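(* Let $X\subset M\subset U\subset\mathbb{R}^n$, where $U$ is open, $M$ is a closed $\mathcal{C}^p$ submanifold of $U$, and $X$ is the closure of its interior as a subset of $M$. Let $f:X\to\mathbb{R}$. If $\nabla^pf:\tau^p(X)\to\mathbb{R}$, then $f$ is the restriction to $X$ of an element of $\mathcal{C}^p(U)$.
   Context: $\mathcal{P}_p$: real polynomials on $\mathbb{R}^n$ of degree $\le p$; $\mathcal{P}_p^*$ dual; $r=\dim\mathcal{P}_p$. For $\xi\in\mathcal{P}_p^*$, $b\in\mathbb{R}^n$, $|\alpha|\le p$: $\xi_\alpha(b):=\xi(\tfrac1{\alpha!}(x-b)^\alpha)$; $\delta_a(P)=P(a)$. A bundle over $X$ with fibres in $W$ is a subset of $X\times W$ with linear-subspace fibres. For a bundle $E\subset X\times\mathcal{P}_p^*$: $\Delta E=\{(a,b,\xi+\eta):a,b\in X,\xi\in E_a,\eta\in E_b,|a-b|^{p-|\alpha|}|\eta_\alpha(b)|\le1\ \forall|\alpha|\le p\}$, $E'=\{(a,\xi):(a,a,\xi)\in\overline{\Delta E}\}$, $\rho(E)=\{(a,\xi):\xi\in\operatorname{Span}E'_a\}$; $\tau^p(X):=\rho^{2r}(E_0)$ with $E_0=\{(a,\lambda\delta_a)\}$ (iterates constant from $2r$ on). For bundles $\Phi\subset X\times(\mathcal{P}_p^*\times\mathbb{R})$: $\Delta\Phi=\{(a,b,\xi+\eta,\lambda+\mu):(\xi,\lambda)\in\Phi_a,(\eta,\mu)\in\Phi_b,|a-b|^{p-|\alpha|}|\eta_\alpha(b)|\le1\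 \forall|\alpha|\le p\}$, $\Phi'=\{(a,\xi,\lambda):(a,a,\xi,\lambda)\in\overline{\Delta\Phi}\}$, $\rho(\Phi)$ fibrewise span of $\Phi'$; $\nabla^pf:=\rho^{2(r+1)}(\Phi_0)$ with $\Phi_0=\{(a,\lambda\delta_a,\lambda f(a))\}$. "$\nabla^pf:\tau^p(X)\to\mathbb{R}$" means each $\xi\in\tau^p_a(X)$ has exactly one $\lambda$ with $(a,\xi,\lambda)\in\nabla^pf$. *)

theory Defs
  imports "HOL-Analysis.Analysis"
begin

type_synonym 'n mindex = "'n \<Rightarrow> nat"

definition mdeg :: "('n::finite) mindex \<Rightarrow> nat" where
  "mdeg \<alpha> = (\<Sum>i\<in>UNIV. \<alpha> i)"

definition mfact :: "('n::finite) mindex \<Rightarrow> real" where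
  "mfact \<alpha> = (\<Prod>i\<in>UNIV. fact (\<alpha> i))"

definition mono :: "('n::finite) mindex \<Rightarrow> real^'n \<Rightarrow> real" where
  "mono \<alpha> x = (\<Prod>i\<in>UNIV. (x $ i) ^ (\<alpha> i))"

definition Idx :: "nat \<Rightarrow> ('n::finite) mindex set" where
  "Idx p = {\<alpha>. mdeg \<alpha> \<le> p}"

definition dimP :: "nat \<Rightarrow> 'n::finite itself \<Rightarrow> nat" where
  "dimP p _ = card (Idx p :: 'n mindex set)"

definition Ppoly :: "nat \<Rightarrow> (real^'n::finite \<Rightarrow> real) set" where
  "Ppoly p = {P. \<exists>c. \<forall>x. P x = (\<Sum>\<alpha>\<in>Idx p. c \<alpha> * mono \<alpha> x)}"

definition pcoeff :: "nat \<Rightarrow> (real^'n::finite \<Rightarrow> real) \<Rightarrow> 'n mindex \<Rightarrow> real" where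
  "pcoeff p P = (THE c. (\<forall>\<alpha>. \<alpha> \<notin> Idx p \<longrightarrow> c \<alpha> = 0) \<and>
                        (\<forall>x. P x = (\<Sum>\<alpha>\<in>Idx p. c \<alpha> * mono \<alpha> x)))"

text \<open>The dual P_p^*: a functional xi is represented by its values xi(x^alpha) on the
  monomial basis (and 0 off the basis index set).\<close>
definition Pdual :: "nat \<Rightarrow> (('n::finite) mindex \<Rightarrow> real) set" where
  "Pdual p = {\<xi>. \<forall>\<alpha>. \<alpha> \<notin> Idx p \<longrightarrow> \<xi> \<alpha> = 0}"

definition dapp :: "nat \<Rightarrow> (('n::finite) mindex \<Rightarrow> real) \<Rightarrow> (real^'n \<Rightarrow> real) \<Rightarrow> real" where
  "dapp p \<xi> P = (\<Sum>\<alpha>\<in>Idx p. pcoeff p P \<alpha> * \<xi> \<alpha>)"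

definition dcomp :: "nat \<Rightarrow> (('n::finite) mindex \<Rightarrow> real) \<Rightarrow> 'n mindex \<Rightarrow> real^'n \<Rightarrow> real" where
  "dcomp p \<xi> \<alpha> b = dapp p \<xi> (\<lambda>x. mono \<alpha> (x - b) / mfact \<alpha>)"

definition delta :: "nat \<Rightarrow> real^'n::finite \<Rightarrow> ('n mindex \<Rightarrow> real)" where
  "delta p a = (\<lambda>\<alpha>. if \<alpha> \<in> Idx p then mono \<alpha> a else 0)"

definition lspan :: "(('n::finite) mindex \<Rightarrow> real) set \<Rightarrow> ('n mindex \<Rightarrow> real) set" where
  "lspan A = {v. \<exists>S c. finite S \<and> S \<subseteq> A \<and> v = (\<lambda>\<alpha>. \<Sum>w\<in>S. c w * w \<alpha>)}"

definition lspan2 :: "((('n::finite) mindex \<Rightarrow> real) \<times> real) set \<Rightarrow> (('n mindex \<Rightarrow> real) \<times> real) set" where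
  "lspan2 A = {v. \<exists>S c. finite S \<and> S \<subseteq> A \<and>
      v = ((\<lambda>\<alpha>. \<Sum>w\<in>S. c w * fst w \<alpha>), (\<Sum>w\<in>S. c w * snd w))}"

definition small :: "nat \<Rightarrow> real^'n::finite \<Rightarrow> real^'n \<Rightarrow> ('n mindex \<Rightarrow> real) \<Rightarrow> bool" where
  "small p a b \<eta> \<longleftrightarrow> (\<forall>\<alpha>\<in>Idx p. norm (a - b) ^ (p - mdeg \<alpha>) * \<bar>dcomp p \<eta> \<alpha> b\<bar> \<le> 1)"

definition DeltaE :: "nat \<Rightarrow> (real^'n::finite) set \<Rightarrow> ((real^'n) \<times> ('n mindex \<Rightarrow> real)) set
    \<Rightarrow> ((real^'n) \<times> (real^'n) \<times> ('n mindex \<Rightarrow> real)) set" where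
  "DeltaE p X E = {(a, b, (\<lambda>\<alpha>. \<xi> \<alpha> + \<eta> \<alpha>)) | a b \<xi> \<eta>. a \<in> X \<and> b \<in> X \<and> (a, \<xi>) \<in> E \<and> (b, \<eta>) \<in> E \<and> small p a b \<eta>}"

definition rhoE :: "nat \<Rightarrow> (real^'n::finite) set \<Rightarrow> ((real^'n) \<times> ('n mindex \<Rightarrow> real)) set
    \<Rightarrow> ((real^'n) \<times> ('n mindex \<Rightarrow> real)) set" where
  "rhoE p X E = {(a, \<xi>). a \<in> X \<and> \<xi> \<in> lspan {\<eta>. (a, a, \<eta>) \<in> closure (DeltaE p X E)}}"

definition E0 :: "nat \<Rightarrow> (real^'n::finite) set \<Rightarrow> ((real^'n) \<times> ('n mindex \<Rightarrow> real)) set" where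
  "E0 p X = {(a, (\<lambda>\<alpha>. c * delta p a \<alpha>)) | a c. a \<in> X}"

definition tau :: "nat \<Rightarrow> (real^'n::finite) set \<Rightarrow> ((real^'n) \<times> ('n mindex \<Rightarrow> real)) set" where
  "tau p X = (rhoE p X ^^ (2 * dimP p TYPE('n))) (E0 p X)"

definition DeltaPhi :: "nat \<Rightarrow> (real^'n::finite) set \<Rightarrow> ((real^'n) \<times> ('n mindex \<Rightarrow> real) \<times> real) set
    \<Rightarrow> ((real^'n) \<times> (real^'n) \<times> ('n mindex \<Rightarrow> real) \<times> real) set" where
  "DeltaPhi p X \<Phi> = {(a, b, (\<lambda>\<alpha>. \<xi> \<alpha> + \<eta> \<alpha>), l + m) | a b \<xi> \<eta> l m.
       a \<in> X \<and> b \<in> X \<and> (a, \<xi>, l) \<in> \<Phi> \<and> (b, \<eta>, m) \<in> \<Phi> \<and> small p a b \<eta>}"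

definition rhoPhi :: "nat \<Rightarrow> (real^'n::finite) set \<Rightarrow> ((real^'n) \<times> ('n mindex \<Rightarrow> real) \<times> real) set
    \<Rightarrow> ((real^'n) \<times> ('n mindex \<Rightarrow> real) \<times> real) set" where
  "rhoPhi p X \<Phi> = {(a, v). a \<in> X \<and> v \<in> lspan2 {w. (a, a, w) \<in> closure (DeltaPhi p X \<Phi>)}}"

definition Phi0 :: "nat \<Rightarrow> (real^'n::finite) set \<Rightarrow> (real^'n \<Rightarrow> real)
    \<Rightarrow> ((real^'n) \<times> ('n mindex \<Rightarrow> real) \<times> real) set" where
  "Phi0 p X f = {(a, (\<lambda>\<alpha>. c * delta p a \<alpha>), c * f a) | a c. a \<in> X}"

definition nabla :: "nat \<Rightarrow> (real^'n::finite) set \<Rightarrow> (real^'n \<Rightarrow> real)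
    \<Rightarrow> ((real^'n) \<times> ('n mindex \<Rightarrow> real) \<times> real) set" where
  "nabla p X f = (rhoPhi p X ^^ (2 * (dimP p TYPE('n) + 1))) (Phi0 p X f)"

definition nabla_is_function :: "nat \<Rightarrow> (real^'n::finite) set \<Rightarrow> (real^'n \<Rightarrow> real) \<Rightarrow> bool" where
  "nabla_is_function p X f \<longleftrightarrow>
     (\<forall>a \<xi>. (a, \<xi>) \<in> tau p X \<longrightarrow> (\<exists>!l. (a, \<xi>, l) \<in> nabla p X f))"

fun Ck_on :: "nat \<Rightarrow> ('a::real_normed_vector \<Rightarrow> 'b::real_normed_vector) \<Rightarrow> 'a set \<Rightarrow> bool" where
  "Ck_on 0 f S = continuous_on S f"
| "Ck_on (Suc k) f S = ((\<forall>x\<in>S. f differentiable (at x)) \<and>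
      (\<forall>v. Ck_on k (\<lambda>x. frechet_derivative f (at x) v) S))"

definition Ck_diffeo :: "nat \<Rightarrow> (real^'n::finite \<Rightarrow> real^'n) \<Rightarrow> (real^'n) set \<Rightarrow> (real^'n) set \<Rightarrow> bool" where
  "Ck_diffeo k \<phi> V W \<longleftrightarrow> open V \<and> open W \<and>
     (\<exists>\<psi>. homeomorphism V W \<phi> \<psi> \<and> Ck_on k \<phi> V \<and> Ck_on k \<psi> W)"

definition closed_Ck_submanifold :: "nat \<Rightarrow> (real^'n::finite) set \<Rightarrow> (real^'n) set \<Rightarrow> bool" where
  "closed_Ck_submanifold k M U \<longleftrightarrow> M \<subseteq> U \<and> closedin (top_of_set U) M \<and>
     (\<forall>x\<in>M. \<exists>V W \<phi> L. x \<in> V \<and> V \<subseteq> U \<and> Ck_diffeo k \<phi> V W \<and> subspace L \<and>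
        \<phi> ` (M \<inter> V) = W \<inter> L)"

end

theory Submission
  imports Defs
begin

text \<open>
  Since the fibres of \<open>\<nabla>\<^sup>p f\<close> are linear, being a function over \<open>\<tau>\<^sup>p(X)\<close> forces that no fibre contains
  the vertical vector \<open>(0, 1)\<close>; this makes the \<open>\<lambda>\<close>-components of all limits in the construction bounded,
  hence convergent along subsequences to uniquely determined values.

  In a chart, let \<open>\<psi>\<close> parametrise \<open>M\<close> by an open subset of a linear subspace \<open>L\<close> with projection \<open>\<pi>\<close>.
  Difference quotients put the functional \<open>P \<mapsto> D\<^sub>v\<^sup>k(P \<circ> \<psi>)(z)\<close> into the \<open>k\<close>-th iterate at interior
  points, and limits put it into the next iterate at all points of \<open>X\<close>. By linearity
  \<open>P \<mapsto> T\<^sub>z(P \<circ> \<psi>)(\<pi> x)\<close> lies there too, and its value \<open>G\<^sub>z(x)\<close> under \<open>\<nabla>\<^sup>p f\<close> is a polynomial in \<open>x\<close>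
  with \<open>G\<^sub>z(z) = f(\<psi> z)\<close>. One more iterate, applied to the difference of these functionals at \<open>y\<close> and \<open>z\<close>
  divided by \<open>|y - z|\<^sup>p\<close>, which tends to \<open>0\<close> by Taylor's theorem, gives
  \<open>|G\<^sub>y - G\<^sub>z| = o(|y - z|\<^sup>p)\<close> on the ball of radius \<open>|y - z|\<close> about \<open>z\<close>. This is Whitney's condition, so
  Whitney's extension theorem yields an extension near every point, and a partition of unity glues them.
  Only \<open>p + 2\<close> iterates are used, so no stabilisation of the iteration is needed.
\<close>

section \<open>Calculus of iterated directional derivatives\<close>

text \<open>The test \<open>small\<close> weighs the component of index \<alpha> by |a - b|^(p -
  |\<alpha>|), and the proof matches this with vanishing orders. The monomial of index \<alpha>
  centred at \<open>\<psi> z\<close> vanishes to order |\<alpha>| at z, so k derivatives along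
  vectors of length about h give it a component of size h^|\<alpha>|, while |\<psi> y - \<psi> z| is
  at most a multiple of h = |y - z|. Each weighted component of a Taylor functional is thus O(h^p),
  which permits division by h^p; for a fixed direction it is O(t^(p - k)) at step t, which permits
  the difference quotient exactly while k < p. The constants \<open>D\<close> only bring these
  bounds below 1 and are undone by linearity.

  A Whitney field is kept as whole polynomials compared on balls, since \<open>nabla\<close>
  delivers values of functionals and not separate derivatives; a Markov-type inequality turns a
  bound on a ball into derivative bounds.

  The averaging construction is written once, for any positive 1-Lipschitz length scale. It serves
  Whitney's theorem with the distance to the closed set, and the gluing with the Lebesgue radius of
  the cover.

  \<open>Ck_on\<close> treats one fixed direction at a time, so uniformity over directions always
  comes from expansion in a basis.\<close>

lemma Ck_on_cong_open:
  assumes "open S" "\<And>x. x \<in> S \<Longrightarrow> f x = g x" "Ck_on k f S"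
  shows "Ck_on k g S"
  using assms(2,3)
proof (induction k arbitrary: f g)
  case 0
  then show ?case by (metis Ck_on.simps(1) continuous_on_cong)
next
  case (Suc k)
  have der: "(g has_derivative frechet_derivative f (at x)) (at x)" if "x \<in> S" for x
    using Suc.prems that assms(1)
    by (intro has_derivative_transform_within_open[of f _ x UNIV S g])
       (auto simp: frechet_derivative_works[symmetric])
  then have "frechet_derivative g (at x) = frechet_derivative f (at x)" if "x \<in> S" for x
    using frechet_derivative_at that by metis
  then have "Ck_on k (\<lambda>x. frechet_derivative g (at x) v) S" for v
    using Suc.prems by - (rule Suc.IH[of "\<lambda>x. frechet_derivative f (at x) v"]; auto)
  then show ?case using der by (auto simp: differentiable_def)
qed

text \<open>Frechet derivatives are unique, so on an open set an explicit \<open>D\<close> may stand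
  in for \<open>frechet_derivative\<close>. Most closure properties below are proved through this
  rule.\<close>

lemma Ck_on_SucI:
  assumes "open S" "\<And>x. x \<in> S \<Longrightarrow> (f has_derivative D x) (at x)"
    and "\<And>v. Ck_on k (\<lambda>x. D x v) S"
  shows "Ck_on (Suc k) f S"
proof -
  have "D x = frechet_derivative f (at x)" if "x \<in> S" for x
    using assms(2)[OF that] by (rule frechet_derivative_at)
  then have "Ck_on k (\<lambda>x. frechet_derivative f (at x) v) S" for v
    by - (rule Ck_on_cong_open[OF assms(1) _ assms(3)[of v]]; auto)
  then show ?thesis using assms(2) by (auto simp: differentiable_def)
qed

lemma Ck_on_has_derivative:
  "Ck_on (Suc k) f S \<Longrightarrow> x \<in> S \<Longrightarrow> (f has_derivative frechet_derivative f (at x)) (at x)"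
  by (auto simp: frechet_derivative_works[symmetric])

lemma Ck_on_SucD: "Ck_on (Suc k) f S \<Longrightarrow> Ck_on k f S"
proof (induction k arbitrary: f)
  case 0
  then show ?case
    by (auto intro!: continuous_at_imp_continuous_on differentiable_imp_continuous_within)
next
  case (Suc k)
  have "Ck_on k (\<lambda>x. frechet_derivative f (at x) v) S" for v
    by (rule Suc.IH) (use Suc.prems in simp)
  then show ?case using Suc.prems by simp
qed

lemma Ck_on_le: "Ck_on k f S \<Longrightarrow> j \<le> k \<Longrightarrow> Ck_on j f S"
  by (induction k) (auto simp: le_Suc_eq simp del: Ck_on.simps dest: Ck_on_SucD)

lemma Ck_on_continuous_on: "Ck_on k f S \<Longrightarrow> continuous_on S f"
  using Ck_on_le[of k f S 0] by simp

lemma Ck_on_subset: "Ck_on k f S \<Longrightarrow> T \<subseteq> S \<Longrightarrow> Ck_on k f T"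
  by (induction k arbitrary: f) (auto intro: continuous_on_subset)

lemma Ck_on_local:
  assumes "\<And>x. x \<in> S \<Longrightarrow> \<exists>T. open T \<and> x \<in> T \<and> Ck_on k f T"
  shows "Ck_on k f S"
  using assms
proof (induction k arbitrary: f)
  case 0
  have "isCont f x" if "x \<in> S" for x
    using 0[OF that] by (auto simp: continuous_on_eq_continuous_at)
  then show ?case by (simp add: continuous_at_imp_continuous_on)
next
  case (Suc k)
  have "f differentiable (at x)" if "x \<in> S" for x
    using Suc.prems[OF that] by auto
  moreover have "Ck_on k (\<lambda>x. frechet_derivative f (at x) v) S" for v
    by (rule Suc.IH) (use Suc.prems in fastforce)
  ultimately show ?case by simp
qed

lemma Ck_on_const: "Ck_on k (\<lambda>x. c) S"
  by (induction k arbitrary: c) auto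

lemma Ck_on_bounded_linear:
  assumes "bounded_linear T" "open S"
  shows "Ck_on k T S"
proof (cases k)
  case 0
  then show ?thesis using assms by (simp add: linear_continuous_on)
next
  case (Suc j)
  have "Ck_on (Suc j) T S"
    by (rule Ck_on_SucI[where D="\<lambda>x. T"])
       (use assms in \<open>auto intro: bounded_linear_imp_has_derivative Ck_on_const\<close>)
  then show ?thesis by (simp add: Suc)
qed

lemma Ck_on_bounded_linear_comp:
  assumes "bounded_linear T" "open S" "Ck_on k f S"
  shows "Ck_on k (\<lambda>x. T (f x)) S"
  using assms(3)
proof (induction k arbitrary: f)
  case 0
  then show ?case using assms(1) by (simp add: bounded_linear.continuous_on)
next
  case (Suc k)
  show ?case
    by (rule Ck_on_SucI[where D="\<lambda>x v. T (frechet_derivative f (at x) v)"])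
       (use Suc assms Ck_on_has_derivative[OF Suc.prems]
        in \<open>auto intro: bounded_linear.has_derivative\<close>)
qed

lemma Ck_on_add:
  assumes "open S" "Ck_on k f S" "Ck_on k g S"
  shows "Ck_on k (\<lambda>x. f x + g x) S"
  using assms(2,3)
proof (induction k arbitrary: f g)
  case 0
  then show ?case by (auto intro: continuous_on_add)
next
  case (Suc k)
  show ?case
    by (rule Ck_on_SucI[where D="\<lambda>x v. frechet_derivative f (at x) v + frechet_derivative g (at x) v"])
       (use Suc assms Ck_on_has_derivative[OF Suc.prems(1)] Ck_on_has_derivative[OF Suc.prems(2)]
        in \<open>auto intro: has_derivative_add\<close>)
qed

lemma Ck_on_mult:
  fixes f g :: "'a::real_normed_vector \<Rightarrow> real"
  assumes "open S" "Ck_on k f S" "Ck_on k g S"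
  shows "Ck_on k (\<lambda>x. f x * g x) S"
  using assms(2,3)
proof (induction k arbitrary: f g)
  case 0
  then show ?case by (auto intro: continuous_on_mult)
next
  case (Suc k)
  have "Ck_on k f S" "Ck_on k g S" using Suc.prems Ck_on_SucD by blast+
  then show ?case
    by - (rule Ck_on_SucI[where D="\<lambda>x v. f x * frechet_derivative g (at x) v + frechet_derivative f (at x) v * g x"];
       use Suc assms Ck_on_has_derivative[OF Suc.prems(1)] Ck_on_has_derivative[OF Suc.prems(2)]
        in \<open>auto intro!: has_derivative_mult Ck_on_add\<close>)
qed

lemma Ck_on_cmult:
  fixes f :: "'a::real_normed_vector \<Rightarrow> real"
  shows "open S \<Longrightarrow> Ck_on k f S \<Longrightarrow> Ck_on k (\<lambda>x. c * f x) S"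
  by (intro Ck_on_mult Ck_on_const)

lemma Ck_on_diff:
  fixes f :: "'a::real_normed_vector \<Rightarrow> real"
  assumes "open S" "Ck_on k f S" "Ck_on k g S"
  shows "Ck_on k (\<lambda>x. f x - g x) S"
  using Ck_on_add[OF assms(1,2) Ck_on_cmult[OF assms(1,3), of "-1"]] by simp

lemma Ck_on_sum:
  fixes f :: "'i \<Rightarrow> 'a::real_normed_vector \<Rightarrow> 'b::real_normed_vector"
  assumes "open S" "\<And>i. i \<in> I \<Longrightarrow> Ck_on k (f i) S"
  shows "Ck_on k (\<lambda>x. \<Sum>i\<in>I. f i x) S"
  using assms(2)
proof (induction I rule: infinite_finite_induct)
  case (insert i I)
  then show ?case using Ck_on_add[OF assms(1), of k "f i" "\<lambda>x. \<Sum>i\<in>I. f i x"] by simp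
qed (auto simp: Ck_on_const)

lemma Ck_on_prod:
  fixes f :: "'i \<Rightarrow> 'a::real_normed_vector \<Rightarrow> real"
  assumes "open S" "\<And>i. i \<in> I \<Longrightarrow> Ck_on k (f i) S"
  shows "Ck_on k (\<lambda>x. \<Prod>i\<in>I. f i x) S"
  using assms(2)
proof (induction I rule: infinite_finite_induct)
  case (insert i I)
  then show ?case using Ck_on_mult[OF assms(1), of k "f i" "\<lambda>x. \<Prod>i\<in>I. f i x"] by simp
qed (auto simp: Ck_on_const)

lemma Ck_on_power:
  fixes f :: "'a::real_normed_vector \<Rightarrow> real"
  assumes "open S" "Ck_on k f S"
  shows "Ck_on k (\<lambda>x. f x ^ m) S"
  by (induction m) (auto intro!: Ck_on_const Ck_on_mult assms)

lemma Ck_on_inverse: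
  fixes f :: "'a::real_normed_vector \<Rightarrow> real"
  assumes "open S" "Ck_on k f S" "\<And>x. x \<in> S \<Longrightarrow> f x \<noteq> 0"
  shows "Ck_on k (\<lambda>x. inverse (f x)) S"
  using assms(2)
proof (induction k)
  case 0
  then show ?case using assms by (auto intro: continuous_on_inverse)
next
  case (Suc k)
  have *: "Ck_on k (\<lambda>x. inverse (f x)) S" using Suc Ck_on_SucD by blast
  have "Ck_on k (\<lambda>x. (-1) * (inverse (f x) * frechet_derivative f (at x) v * inverse (f x))) S" for v
    using * Suc.prems by (intro Ck_on_cmult Ck_on_mult assms(1)) auto
  then show ?case
    by - (rule Ck_on_SucI[where D="\<lambda>x v. - (inverse (f x) * frechet_derivative f (at x) v * inverse (f x))"];
       use assms Ck_on_has_derivative[OF Suc.prems] in \<open>auto intro!: Deriv.has_derivative_inverse\<close>)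
qed

lemma has_derivative_euclidean_expand:
  fixes f :: "'a::euclidean_space \<Rightarrow> 'b::real_normed_vector"
  assumes "f differentiable (at x)"
  shows "frechet_derivative f (at x) v = (\<Sum>b\<in>Basis. (v \<bullet> b) *\<^sub>R frechet_derivative f (at x) b)"
proof -
  have "linear (frechet_derivative f (at x))"
    using assms by (rule linear_frechet_derivative)
  then have "frechet_derivative f (at x) (\<Sum>b\<in>Basis. (v \<bullet> b) *\<^sub>R b) =
      (\<Sum>b\<in>Basis. (v \<bullet> b) *\<^sub>R frechet_derivative f (at x) b)"
    by (simp only: linear_sum linear_cmul)
  then show ?thesis by (simp only: euclidean_representation)
qed

text \<open>The direction \<open>frechet_derivative \<phi> (at x) v\<close> moves with x, whereas
  \<open>Ck_on\<close> controls fixed directions only. Expanding it in the basis turns the chain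
  rule into a finite sum of products to which the induction hypothesis applies.\<close>

lemma Ck_on_compose:
  fixes H :: "'b::euclidean_space \<Rightarrow> real" and \<phi> :: "'a::real_normed_vector \<Rightarrow> 'b"
  assumes "open S" "open T" "\<phi> ` S \<subseteq> T" "Ck_on k H T" "Ck_on k \<phi> S"
  shows "Ck_on k (\<lambda>x. H (\<phi> x)) S"
  using assms(4,5)
proof (induction k arbitrary: H)
  case 0
  then show ?case using assms(3) by (auto intro: continuous_on_compose2)
next
  case (Suc k)
  have hd: "((\<lambda>x. H (\<phi> x)) has_derivative
     (\<lambda>v. frechet_derivative H (at (\<phi> x)) (frechet_derivative \<phi> (at x) v))) (at x)" if "x \<in> S" for x
    using diff_chain_at[OF Ck_on_has_derivative[OF Suc.prems(2) that]
        Ck_on_has_derivative[OF Suc.prems(1), of "\<phi> x"]] that assms(3)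
    by (auto simp: o_def)
  have eq: "frechet_derivative H (at (\<phi> x)) (frechet_derivative \<phi> (at x) v) =
     (\<Sum>b\<in>Basis. (frechet_derivative \<phi> (at x) v \<bullet> b) * frechet_derivative H (at (\<phi> x)) b)"
    if "x \<in> S" for x v
    using has_derivative_euclidean_expand[of H "\<phi> x"] Suc.prems(1) that assms(3) by auto
  have \<phi>k: "Ck_on k \<phi> S" using Suc.prems(2) by (rule Ck_on_SucD)
  have 1: "Ck_on k (\<lambda>x. (frechet_derivative \<phi> (at x) v \<bullet> b)) S" for v b
    by (rule Ck_on_bounded_linear_comp[OF bounded_linear_inner_left assms(1)])
       (use Suc.prems(2) in auto)
  have 2: "Ck_on k (\<lambda>x. frechet_derivative H (at (\<phi> x)) b) S" for b
    using Suc.IH[of "\<lambda>y. frechet_derivative H (at y) b"] Suc.prems(1) \<phi>k by simp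
  show ?case
  proof (rule Ck_on_SucI[OF assms(1) hd])
    fix v
    show "Ck_on k (\<lambda>x. frechet_derivative H (at (\<phi> x)) (frechet_derivative \<phi> (at x) v)) S"
      by (rule Ck_on_cong_open[OF assms(1), of "\<lambda>x. (\<Sum>b\<in>Basis. (frechet_derivative \<phi> (at x) v \<bullet> b) * frechet_derivative H (at (\<phi> x)) b)"])
         (auto simp: eq intro!: Ck_on_sum assms(1) Ck_on_mult 1 2)
  qed
qed

section \<open>Iterated derivatives along lists of directions\<close>

fun Dl :: "'a::real_normed_vector list \<Rightarrow> ('a \<Rightarrow> real) \<Rightarrow> 'a \<Rightarrow> real" where
  "Dl [] f = f"
| "Dl (v # vs) f = Dl vs (\<lambda>x. frechet_derivative f (at x) v)"

text \<open>Directions are consumed from the head, so a vector appended at the end differentiates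
  the function \<open>Dl vs f\<close> once more. This is the form in which derivatives of
  derivatives are handled below.\<close>

lemma Dl_append: "Dl (us @ vs) f = Dl vs (Dl us f)"
  by (induction us arbitrary: f) auto

lemma Dl_cong:
  assumes "open S" "\<And>x. x \<in> S \<Longrightarrow> f x = g x" "Ck_on (length vs) f S" "x \<in> S"
  shows "Dl vs f x = Dl vs g x"
  using assms(2,3)
proof (induction vs arbitrary: f g)
  case Nil
  then show ?case using assms by simp
next
  case (Cons v vs)
  have "frechet_derivative f (at y) = frechet_derivative g (at y)" if "y \<in> S" for y
    by (rule frechet_derivative_transform_within_open[OF _ assms(1) that])
       (use Cons.prems that in auto)
  then show ?case using Cons.prems by (auto intro!: Cons.IH)
qed

lemma Ck_on_Dl: "Ck_on (k + length vs) f S \<Longrightarrow> Ck_on k (Dl vs f) S"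
  by (induction vs arbitrary: f) auto

lemma Dl_const: "Dl vs (\<lambda>x. c) x = (if vs = [] then c else 0)"
proof -
  have "Dl vs (\<lambda>x. 0) = (\<lambda>x::'a. 0)" for vs by (induction vs) auto
  then show ?thesis by (cases vs) auto
qed

lemma Dl_add:
  assumes "open S" "Ck_on (length vs) f S" "Ck_on (length vs) g S" "x \<in> S"
  shows "Dl vs (\<lambda>x. f x + g x) x = Dl vs f x + Dl vs g x"
  using assms(2,3)
proof (induction vs arbitrary: f g)
  case Nil
  then show ?case by simp
next
  case (Cons v vs)
  have "frechet_derivative (\<lambda>x. f x + g x) (at y) =
    (\<lambda>v. frechet_derivative f (at y) v + frechet_derivative g (at y) v)" if "y \<in> S" for y
    by (rule frechet_derivative_at[symmetric])
       (use Cons.prems that Ck_on_has_derivative in \<open>auto intro!: has_derivative_add\<close>)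
  then have "Dl (v # vs) (\<lambda>x. f x + g x) x
     = Dl vs (\<lambda>y. frechet_derivative f (at y) v + frechet_derivative g (at y) v) x"
    unfolding Dl.simps
    by - (rule Dl_cong[OF assms(1)];
       use Cons.prems Ck_on_add[OF assms(1) Cons.prems] assms in auto)
  also have "\<dots> = Dl (v # vs) f x + Dl (v # vs) g x"
    using Cons by auto
  finally show ?case .
qed

lemma Dl_cmult:
  assumes "open S" "Ck_on (length vs) f S" "x \<in> S"
  shows "Dl vs (\<lambda>x. c * f x) x = c * Dl vs f x"
  using assms(2)
proof (induction vs arbitrary: f)
  case Nil
  then show ?case by simp
next
  case (Cons v vs)
  have "frechet_derivative (\<lambda>x. c * f x) (at y) =
    (\<lambda>v. c * frechet_derivative f (at y) v)" if "y \<in> S" for y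
    by (rule frechet_derivative_at[symmetric])
       (use Cons.prems that Ck_on_has_derivative in \<open>auto intro!: has_derivative_mult_right\<close>)
  then have "Dl (v # vs) (\<lambda>x. c * f x) x = Dl vs (\<lambda>y. c * frechet_derivative f (at y) v) x"
    unfolding Dl.simps
    by - (rule Dl_cong[OF assms(1)];
       use Cons.prems Ck_on_cmult[OF assms(1) Cons.prems] assms in auto)
  then show ?case using Cons by auto
qed

lemma Dl_diff:
  assumes "open S" "Ck_on (length vs) f S" "Ck_on (length vs) g S" "x \<in> S"
  shows "Dl vs (\<lambda>x. f x - g x) x = Dl vs f x - Dl vs g x"
  using Dl_add[OF assms(1,2) Ck_on_cmult[OF assms(1,3), of "-1"] assms(4)] Dl_cmult[OF assms(1,3,4), of "-1"]
  by simp

lemma Dl_sum: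
  assumes "open S" "\<And>i. i \<in> I \<Longrightarrow> Ck_on (length vs) (f i) S" "x \<in> S"
  shows "Dl vs (\<lambda>x. \<Sum>i\<in>I. f i x) x = (\<Sum>i\<in>I. Dl vs (f i) x)"
  using assms(2)
proof (induction I rule: infinite_finite_induct)
  case (insert i I)
  then show ?case
    using Dl_add[OF assms(1), of vs "f i" "\<lambda>x. \<Sum>i\<in>I. f i x" x] Ck_on_sum[OF assms(1), of I _ f] assms(3)
    by simp
qed (auto simp: Dl_const)

text \<open>Linearity of the derivative in the head direction survives the later differentiations
  because the coefficients \<open>v \<bullet> b\<close> do not depend on the point.\<close>

lemma Dl_expand:
  fixes f :: "'a::euclidean_space \<Rightarrow> real"
  assumes "open S" "Ck_on (Suc (length vs)) f S" "x \<in> S"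
  shows "Dl (v # vs) f x = (\<Sum>b\<in>Basis. (v \<bullet> b) * Dl (b # vs) f x)"
proof -
  have "Dl (v # vs) f x = Dl vs (\<lambda>x. \<Sum>b\<in>Basis. (v \<bullet> b) * frechet_derivative f (at x) b) x"
    unfolding Dl.simps
    by (rule Dl_cong[OF assms(1)])
       (use assms in \<open>auto simp: has_derivative_euclidean_expand[of f _ v] intro!: Ck_on_sum Ck_on_cmult\<close>)
  also have "\<dots> = (\<Sum>b\<in>Basis. Dl vs (\<lambda>x. (v \<bullet> b) * frechet_derivative f (at x) b) x)"
    by (intro Dl_sum[OF assms(1)] Ck_on_cmult assms) (use assms in auto)
  also have "\<dots> = (\<Sum>b\<in>Basis. (v \<bullet> b) * Dl (b # vs) f x)"
    using assms by (intro sum.cong) (auto intro!: Dl_cmult)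
  finally show ?thesis .
qed

text \<open>Meant for a function defined by cases, such as Whitney's extension: all its derivatives
  are prescribed in advance and only one differentiation at a time has to be verified. The induction
  passes to the subfamily of lists with a given head.\<close>

lemma Ck_on_from_family:
  fixes F :: "'a::real_normed_vector list \<Rightarrow> 'a \<Rightarrow> real"
  assumes "open S"
    and "\<And>vs x. length vs < p \<Longrightarrow> x \<in> S \<Longrightarrow> (F vs has_derivative (\<lambda>v. F (vs @ [v]) x)) (at x)"
    and "\<And>vs. length vs = p \<Longrightarrow> continuous_on S (F vs)"
  shows "Ck_on p (F []) S"
  using assms(2,3)
proof (induction p arbitrary: F)
  case 0
  then show ?case by simp
next
  case (Suc p)
  have "Ck_on p (F [v]) S" for v
    using Suc.IH[of "\<lambda>vs. F (v # vs)"] Suc.prems(1)[of "v # _"] Suc.prems(2)[of "v # _"] by simp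
  then show ?case
    using Suc.prems(1)[of "[]"] by - (rule Ck_on_SucI[OF assms(1), where D="\<lambda>x v. F [v] x"]; auto)
qed

lemma Dl_has_derivative:
  assumes "Ck_on p f S" "length vs < p" "x \<in> S"
  shows "(Dl vs f has_derivative (\<lambda>v. Dl (vs @ [v]) f x)) (at x)"
proof -
  have "Ck_on (Suc 0) (Dl vs f) S"
    by (rule Ck_on_Dl) (use assms in \<open>auto intro: Ck_on_le simp del: Ck_on.simps\<close>)
  from Ck_on_has_derivative[OF this assms(3)] show ?thesis
    by (simp add: Dl_append)
qed

lemma Dl_continuous_on:
  assumes "Ck_on p f S" "length vs \<le> p"
  shows "continuous_on S (Dl vs f)"
  using Ck_on_Dl[of 0 vs f S] assms by (auto intro: Ck_on_le simp del: Ck_on.simps(2))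

text \<open>Measuring every direction against the length scale \<open>h\<close> makes these bounds multiplicative
  up to a factor that depends on \<open>k\<close> only.\<close>

definition dbd :: "nat \<Rightarrow> real \<Rightarrow> real \<Rightarrow> ('a::real_normed_vector \<Rightarrow> real) \<Rightarrow> 'a \<Rightarrow> bool" where
  "dbd k A h f x \<longleftrightarrow> (\<forall>vs. length vs \<le> k \<longrightarrow> \<bar>Dl vs f x\<bar> \<le> A * (\<Prod>v\<leftarrow>vs. norm v / h))"

lemma dbdD: "dbd k A h f x \<Longrightarrow> length vs \<le> k \<Longrightarrow> \<bar>Dl vs f x\<bar> \<le> A * (\<Prod>v\<leftarrow>vs. norm v / h)"
  by (auto simp: dbd_def)

lemma dbd_value: "dbd k A h f x \<Longrightarrow> \<bar>f x\<bar> \<le> A"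
  using dbdD[of k A h f x "[]"] by simp

lemma dbd_nonneg: "dbd k A h f x \<Longrightarrow> 0 \<le> A"
  using dbd_value[of k A h f x] by simp

lemma norm_prod_nonneg: "h > 0 \<Longrightarrow> 0 \<le> (\<Prod>v\<leftarrow>vs. norm v / h)"
  by (induction vs) auto

lemma norm_prod_mono: "0 < h' \<Longrightarrow> h' \<le> h \<Longrightarrow> (\<Prod>v\<leftarrow>vs. norm v / h) \<le> (\<Prod>v\<leftarrow>vs. norm v / h')"
  by (induction vs) (auto intro!: frac_le mult_left_mono norm_prod_nonneg mult_nonneg_nonneg)

lemma dbd_mono: "dbd k A h f x \<Longrightarrow> A \<le> B \<Longrightarrow> h > 0 \<Longrightarrow> dbd k B h f x"
  using mult_right_mono[OF _ norm_prod_nonneg[of h], of A B]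
  by (fastforce simp: dbd_def intro: order_trans)

lemma dbd_le: "dbd k A h f x \<Longrightarrow> j \<le> k \<Longrightarrow> dbd j A h f x"
  unfolding dbd_def by auto

lemma dbd_shrink: "dbd k A h f x \<Longrightarrow> 0 < h' \<Longrightarrow> h' \<le> h \<Longrightarrow> dbd k A h' f x"
  using mult_left_mono[OF norm_prod_mono[of h' h]] dbd_nonneg[of k A h f x]
  by (fastforce simp: dbd_def intro: order_trans)

lemma dbd_pd: "dbd (Suc k) A h f x \<Longrightarrow> dbd k (A * (norm v / h)) h (\<lambda>x. frechet_derivative f (at x) v) x"
  using dbdD[of "Suc k" A h f x "v # _"] by (auto simp: dbd_def mult.assoc)

lemma dbd_SucI:
  assumes "\<bar>f x\<bar> \<le> A" "\<And>v. dbd k (A * (norm v / h)) h (\<lambda>x. frechet_derivative f (at x) v) x"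
  shows "dbd (Suc k) A h f x"
  unfolding dbd_def
proof (intro allI impI)
  fix vs :: "'a list" assume "length vs \<le> Suc k"
  then show "\<bar>Dl vs f x\<bar> \<le> A * (\<Prod>v\<leftarrow>vs. norm v / h)"
    using assms dbdD[OF assms(2)] by (cases vs) (auto simp: mult.assoc)
qed

lemma dbd_cong:
  assumes "open S" "\<And>x. x \<in> S \<Longrightarrow> f x = g x" "Ck_on k f S" "x \<in> S" "dbd k A h f x"
  shows "dbd k A h g x"
  unfolding dbd_def
proof (intro allI impI)
  fix vs :: "'a list" assume l: "length vs \<le> k"
  have "Dl vs f x = Dl vs g x"
    by (rule Dl_cong[OF assms(1,2) Ck_on_le[OF assms(3) l] assms(4)])
  then show "\<bar>Dl vs g x\<bar> \<le> A * (\<Prod>v\<leftarrow>vs. norm v / h)"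
    using dbdD[OF assms(5) l] by simp
qed

lemma dbd_add:
  assumes "open S" "x \<in> S" "Ck_on k f S" "Ck_on k g S" "dbd k A h f x" "dbd k B h g x"
  shows "dbd k (A + B) h (\<lambda>x. f x + g x) x"
  unfolding dbd_def
proof (intro allI impI)
  fix vs :: "'a list" assume "length vs \<le> k"
  then show "\<bar>Dl vs (\<lambda>x. f x + g x) x\<bar> \<le> (A + B) * (\<Prod>v\<leftarrow>vs. norm v / h)"
    using Dl_add[OF assms(1) _ _ assms(2), of vs f g] Ck_on_le[OF assms(3)] Ck_on_le[OF assms(4)]
      dbdD[OF assms(5), of vs] dbdD[OF assms(6), of vs]
    by (auto simp: distrib_right)
qed

lemma dbd_const: "h > 0 \<Longrightarrow> dbd k \<bar>c\<bar> h (\<lambda>x. c) x"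
  unfolding dbd_def by (auto simp: Dl_const norm_prod_nonneg)

lemma dbd_sum:
  assumes "open S" "x \<in> S" "\<And>i. i \<in> I \<Longrightarrow> Ck_on k (f i) S" "h > 0" "\<And>i. i \<in> I \<Longrightarrow> dbd k (A i) h (f i) x"
  shows "dbd k (\<Sum>i\<in>I. A i) h (\<lambda>x. \<Sum>i\<in>I. f i x) x"
  using assms(3,5)
proof (induction I rule: infinite_finite_induct)
  case (insert i I)
  then show ?case
    using dbd_add[OF assms(1,2), of k "f i" "\<lambda>x. \<Sum>i\<in>I. f i x" "A i" h "\<Sum>i\<in>I. A i"]
      Ck_on_sum[OF assms(1), of I k f] by simp
qed (use dbd_const[OF assms(4), of _ 0] in auto)

text \<open>Each use of the product rule doubles the number of terms. The factor
  \<open>norm v / h\<close> goes into the bound of whichever factor is differentiated, so both terms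
  have the same size, and the resulting \<open>2 ^ k\<close> does not depend on h.\<close>

lemma dbd_mult:
  assumes "open S" "x \<in> S" "Ck_on k f S" "Ck_on k g S" "h > 0" "dbd k A h f x" "dbd k B h g x"
  shows "dbd k (2 ^ k * A * B) h (\<lambda>x. f x * g x) x"
  using assms(3,4,6,7)
proof (induction k arbitrary: f g A B)
  case 0
  then show ?case
    using dbd_value[OF 0(3)] dbd_value[OF 0(4)] by (auto simp: dbd_def abs_mult mult_mono)
next
  case (Suc k)
  have nn: "0 \<le> A" "0 \<le> B" using Suc.prems dbd_nonneg by blast+
  show ?case
  proof (rule dbd_SucI)
    have "\<bar>f x * g x\<bar> \<le> A * B"
      using dbd_value[OF Suc.prems(3)] dbd_value[OF Suc.prems(4)] nn by (auto simp: abs_mult mult_mono)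
    also have "\<dots> \<le> 2 ^ Suc k * (A * B)"
      using nn one_le_power[of "2::real" "Suc k"] mult_right_mono[of 1 "2 ^ Suc k" "A * B"] by simp
    finally show "\<bar>f x * g x\<bar> \<le> 2 ^ Suc k * A * B" by (simp add: mult.assoc)
  next
    fix v
    let ?f = "\<lambda>x. frechet_derivative f (at x) v" and ?g = "\<lambda>x. frechet_derivative g (at x) v"
    have C: "Ck_on k f S" "Ck_on k g S" "Ck_on k ?f S" "Ck_on k ?g S"
      using Suc.prems Ck_on_SucD by auto
    have 1: "dbd k (2 ^ k * A * (B * (norm v / h))) h (\<lambda>x. f x * ?g x) x"
      by (rule Suc.IH) (use C Suc.prems dbd_pd in \<open>auto intro: dbd_le\<close>)
    have 2: "dbd k (2 ^ k * (A * (norm v / h)) * B) h (\<lambda>x. ?f x * g x) x"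
      by (rule Suc.IH) (use C Suc.prems dbd_pd in \<open>auto intro: dbd_le\<close>)
    have "dbd k (2 ^ k * A * (B * (norm v / h)) + 2 ^ k * (A * (norm v / h)) * B) h
       (\<lambda>x. f x * ?g x + ?f x * g x) x"
      by (rule dbd_add[OF assms(1,2) _ _ 1 2]) (intro Ck_on_mult assms C)+
    moreover have "frechet_derivative (\<lambda>x. f x * g x) (at y) v = f y * ?g y + ?f y * g y" if "y \<in> S" for y
      using frechet_derivative_at[OF has_derivative_mult[OF Ck_on_has_derivative[OF Suc.prems(1) that]
          Ck_on_has_derivative[OF Suc.prems(2) that]]] by metis
    moreover have "Ck_on k (\<lambda>x. f x * ?g x + ?f x * g x) S"
      by (intro Ck_on_add Ck_on_mult assms C)
    ultimately have "dbd k (2 ^ k * A * (B * (norm v / h)) + 2 ^ k * (A * (norm v / h)) * B) h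
       (\<lambda>x. frechet_derivative (\<lambda>x. f x * g x) (at x) v) x"
      using dbd_cong[OF assms(1) _ _ assms(2), of "\<lambda>x. f x * ?g x + ?f x * g x"] by simp
    then show "dbd k (2 ^ Suc k * A * B * (norm v / h)) h (\<lambda>x. frechet_derivative (\<lambda>x. f x * g x) (at x) v) x"
      by (simp add: algebra_simps)
  qed
qed

lemma dbd_power:
  assumes "open S" "x \<in> S" "Ck_on k f S" "h > 0" "dbd k A h f x"
  shows "dbd k ((2 ^ k * A) ^ m) h (\<lambda>x. f x ^ m) x"
proof (induction m)
  case 0
  then show ?case using dbd_const[OF assms(4), of k 1] by simp
next
  case (Suc m)
  then show ?case
    using dbd_mult[OF assms(1,2,3) _ assms(4,5) Suc] Ck_on_power[OF assms(1,3)] by simp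
qed

lemma dbd_prod:
  assumes "open S" "x \<in> S" "\<And>i. i \<in> I \<Longrightarrow> Ck_on k (f i) S" "h > 0" "\<And>i. i \<in> I \<Longrightarrow> dbd k (A i) h (f i) x"
  shows "dbd k (\<Prod>i\<in>I. 2 ^ k * A i) h (\<lambda>x. \<Prod>i\<in>I. f i x) x"
  using assms(3,5)
proof (induction I rule: infinite_finite_induct)
  case (insert i I)
  then show ?case
    using dbd_mult[OF assms(1,2), of k "f i" "\<lambda>x. \<Prod>i\<in>I. f i x" h "A i" "\<Prod>i\<in>I. 2 ^ k * A i"]
      Ck_on_prod[OF assms(1), of I k f] assms(4) by simp
qed (use dbd_const[OF assms(4), of k 1] in auto)

text \<open>The condition \<open>h \<le> A\<close> makes the slope fit the scale, since then
  \<open>norm v\<close> is at most \<open>A * (norm v / h)\<close>. Derivatives of higher order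
  vanish.\<close>

lemma dbd_affine:
  fixes T :: "'a::real_normed_vector \<Rightarrow> real"
  assumes "bounded_linear T" "\<And>v. \<bar>T v\<bar> \<le> norm v" "\<bar>T x + c\<bar> \<le> A" "0 < h" "h \<le> A"
  shows "dbd k A h (\<lambda>x. T x + c) x"
proof (cases k)
  case 0
  then show ?thesis using assms by (simp add: dbd_def)
next
  case (Suc j)
  have fd: "frechet_derivative (\<lambda>x. T x + c) (at y) = T" for y
    using bounded_linear_imp_has_derivative[OF assms(1)]
    by (intro frechet_derivative_at[symmetric]) (auto intro!: derivative_eq_intros)
  have "dbd (Suc j) A h (\<lambda>x. T x + c) x"
  proof (rule dbd_SucI)
    fix v
    have "\<bar>T v\<bar> \<le> norm v" using assms by simp
    also have "\<dots> \<le> A * (norm v / h)"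
      using assms mult_left_mono[of 1 "A / h" "norm v"] by (simp add: mult.commute)
    finally show "dbd j (A * (norm v / h)) h (\<lambda>x. frechet_derivative (\<lambda>x. T x + c) (at x) v) x"
      using dbd_const[OF assms(4), of j "T v" x] assms(4) by (auto simp: fd intro: dbd_mono)
  qed (use assms in auto)
  then show ?thesis by (simp add: Suc)
qed

text \<open>The order of the quantifiers is the point: the constant depends on k, c and A but not on
  the scale, the function or the point, so one constant serves at every distance from the closed
  set.\<close>

lemma dbd_inverse_ex:
  assumes "c > 0"
  shows "\<exists>C. \<forall>h (f :: 'a::real_normed_vector \<Rightarrow> real) S x. h > 0 \<longrightarrow> open S \<longrightarrow> x \<in> S \<longrightarrow> Ck_on k f S \<longrightarrow>
     (\<forall>y\<in>S. f y \<noteq> 0) \<longrightarrow> c \<le> \<bar>f x\<bar> \<longrightarrow> dbd k A h f x \<longrightarrow> dbd k C h (\<lambda>x. inverse (f x)) x"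
proof (induction k)
  case 0
  have "\<bar>inverse (f x)\<bar> \<le> inverse c" if "c \<le> \<bar>f x\<bar>" for f :: "'a \<Rightarrow> real" and x
    using that assms by (simp add: abs_inverse le_imp_inverse_le)
  then show ?case by (intro exI[of _ "inverse c"]) (auto simp: dbd_def abs_inverse)
next
  case (Suc k)
  then obtain C where C: "\<And>h (f :: 'a \<Rightarrow> real) S x. h > 0 \<Longrightarrow> open S \<Longrightarrow> x \<in> S \<Longrightarrow> Ck_on k f S \<Longrightarrow>
     (\<forall>y\<in>S. f y \<noteq> 0) \<Longrightarrow> c \<le> \<bar>f x\<bar> \<Longrightarrow> dbd k A h f x \<Longrightarrow> dbd k C h (\<lambda>x. inverse (f x)) x" by blast
  \<comment> \<open>Bounds the derivative -(1/f) f' (1/f) by two uses of \<open>dbd_mult\<close>.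
    Only derivatives of 1/f of order at most k enter, which is why the induction closes.\<close>
  define B where "B = 2 ^ k * (2 ^ k * C * A) * C"
  show ?case
  proof (intro exI[of _ "max C B"] allI impI)
    fix h x and f :: "'a \<Rightarrow> real" and S
    assume h: "h > 0" and S: "open S" "x \<in> S" and f: "Ck_on (Suc k) f S" "\<forall>y\<in>S. f y \<noteq> 0" "c \<le> \<bar>f x\<bar>"
      "dbd (Suc k) A h f x"
    have fk: "Ck_on k f S" using f(1) by (rule Ck_on_SucD)
    have inv: "dbd k C h (\<lambda>x. inverse (f x)) x"
      by (rule C[OF h S fk]) (use f in \<open>auto intro: dbd_le\<close>)
    have Ci: "Ck_on k (\<lambda>x. inverse (f x)) S" using Ck_on_inverse[OF S(1) fk] f by blast
    show "dbd (Suc k) (max C B) h (\<lambda>x. inverse (f x)) x"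
    proof (rule dbd_SucI)
      show "\<bar>inverse (f x)\<bar> \<le> max C B" using dbd_value[OF inv] by simp
      fix v
      let ?f = "\<lambda>x. frechet_derivative f (at x) v"
      have Cf: "Ck_on k ?f S" using f(1) by simp
      have 1: "dbd k (2 ^ k * C * (A * (norm v / h))) h (\<lambda>x. inverse (f x) * ?f x) x"
        by (rule dbd_mult[OF S Ci Cf h inv dbd_pd[OF f(4)]])
      have 2: "dbd k (2 ^ k * (2 ^ k * C * (A * (norm v / h))) * C) h (\<lambda>x. inverse (f x) * ?f x * inverse (f x)) x"
        by (rule dbd_mult[OF S _ Ci h 1 inv]) (intro Ck_on_mult S Ci Cf)
      have 3: "Ck_on k (\<lambda>x. (-1) * (inverse (f x) * ?f x * inverse (f x))) S"
        by (intro Ck_on_cmult Ck_on_mult S Ci Cf)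
      have fd: "frechet_derivative (\<lambda>x. inverse (f x)) (at y) v = - (inverse (f y) * ?f y * inverse (f y))" if "y \<in> S" for y
        using frechet_derivative_at[OF Deriv.has_derivative_inverse[OF _ Ck_on_has_derivative[OF f(1) that]]] f(2) that
        by metis
      have "\<bar>Dl vs (\<lambda>x. (-1) * (inverse (f x) * ?f x * inverse (f x))) x\<bar> =
            \<bar>Dl vs (\<lambda>x. inverse (f x) * ?f x * inverse (f x)) x\<bar>" if "length vs \<le> k" for vs
        by (subst Dl_cmult[OF S(1) _ S(2)])
           (use that in \<open>auto intro!: Ck_on_le[of k _ _ "length vs"] Ck_on_mult S Ci Cf\<close>)
      then have "dbd k (B * (norm v / h)) h (\<lambda>x. (-1) * (inverse (f x) * ?f x * inverse (f x))) x"
        using 2 by (simp add: dbd_def B_def algebra_simps)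
      then have "dbd k (B * (norm v / h)) h (\<lambda>x. frechet_derivative (\<lambda>x. inverse (f x)) (at x) v) x"
        by (rule dbd_cong[OF S(1) _ 3 S(2), rotated]) (use fd in auto)
      then show "dbd k (max C B * (norm v / h)) h (\<lambda>x. frechet_derivative (\<lambda>x. inverse (f x)) (at x) v) x"
        by (rule dbd_mono) (use h in \<open>auto intro!: divide_right_mono mult_right_mono\<close>)
    qed
  qed
qed

text \<open>Continuity bounds one fixed list of directions at a time. Expanding the head direction
  in the finite basis makes the bound uniform over all lists on one neighbourhood.\<close>

lemma dbd_locally:
  fixes g :: "'a::euclidean_space \<Rightarrow> real"
  assumes "open S" "z0 \<in> S" "Ck_on p g S"
  shows "\<exists>A. eventually (\<lambda>z. dbd p A 1 g z) (nhds z0)"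
  using assms(3)
proof (induction p arbitrary: g)
  case 0
  then have "isCont g z0" using assms by (simp add: continuous_on_eq_continuous_at)
  then have "(g \<longlongrightarrow> g z0) (nhds z0)" by (simp add: continuous_at tendsto_at_iff_tendsto_nhds)
  then have "eventually (\<lambda>z. dist (g z) (g z0) < 1) (nhds z0)" by (rule tendstoD) simp
  then have "eventually (\<lambda>z. dbd 0 (\<bar>g z0\<bar> + 1) 1 g z) (nhds z0)"
    by (rule eventually_mono) (auto simp: dbd_def dist_real_def)
  then show ?case by blast
next
  case (Suc p)
  obtain A0 where A0: "eventually (\<lambda>z. dbd p A0 1 g z) (nhds z0)"
    using Suc.IH[of g] Ck_on_SucD[OF Suc.prems] by blast
  have "\<forall>b. \<exists>A. eventually (\<lambda>z. dbd p A 1 (\<lambda>x. frechet_derivative g (at x) b) z) (nhds z0)"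
    using Suc.IH Suc.prems by simp
  then obtain A where A: "\<And>b. eventually (\<lambda>z. dbd p (A b) 1 (\<lambda>x. frechet_derivative g (at x) b) z) (nhds z0)"
    by metis
  have ev: "eventually (\<lambda>z. \<forall>b\<in>Basis. dbd p (A b) 1 (\<lambda>x. frechet_derivative g (at x) b) z) (nhds z0)"
    using A by (intro eventually_ball_finite) auto
  have "eventually (\<lambda>z. z \<in> S) (nhds z0)" using assms by (simp add: eventually_nhds) blast
  then have "eventually (\<lambda>z. dbd (Suc p) (A0 + (\<Sum>b\<in>Basis. A b)) 1 g z) (nhds z0)"
    using A0 ev
  proof eventually_elim
    case (elim z)
    have A0n: "0 \<le> A0" using elim dbd_nonneg by blast
    have An: "0 \<le> A b" if "b \<in> Basis" for b using elim dbd_nonneg that by blast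
    show ?case unfolding dbd_def
    proof (intro allI impI)
      fix vs :: "'a list" assume l: "length vs \<le> Suc p"
      show "\<bar>Dl vs g z\<bar> \<le> (A0 + (\<Sum>b\<in>Basis. A b)) * (\<Prod>v\<leftarrow>vs. norm v / 1)"
      proof (cases vs)
        case Nil
        then show ?thesis using dbd_value[OF elim(2)] sum_nonneg[of Basis A] An by simp
      next
        case (Cons v us)
        let ?P = "\<Prod>v\<leftarrow>us. norm v / 1"
        have P: "?P \<ge> 0" by (rule norm_prod_nonneg) simp
        have "Dl vs g z = (\<Sum>b\<in>Basis. (v \<bullet> b) * Dl (b # us) g z)"
          unfolding Cons
          by (rule Dl_expand[OF assms(1)])
             (use Ck_on_le[OF Suc.prems, of "Suc (length us)"] elim l Cons in \<open>auto simp del: Ck_on.simps\<close>)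
        then have "\<bar>Dl vs g z\<bar> \<le> (\<Sum>b\<in>Basis. \<bar>(v \<bullet> b) * Dl (b # us) g z\<bar>)" by simp
        also have "\<dots> \<le> (\<Sum>b\<in>Basis. norm v * (A b * ?P))"
        proof (rule sum_mono)
          fix b :: 'a assume b: "b \<in> Basis"
          have "\<bar>Dl (b # us) g z\<bar> \<le> A b * ?P"
            using elim(3) b l Cons dbdD[of p "A b" 1 "\<lambda>x. frechet_derivative g (at x) b" z us] by simp
          then show "\<bar>(v \<bullet> b) * Dl (b # us) g z\<bar> \<le> norm v * (A b * ?P)"
            unfolding abs_mult using b by (intro mult_mono) (auto simp: Basis_le_norm)
        qed
        also have "\<dots> = (\<Sum>b\<in>Basis. A b) * (norm v * ?P)"
          by (simp add: sum_distrib_right sum_distrib_left mult_ac)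
        also have "\<dots> \<le> (A0 + (\<Sum>b\<in>Basis. A b)) * (norm v * ?P)"
          using A0n P by (intro mult_right_mono) auto
        finally show ?thesis by (simp add: Cons)
      qed
    qed
  qed
  then show ?case by blast
qed

text \<open>The basis expansion of \<open>dbd_locally\<close>, now for the oscillation of the
  derivatives of top order. Uniformity over directions is what a Taylor remainder along arbitrary
  segments needs.\<close>

lemma Dl_close_locally:
  fixes g :: "'a::euclidean_space \<Rightarrow> real"
  assumes "open S" "z0 \<in> S" "Ck_on p g S" "e > 0"
  shows "eventually (\<lambda>z. \<forall>vs. length vs = p \<longrightarrow> \<bar>Dl vs g z - Dl vs g z0\<bar> \<le> e * (\<Prod>v\<leftarrow>vs. norm v)) (nhds z0)"
  using assms(3,4)
proof (induction p arbitrary: g e)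
  case 0
  then have "isCont g z0" using assms by (simp add: continuous_on_eq_continuous_at)
  then have "(g \<longlongrightarrow> g z0) (nhds z0)" by (simp add: continuous_at tendsto_at_iff_tendsto_nhds)
  then have "eventually (\<lambda>z. dist (g z) (g z0) < e) (nhds z0)" by (rule tendstoD) (use 0 in simp)
  then show ?case
    by (rule eventually_mono) (auto simp: dist_real_def)
next
  case (Suc p)
  define e' where "e' = e / DIM('a)"
  have e': "e' > 0" using Suc.prems by (simp add: e'_def)
  have "eventually (\<lambda>z. \<forall>b\<in>Basis. \<forall>vs. length vs = p \<longrightarrow>
     \<bar>Dl (b # vs) g z - Dl (b # vs) g z0\<bar> \<le> e' * (\<Prod>v\<leftarrow>vs. norm v)) (nhds z0)"
    unfolding Dl.simps
    by (intro eventually_ball_finite ballI Suc.IH) (use Suc.prems e' in auto)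
  moreover have "eventually (\<lambda>z. z \<in> S) (nhds z0)" using assms by (simp add: eventually_nhds) blast
  ultimately show ?case
  proof eventually_elim
    case (elim z)
    show ?case
    proof (intro allI impI)
      fix vs :: "'a list" assume l: "length vs = Suc p"
      then obtain v us where vs: "vs = v # us" "length us = p" by (cases vs) auto
      let ?P = "\<Prod>v\<leftarrow>us. norm v"
      have P: "?P \<ge> 0" using norm_prod_nonneg[of 1 us] by simp
      have "Dl vs g y = (\<Sum>b\<in>Basis. (v \<bullet> b) * Dl (b # us) g y)" if "y \<in> S" for y
        unfolding vs using Suc.prems vs that by (intro Dl_expand[OF assms(1)]) auto
      then have "Dl vs g z - Dl vs g z0 = (\<Sum>b\<in>Basis. (v \<bullet> b) * (Dl (b # us) g z - Dl (b # us) g z0))"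
        using elim assms by (simp add: sum_subtractf[symmetric] right_diff_distrib del: Dl.simps)
      then have "\<bar>Dl vs g z - Dl vs g z0\<bar> \<le> (\<Sum>b\<in>Basis. \<bar>(v \<bullet> b) * (Dl (b # us) g z - Dl (b # us) g z0)\<bar>)"
        by (simp del: Dl.simps)
      also have "\<dots> \<le> (\<Sum>b\<in>(Basis::'a set). norm v * (e' * ?P))"
        unfolding abs_mult using elim(1) vs P e'
        by (intro sum_mono mult_mono) (auto simp: Basis_le_norm simp del: Dl.simps)
      also have "\<dots> = e * (\<Prod>v\<leftarrow>vs. norm v)" by (simp add: e'_def vs)
      finally show "\<bar>Dl vs g z - Dl vs g z0\<bar> \<le> e * (\<Prod>v\<leftarrow>vs. norm v)" .
    qed
  qed
qed

section \<open>Taylor polynomials through pure directional derivatives\<close>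

definition Tay :: "nat \<Rightarrow> ('a::real_normed_vector \<Rightarrow> real) \<Rightarrow> 'a \<Rightarrow> 'a \<Rightarrow> real" where
  "Tay p g z x = (\<Sum>k\<le>p. Dl (replicate k (x - z)) g z / fact k)"

lemma Dl_line_derivative:
  assumes "Ck_on p g S" "m < p" "z + t *\<^sub>R v \<in> S"
  shows "((\<lambda>t. Dl (replicate m v) g (z + t *\<^sub>R v)) has_real_derivative Dl (replicate (Suc m) v) g (z + t *\<^sub>R v)) (at t)"
proof -
  let ?y = "z + t *\<^sub>R v"
  have D: "(Dl (replicate m v) g has_derivative (\<lambda>u. Dl (replicate m v @ [u]) g ?y)) (at ?y)"
    using Dl_has_derivative[OF assms(1) _ assms(3), of "replicate m v"] assms(2) by simp
  have L: "((\<lambda>t. z + t *\<^sub>R v) has_derivative (\<lambda>s. s *\<^sub>R v)) (at t)"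
    by (auto intro!: derivative_eq_intros)
  have "((\<lambda>t. Dl (replicate m v) g (z + t *\<^sub>R v)) has_derivative (\<lambda>s. Dl (replicate m v @ [s *\<^sub>R v]) g ?y)) (at t)"
    using diff_chain_at[OF L D] by (simp add: o_def)
  moreover have "Dl (replicate m v @ [s *\<^sub>R v]) g ?y = Dl (replicate (Suc m) v) g ?y * s" for s
    using linear_cmul[OF has_derivative_linear[OF D], of s v]
    by (simp add: replicate_append_same)
  ultimately show ?thesis by (simp add: has_field_derivative_def)
qed

text \<open>The base point and the evaluation point both vary. The Lagrange remainder along the
  segment from z to x is a p-th derivative at an intermediate point; subtracting the term of order p
  of \<open>Tay\<close> leaves a difference of p-th derivatives at two points near z0.\<close>

lemma Taylor_locally:
  fixes g :: "'a::euclidean_space \<Rightarrow> real"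
  assumes "open S" "z0 \<in> S" "Ck_on p g S" "e > 0"
  shows "\<exists>d>0. ball z0 d \<subseteq> S \<and> (\<forall>z\<in>ball z0 d. \<forall>x\<in>ball z0 d. \<bar>g x - Tay p g z x\<bar> \<le> e * norm (x - z) ^ p)"
proof -
  have "eventually (\<lambda>z. z \<in> S \<and> (\<forall>vs. length vs = p \<longrightarrow> \<bar>Dl vs g z - Dl vs g z0\<bar> \<le> e / 2 * (\<Prod>v\<leftarrow>vs. norm v))) (nhds z0)"
    using Dl_close_locally[OF assms(1-3), of "e / 2"] assms
    by (auto simp: eventually_conj_iff eventually_nhds_in_open)
  then obtain d where d: "d > 0" "\<And>z. dist z z0 < d \<Longrightarrow> z \<in> S"
    "\<And>z vs. dist z z0 < d \<Longrightarrow> length vs = p \<Longrightarrow> \<bar>Dl vs g z - Dl vs g z0\<bar> \<le> e / 2 * (\<Prod>v\<leftarrow>vs. norm v)"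
    unfolding eventually_nhds_metric by blast
  have "\<bar>g x - Tay p g z x\<bar> \<le> e * norm (x - z) ^ p" if z: "z \<in> ball z0 d" and x: "x \<in> ball z0 d" for z x
  proof -
    define v where "v = x - z"
    have seg: "dist (z + t *\<^sub>R v) z0 < d" if "0 \<le> t" "t \<le> 1" for t
    proof -
      have "z + t *\<^sub>R v = (1 - t) *\<^sub>R z + t *\<^sub>R x" by (simp add: v_def algebra_simps)
      then have "z + t *\<^sub>R v \<in> ball z0 d" using convex_ball[of z0 d] z x that by (simp add: convex_alt)
      then show ?thesis by (simp add: dist_commute)
    qed
    have close: "\<bar>Dl (replicate p v) g (z + t *\<^sub>R v) - Dl (replicate p v) g z\<bar> \<le> e * norm v ^ p"
      if "0 \<le> t" "t \<le> 1" for t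
    proof -
      have *: "\<bar>Dl (replicate p v) g y - Dl (replicate p v) g z0\<bar> \<le> e / 2 * norm v ^ p" if "dist y z0 < d" for y
        using d(3)[OF that, of "replicate p v"] by (simp add: prod_list_replicate)
      note *[OF seg[OF that]]
      moreover have "\<bar>Dl (replicate p v) g z - Dl (replicate p v) g z0\<bar> \<le> e / 2 * norm v ^ p"
        using z by (intro *) (simp add: dist_commute)
      ultimately show ?thesis by linarith
    qed
    have "\<exists>t. 0 \<le> t \<and> t \<le> 1 \<and> g x - Tay p g z x = (Dl (replicate p v) g (z + t *\<^sub>R v) - Dl (replicate p v) g z) / fact p"
    proof (cases "p = 0")
      \<comment> \<open>\<open>Maclaurin\<close> requires a positive order. For p = 0 the claim
        holds with t = 1, the far end of the segment.\<close>
      case True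
      then show ?thesis by (intro exI[of _ 1]) (simp add: Tay_def v_def)
    next
      case False
      have "\<exists>t>0. t < 1 \<and> g (z + 1 *\<^sub>R v) = (\<Sum>m<p. Dl (replicate m v) g (z + 0 *\<^sub>R v) / fact m * 1 ^ m)
           + Dl (replicate p v) g (z + t *\<^sub>R v) / fact p * 1 ^ p"
      proof (rule Maclaurin[where f="\<lambda>t. g (z + t *\<^sub>R v)" and diff="\<lambda>m t. Dl (replicate m v) g (z + t *\<^sub>R v)"])
        show "\<forall>m t. m < p \<and> 0 \<le> t \<and> t \<le> 1 \<longrightarrow>
          ((\<lambda>t. Dl (replicate m v) g (z + t *\<^sub>R v)) has_real_derivative Dl (replicate (Suc m) v) g (z + t *\<^sub>R v)) (at t)"
          using Dl_line_derivative[OF assms(3)] seg d by blast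
      qed (use False in auto)
      then obtain t where t: "t > 0" "t < 1" "g (z + 1 *\<^sub>R v) = (\<Sum>m<p. Dl (replicate m v) g (z + 0 *\<^sub>R v) / fact m * 1 ^ m)
           + Dl (replicate p v) g (z + t *\<^sub>R v) / fact p * 1 ^ p" by blast
      then have "g x - Tay p g z x = (Dl (replicate p v) g (z + t *\<^sub>R v) - Dl (replicate p v) g z) / fact p"
        unfolding Tay_def v_def[symmetric]
        by (simp add: lessThan_Suc_atMost[symmetric] diff_divide_distrib) (simp add: v_def)
      then show ?thesis using t by (intro exI[of _ t]) auto
    qed
    then obtain t where t: "0 \<le> t" "t \<le> 1" "g x - Tay p g z x = (Dl (replicate p v) g (z + t *\<^sub>R v) - Dl (replicate p v) g z) / fact p"
      by blast
    have "\<bar>g x - Tay p g z x\<bar> = \<bar>Dl (replicate p v) g (z + t *\<^sub>R v) - Dl (replicate p v) g z\<bar> / fact p"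
      by (simp add: t(3) abs_divide)
    also have "\<dots> \<le> \<bar>Dl (replicate p v) g (z + t *\<^sub>R v) - Dl (replicate p v) g z\<bar> / 1"
      by (intro divide_left_mono) auto
    finally show ?thesis using close[OF t(1,2)] by (simp add: v_def)
  qed
  then show ?thesis using d by (intro exI[of _ d]) (auto simp: dist_commute)
qed

section \<open>Polynomials\<close>

lemma finite_Idx [simp]: "finite (Idx p :: ('n::finite) mindex set)"
proof (rule finite_subset)
  show "(Idx p :: 'n mindex set) \<subseteq> PiE UNIV (\<lambda>_. {..p})"
  proof
    fix \<alpha> :: "'n mindex" assume "\<alpha> \<in> Idx p"
    then have "(\<Sum>i\<in>UNIV. \<alpha> i) \<le> p" by (simp add: Idx_def mdeg_def)
    moreover have "\<alpha> i \<le> (\<Sum>i\<in>UNIV. \<alpha> i)" for i by (rule member_le_sum) auto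
    ultimately show "\<alpha> \<in> PiE UNIV (\<lambda>_. {..p})" by (auto intro: order_trans)
  qed
  show "finite (PiE (UNIV :: 'n set) (\<lambda>_. {..p}))" by (intro finite_PiE) auto
qed

lemma mono_add: "mono \<alpha> x * mono \<beta> x = mono (\<lambda>i. \<alpha> i + \<beta> i) x"
  by (simp add: mono_def prod.distrib power_add)

lemma mdeg_add: "mdeg (\<lambda>i. \<alpha> i + \<beta> i) = mdeg \<alpha> + mdeg \<beta>"
  by (simp add: mdeg_def sum.distrib)

lemma Ppoly_add: "P \<in> Ppoly p \<Longrightarrow> Q \<in> Ppoly p \<Longrightarrow> (\<lambda>x. P x + Q x) \<in> Ppoly p"
proof -
  assume "P \<in> Ppoly p" "Q \<in> Ppoly p"
  then obtain c d where "\<forall>x. P x = (\<Sum>\<alpha>\<in>Idx p. c \<alpha> * mono \<alpha> x)" "\<forall>x. Q x = (\<Sum>\<alpha>\<in>Idx p. d \<alpha> * mono \<alpha> x)"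
    unfolding Ppoly_def by blast
  then have "\<forall>x. P x + Q x = (\<Sum>\<alpha>\<in>Idx p. (c \<alpha> + d \<alpha>) * mono \<alpha> x)"
    by (simp add: sum.distrib distrib_right)
  then show ?thesis unfolding Ppoly_def by (intro CollectI exI[of _ "\<lambda>\<alpha>. c \<alpha> + d \<alpha>"])
qed

lemma Ppoly_monomial: "mdeg \<gamma> \<le> p \<Longrightarrow> (\<lambda>x. c * mono \<gamma> x) \<in> Ppoly p"
  unfolding Ppoly_def
proof (intro CollectI exI allI)
  fix x assume g: "mdeg \<gamma> \<le> p"
  show "c * mono \<gamma> x = (\<Sum>\<alpha>\<in>Idx p. (if \<alpha> = \<gamma> then c else 0) * mono \<alpha> x)"
  proof -
    have "(\<Sum>\<alpha>\<in>Idx p. (if \<alpha> = \<gamma> then c else 0) * mono \<alpha> x) = (\<Sum>\<alpha>\<in>Idx p. if \<alpha> = \<gamma> then c * mono \<gamma> x else 0)"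
      by (intro sum.cong) auto
    moreover have "\<gamma> \<in> Idx p" using g by (simp add: Idx_def)
    ultimately show ?thesis by simp
  qed
qed

lemma Ppoly_const: "(\<lambda>x. c) \<in> Ppoly p"
  using Ppoly_monomial[of "\<lambda>_. 0" p c] by (simp add: mono_def mdeg_def)

lemma Ppoly_sum: "(\<And>i. i \<in> I \<Longrightarrow> P i \<in> Ppoly p) \<Longrightarrow> (\<lambda>x. \<Sum>i\<in>I. P i x) \<in> Ppoly p"
proof (induction I rule: infinite_finite_induct)
  case (insert i I)
  then show ?case using Ppoly_add[of "P i" p "\<lambda>x. \<Sum>i\<in>I. P i x"] by simp
qed (auto simp: Ppoly_const)

lemma Ppoly_mult:
  assumes "P \<in> Ppoly p" "Q \<in> Ppoly q"
  shows "(\<lambda>x. P x * Q x) \<in> Ppoly (p + q)"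
proof -
  obtain c d where *: "\<And>x. P x = (\<Sum>\<alpha>\<in>Idx p. c \<alpha> * mono \<alpha> x)" "\<And>x. Q x = (\<Sum>\<alpha>\<in>Idx q. d \<alpha> * mono \<alpha> x)"
    using assms unfolding Ppoly_def by blast
  have "(\<lambda>x. P x * Q x) = (\<lambda>x. \<Sum>\<alpha>\<in>Idx p. \<Sum>\<beta>\<in>Idx q. (c \<alpha> * d \<beta>) * mono (\<lambda>i. \<alpha> i + \<beta> i) x)"
    by (simp add: * sum_product mono_add[symmetric] mult_ac)
  also have "\<dots> \<in> Ppoly (p + q)"
    by (intro Ppoly_sum Ppoly_monomial) (auto simp: mdeg_add Idx_def)
  finally show ?thesis .
qed

lemma Ppoly_mono: "P \<in> Ppoly p \<Longrightarrow> p \<le> q \<Longrightarrow> P \<in> Ppoly q"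
  using Ppoly_mult[OF _ Ppoly_const, of P p 1 "q - p"] by simp

lemma Ppoly_cmult: "P \<in> Ppoly p \<Longrightarrow> (\<lambda>x. c * P x) \<in> Ppoly p"
  using Ppoly_mult[OF Ppoly_const[of c 0]] by fastforce

lemma Ppoly_diff: "P \<in> Ppoly p \<Longrightarrow> Q \<in> Ppoly p \<Longrightarrow> (\<lambda>x. P x - Q x) \<in> Ppoly p"
  using Ppoly_add[OF _ Ppoly_cmult[of Q p "-1"], of P] by simp

lemma Ppoly_power: "P \<in> Ppoly p \<Longrightarrow> (\<lambda>x. P x ^ m) \<in> Ppoly (m * p)"
proof (induction m)
  case (Suc m)
  then show ?case using Ppoly_mult[of P p "\<lambda>x. P x ^ m" "m * p"] by simp
qed (auto simp: Ppoly_const)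

lemma Ppoly_prod: "(\<And>i. i \<in> I \<Longrightarrow> P i \<in> Ppoly (q i)) \<Longrightarrow> (\<lambda>x. \<Prod>i\<in>I. P i x) \<in> Ppoly (\<Sum>i\<in>I. q i)"
proof (induction I rule: infinite_finite_induct)
  case (insert i I)
  then show ?case using Ppoly_mult[of "P i" "q i" "\<lambda>x. \<Prod>i\<in>I. P i x"] by simp
qed (auto simp: Ppoly_const)

lemma Ppoly_coord: "(\<lambda>x. x $ i) \<in> Ppoly (Suc 0)"
proof -
  have "mono (\<lambda>j. if j = i then 1 else 0) x = x $ i" for x :: "real^'a"
    unfolding mono_def by (subst prod.remove[of _ i]) auto
  moreover have "mdeg (\<lambda>j. if j = i then 1 else 0) = 1" by (simp add: mdeg_def)
  ultimately show ?thesis using Ppoly_monomial[of "\<lambda>j. if j = i then 1 else 0" 1 1] by simp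
qed

lemma Ppoly_linear: "linear T \<Longrightarrow> (\<lambda>x :: real^'n::finite. T x + c) \<in> Ppoly (Suc 0)"
proof -
  assume T: "linear T"
  have Tx: "T x = (\<Sum>i\<in>UNIV. T (axis i 1) * x $ i)" for x
  proof -
    have "T x = T (\<Sum>i\<in>UNIV. (x $ i) *\<^sub>R axis i 1)"
      by (metis (no_types) basis_expansion scalar_mult_eq_scaleR)
    also have "\<dots> = (\<Sum>i\<in>UNIV. T (axis i 1) * x $ i)"
      using T by (simp add: linear_sum linear_cmul mult.commute)
    finally show ?thesis .
  qed
  have "(\<lambda>x. T x + c) = (\<lambda>x. (\<Sum>i\<in>UNIV. T (axis i 1) * x $ i) + c)"
    by (rule ext) (simp only: Tx[symmetric])
  also have "\<dots> \<in> Ppoly (Suc 0)"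
    by (intro Ppoly_add Ppoly_const Ppoly_sum Ppoly_cmult Ppoly_coord)
  finally show ?thesis .
qed

lemma Ppoly_mono_affine:
  fixes A :: "real^'m::finite \<Rightarrow> real^'n::finite"
  assumes "\<And>i. (\<lambda>x. A x $ i) \<in> Ppoly (Suc 0)"
  shows "(\<lambda>x. mono \<alpha> (A x)) \<in> Ppoly (mdeg \<alpha>)"
proof -
  have "(\<lambda>x. \<Prod>i\<in>UNIV. (A x $ i) ^ \<alpha> i) \<in> Ppoly (\<Sum>i\<in>UNIV. \<alpha> i * Suc 0)"
    by (intro Ppoly_prod Ppoly_power assms)
  then show ?thesis by (simp add: mono_def mdeg_def)
qed

lemma Ppoly_affine:
  assumes "\<And>i. (\<lambda>x. A x $ i) \<in> Ppoly (Suc 0)" "P \<in> Ppoly p"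
  shows "(\<lambda>x. P (A x)) \<in> Ppoly p"
proof -
  obtain c where *: "\<And>x. P x = (\<Sum>\<alpha>\<in>Idx p. c \<alpha> * mono \<alpha> x)"
    using assms unfolding Ppoly_def by blast
  have "(\<lambda>x. \<Sum>\<alpha>\<in>Idx p. c \<alpha> * mono \<alpha> (A x)) \<in> Ppoly p"
    using Ppoly_mono[OF Ppoly_mono_affine[OF assms(1)]]
    by (intro Ppoly_sum Ppoly_cmult) (auto simp: Idx_def)
  then show ?thesis by (simp add: *)
qed

text \<open>The rows of the inverse are the coefficients of the normalised Lagrange polynomials:
  interpolating the monomial of degree b at the p + 1 nodes reproduces it, and comparing
  coefficients of degree a gives the identity.\<close>

lemma inverse_Vandermonde:
  fixes t :: "nat \<Rightarrow> real"
  assumes "inj_on t {..p}"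
  shows "\<exists>w. \<forall>a\<le>p. \<forall>b\<le>p. (\<Sum>j\<le>p. w a j * t j ^ b) = (if a = b then 1 else 0)"
proof -
  define L where "L j = (\<Prod>i\<in>{..p}-{j}. [:- t i, 1:])" for j
  have L: "poly (L j) (t k) = (if k = j then (\<Prod>i\<in>{..p}-{j}. t j - t i) else 0)" if "k \<le> p" "j \<le> p" for k j
    using that by (auto simp: L_def poly_prod intro!: prod_zero)
  have nz: "(\<Prod>i\<in>{..p}-{j}. t j - t i) \<noteq> 0" if "j \<le> p" for j
    using assms that by (auto simp: inj_on_def)
  have deg: "degree (L j) \<le> p" if "j \<le> p" for j
    using degree_prod_sum_le[of "{..p}-{j}" "\<lambda>i. [:- t i, 1:]"] that by (simp add: L_def)
  define w where "w a j = coeff (L j) a / (\<Prod>i\<in>{..p}-{j}. t j - t i)" for a j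
  have "(\<Sum>j\<le>p. w a j * t j ^ b) = (if a = b then 1 else 0)" if "a \<le> p" "b \<le> p" for a b
  proof -
    define Q where "Q = (\<Sum>j\<le>p. smult (t j ^ b / (\<Prod>i\<in>{..p}-{j}. t j - t i)) (L j))"
    have "Q = monom 1 b"
    proof (rule poly_eqI_degree[of "t ` {..p}"])
      show "poly Q x = poly (monom 1 b) x" if xt: "x \<in> t ` {..p}" for x
      proof -
        obtain k where k: "k \<le> p" "x = t k" using xt by auto
        have "poly Q x = (\<Sum>j\<le>p. if j = k then t k ^ b else 0)"
          unfolding Q_def poly_sum k using nz k L by (intro sum.cong) auto
        then show ?thesis using k by (simp add: poly_monom)
      qed
      have "degree Q \<le> p" unfolding Q_def
        by (intro degree_sum_le) (auto intro: order_trans[OF degree_smult_le] deg)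
      then show "card (t ` {..p}) > degree Q" using card_image[OF assms] by simp
      show "card (t ` {..p}) > degree (monom (1::real) b)"
        using card_image[OF assms] that by (simp add: degree_monom_eq)
    qed
    then have "coeff Q a = (if a = b then 1 else 0)" by auto
    moreover have "coeff Q a = (\<Sum>j\<le>p. w a j * t j ^ b)"
      by (simp add: Q_def coeff_sum w_def mult_ac)
    ultimately show ?thesis by simp
  qed
  then show ?thesis by blast
qed

text \<open>A tensor grid of the one-dimensional nodes, with products of the Vandermonde weights. It
  is used for uniqueness of coefficients, for the Markov-type bound \<open>Ppoly_dbd\<close>, and
  for showing that \<open>G z\<close> is a polynomial.\<close>

lemma Ppoly_interpolation:
  obtains J :: "('n::finite \<Rightarrow> nat) set" and pt :: "('n \<Rightarrow> nat) \<Rightarrow> real^'n" and w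
  where "finite J" "\<And>g. g \<in> J \<Longrightarrow> norm (pt g) \<le> 1"
    "\<And>\<alpha> c. \<alpha> \<in> Idx p \<Longrightarrow> (\<Sum>g\<in>J. w \<alpha> g * (\<Sum>\<beta>\<in>Idx p. c \<beta> * mono \<beta> (pt g))) = c \<alpha>"
proof -
  \<comment> \<open>Dividing by p + 1 keeps each node below 1; dividing by the dimension then keeps
    the grid in the unit ball through the l1 estimate of the norm.\<close>
  define t where "t j = real j / (real (p + 1) * real CARD('n))" for j
  have "inj_on t {..p}" by (auto simp: inj_on_def t_def)
  then obtain w where w: "\<And>a b. a \<le> p \<Longrightarrow> b \<le> p \<Longrightarrow> (\<Sum>j\<le>p. w a j * t j ^ b) = (if a = b then 1 else 0)"
    using inverse_Vandermonde by blast
  define J where "J = PiE (UNIV :: 'n set) (\<lambda>_. {..p})"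
  define pt :: "('n \<Rightarrow> nat) \<Rightarrow> real^'n" where "pt g = (\<chi> i. t (g i))" for g
  define W where "W \<alpha> g = (\<Prod>i\<in>UNIV. w (\<alpha> i) (g i))" for \<alpha> g :: "'n \<Rightarrow> nat"
  have le: "\<alpha> i \<le> p" if "\<alpha> \<in> Idx p" for \<alpha> :: "'n mindex" and i
    using that member_le_sum[of i UNIV \<alpha>] by (auto simp: Idx_def mdeg_def)
  have dual: "(\<Sum>g\<in>J. W \<alpha> g * mono \<beta> (pt g)) = (if \<alpha> = \<beta> then 1 else 0)" if "\<alpha> \<in> Idx p" "\<beta> \<in> Idx p" for \<alpha> \<beta>
  proof -
    have "(\<Sum>g\<in>J. W \<alpha> g * mono \<beta> (pt g)) = (\<Sum>g\<in>J. \<Prod>i\<in>UNIV. w (\<alpha> i) (g i) * t (g i) ^ \<beta> i)"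
      by (simp add: W_def mono_def pt_def prod.distrib)
    also have "\<dots> = (\<Prod>i\<in>UNIV. \<Sum>j\<le>p. w (\<alpha> i) j * t j ^ \<beta> i)"
      unfolding J_def by (rule prod_sum_PiE[symmetric]) auto
    also have "\<dots> = (\<Prod>i\<in>UNIV. if \<alpha> i = \<beta> i then 1 else 0)"
      using le that by (simp add: w)
    also have "\<dots> = (if \<alpha> = \<beta> then 1 else 0)"
      by (auto simp: fun_eq_iff)
    finally show ?thesis .
  qed
  have "finite J" unfolding J_def by (intro finite_PiE) auto
  moreover have "norm (pt g) \<le> 1" if "g \<in> J" for g
  proof -
    have "norm (pt g) \<le> (\<Sum>i\<in>UNIV. \<bar>pt g $ i\<bar>)" by (rule norm_le_l1_cart)
    also have "\<dots> \<le> (\<Sum>i\<in>(UNIV::'n set). 1 / CARD('n))"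
    proof (rule sum_mono)
      fix i
      have "g i \<le> p" using that by (auto simp: J_def PiE_iff)
      then have "real (g i) / (p + 1) \<le> 1" by simp
      then have "real (g i) / (p + 1) / CARD('n) \<le> 1 / CARD('n)" by (rule divide_right_mono) simp
      then show "\<bar>pt g $ i\<bar> \<le> 1 / CARD('n)" by (simp add: pt_def t_def)
    qed
    finally show ?thesis by simp
  qed
  moreover have "(\<Sum>g\<in>J. W \<alpha> g * (\<Sum>\<beta>\<in>Idx p. c \<beta> * mono \<beta> (pt g))) = c \<alpha>" if "\<alpha> \<in> Idx p" for \<alpha> c
  proof -
    have "(\<Sum>g\<in>J. W \<alpha> g * (\<Sum>\<beta>\<in>Idx p. c \<beta> * mono \<beta> (pt g))) = (\<Sum>g\<in>J. \<Sum>\<beta>\<in>Idx p. c \<beta> * (W \<alpha> g * mono \<beta> (pt g)))"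
      by (simp add: sum_distrib_left mult_ac)
    also have "\<dots> = (\<Sum>\<beta>\<in>Idx p. c \<beta> * (\<Sum>g\<in>J. W \<alpha> g * mono \<beta> (pt g)))"
      by (subst sum.swap) (simp add: sum_distrib_left)
    also have "\<dots> = (\<Sum>\<beta>\<in>Idx p. if \<beta> = \<alpha> then c \<alpha> else 0)"
      using that by (intro sum.cong) (auto simp: dual)
    finally show ?thesis using that by simp
  qed
  ultimately show ?thesis by (rule that)
qed

text \<open>The interpolation weights compute the coefficients from values of P, which is the
  uniqueness that the \<open>THE\<close> in \<open>pcoeff\<close> rests on.\<close>

lemma pcoeff_eq:
  assumes "\<And>\<alpha>. \<alpha> \<notin> Idx p \<Longrightarrow> c \<alpha> = 0" "\<And>x. P x = (\<Sum>\<alpha>\<in>Idx p. c \<alpha> * mono \<alpha> x)"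
  shows "pcoeff p P = c"
  unfolding pcoeff_def
proof (rule the_equality)
  obtain J and pt :: "('a \<Rightarrow> nat) \<Rightarrow> real^'a" and w where "finite J" "\<And>g. g \<in> J \<Longrightarrow> norm (pt g) \<le> 1" and
    J: "\<And>\<alpha> c. \<alpha> \<in> Idx p \<Longrightarrow> (\<Sum>g\<in>J. w \<alpha> g * (\<Sum>\<beta>\<in>Idx p. c \<beta> * mono \<beta> (pt g))) = c \<alpha>"
    by (rule Ppoly_interpolation[where p=p]) (rule that)
  fix d assume d: "(\<forall>\<alpha>. \<alpha> \<notin> Idx p \<longrightarrow> d \<alpha> = 0) \<and> (\<forall>x. P x = (\<Sum>\<alpha>\<in>Idx p. d \<alpha> * mono \<alpha> x))"
  show "d = c"
  proof
    fix \<alpha>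
    show "d \<alpha> = c \<alpha>"
    proof (cases "\<alpha> \<in> Idx p")
      case True
      have "d \<alpha> = (\<Sum>g\<in>J. w \<alpha> g * P (pt g))" using J[OF True, of d] d by simp
      also have "\<dots> = c \<alpha>" using J[OF True, of c] assms by simp
      finally show ?thesis .
    qed (use d assms in auto)
  qed
qed (use assms in auto)

lemma dapp_eq:
  assumes "\<And>x. P x = (\<Sum>\<alpha>\<in>Idx p. c \<alpha> * mono \<alpha> x)"
  shows "dapp p \<xi> P = (\<Sum>\<alpha>\<in>Idx p. c \<alpha> * \<xi> \<alpha>)"
proof -
  have "pcoeff p P = (\<lambda>\<alpha>. if \<alpha> \<in> Idx p then c \<alpha> else 0)"
    by (rule pcoeff_eq) (auto simp: assms)
  then show ?thesis by (simp add: dapp_def)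
qed

lemma mono_shift_Ppoly: "\<alpha> \<in> Idx p \<Longrightarrow> (\<lambda>x. c * mono \<alpha> (x - b)) \<in> Ppoly p"
  using Ppoly_mono_affine[of "\<lambda>x. x - b" \<alpha>] Ppoly_linear[of "\<lambda>x. x $ _" "- b $ _"]
  by (auto simp: Idx_def linear_iff intro!: Ppoly_cmult intro: Ppoly_mono)

lemma dcomp_scale: "dcomp p (\<lambda>\<beta>. c * \<xi> \<beta>) \<alpha> b = c * dcomp p \<xi> \<alpha> b"
  by (simp add: dcomp_def dapp_def sum_distrib_left mult_ac)

section \<open>Smoothness and derivative bounds of polynomials\<close>

lemma Ck_on_mono_comp:
  assumes "open S" "\<And>i. Ck_on k (\<lambda>x. f x $ i) S"
  shows "Ck_on k (\<lambda>x. mono \<alpha> (f x)) S"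
  unfolding mono_def by (intro Ck_on_prod Ck_on_power assms)

lemma Ck_on_coord: "open S \<Longrightarrow> Ck_on k (\<lambda>x::real^'n::finite. x $ i) S"
  by (intro Ck_on_bounded_linear bounded_linear_vec_nth)

lemma Ck_on_Ppoly:
  assumes "P \<in> Ppoly p" shows "Ck_on k P UNIV"
proof -
  obtain c where "P = (\<lambda>x. \<Sum>\<alpha>\<in>Idx p. c \<alpha> * mono \<alpha> x)"
    using assms unfolding Ppoly_def by blast
  then show ?thesis
    by (auto intro!: Ck_on_sum Ck_on_cmult Ck_on_mono_comp Ck_on_coord)
qed

text \<open>The exponent \<open>mdeg \<alpha>\<close> on A is kept exact: when A is proportional to
  h it becomes the vanishing order h^|\<alpha>| on which all smallness estimates depend.\<close>

lemma dbd_mono_comp: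
  fixes f :: "'a::real_normed_vector \<Rightarrow> real^'n::finite"
  assumes "open S" "x \<in> S" "\<And>i. Ck_on k (\<lambda>x. f x $ i) S" "h > 0" "\<And>i. dbd k A h (\<lambda>x. f x $ i) x"
  shows "dbd k ((2 ^ k) ^ CARD('n) * (2 ^ k * A) ^ mdeg \<alpha>) h (\<lambda>x. mono \<alpha> (f x)) x"
proof -
  have "dbd k (\<Prod>i\<in>UNIV. 2 ^ k * (2 ^ k * A) ^ \<alpha> i) h (\<lambda>x. \<Prod>i\<in>UNIV. (f x $ i) ^ \<alpha> i) x"
    by (intro dbd_prod[OF assms(1,2)] dbd_power[OF assms(1,2)] Ck_on_power assms)
  moreover have "(\<Prod>i\<in>UNIV. 2 ^ k * (2 ^ k * A) ^ \<alpha> i) = (2 ^ k) ^ CARD('n) * (2 ^ k * A) ^ mdeg \<alpha>"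
    by (simp add: prod.distrib mdeg_def power_sum)
  ultimately show ?thesis by (simp add: mono_def)
qed

lemma mono_scale: "mono \<alpha> (c *\<^sub>R x) = c ^ mdeg \<alpha> * mono \<alpha> x"
  by (simp add: mono_def mdeg_def power_mult_distrib prod.distrib power_sum)

text \<open>A Markov-type inequality with a constant depending on p and the dimension only.
  Rescaling the ball of radius r to the unit ball lets the fixed interpolation weights bound the
  coefficients.\<close>

lemma Ppoly_dbd:
  "\<exists>C\<ge>0. \<forall>Q\<in>Ppoly p. \<forall>(z::real^'n::finite) r R A x. 0 < r \<longrightarrow> r \<le> R \<longrightarrow> (\<forall>y\<in>cball z r. \<bar>Q y\<bar> \<le> A) \<longrightarrow> norm (x - z) \<le> R \<longrightarrow>
      dbd p (C * A * (R / r) ^ p) R Q x"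
proof -
  obtain J and pt :: "('n \<Rightarrow> nat) \<Rightarrow> real^'n" and w where J: "finite J" "\<And>g. g \<in> J \<Longrightarrow> norm (pt g) \<le> 1"
      "\<And>\<alpha> c. \<alpha> \<in> Idx p \<Longrightarrow> (\<Sum>g\<in>J. w \<alpha> g * (\<Sum>\<beta>\<in>Idx p. c \<beta> * mono \<beta> (pt g))) = c \<alpha>"
    by (rule Ppoly_interpolation[where p=p]) (rule that)
  \<comment> \<open>\<open>W \<alpha>\<close> bounds the coefficient functional of index \<alpha>
    against the supremum over the unit ball.\<close>
  define W where "W \<alpha> = (\<Sum>g\<in>J. \<bar>w \<alpha> g\<bar>)" for \<alpha>
  define B where "B = (2 ^ p) ^ CARD('n) * ((2::real) ^ p) ^ p"
  define C where "C = (\<Sum>\<alpha>\<in>(Idx p :: 'n mindex set). W \<alpha> * B)"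
  have W: "W \<alpha> \<ge> 0" for \<alpha> by (simp add: W_def sum_nonneg)
  have B: "B \<ge> 0" by (simp add: B_def)
  have "C \<ge> 0" by (simp add: C_def sum_nonneg W B)
  moreover have "dbd p (C * A * (R / r) ^ p) R Q x"
    if Q: "Q \<in> Ppoly p" and r: "0 < r" "r \<le> R" and bd: "\<And>y. y \<in> cball z r \<Longrightarrow> \<bar>Q y\<bar> \<le> A" and x: "norm (x - z) \<le> R"
    for Q and z :: "real^'n" and r R A x
  proof -
    have A: "A \<ge> 0" using bd[of z] r by auto
    have R: "R > 0" using r by simp
    have "(\<lambda>u. Q (z + r *\<^sub>R u)) \<in> Ppoly p"
      by (rule Ppoly_affine[OF _ Q])
         (use Ppoly_linear[of "\<lambda>x. r * x $ _" "z $ _"] in \<open>auto simp: linear_iff algebra_simps\<close>)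
    then obtain c where c: "\<And>u. Q (z + r *\<^sub>R u) = (\<Sum>\<alpha>\<in>Idx p. c \<alpha> * mono \<alpha> u)"
      unfolding Ppoly_def by blast
    have cb: "\<bar>c \<alpha>\<bar> \<le> W \<alpha> * A" if "\<alpha> \<in> Idx p" for \<alpha>
    proof -
      have "c \<alpha> = (\<Sum>g\<in>J. w \<alpha> g * Q (z + r *\<^sub>R pt g))" using J(3)[OF that, of c] by (simp add: c)
      then have "\<bar>c \<alpha>\<bar> \<le> (\<Sum>g\<in>J. \<bar>w \<alpha> g * Q (z + r *\<^sub>R pt g)\<bar>)" by simp
      also have "\<dots> \<le> (\<Sum>g\<in>J. \<bar>w \<alpha> g\<bar> * A)"
        unfolding abs_mult
      proof (intro sum_mono mult_left_mono)
        fix g assume "g \<in> J"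
        then have "r * norm (pt g) \<le> r" using J(2) r by (simp add: mult_left_le)
        then show "\<bar>Q (z + r *\<^sub>R pt g)\<bar> \<le> A" using r by (intro bd) (simp add: dist_norm)
      qed simp
      finally show ?thesis by (simp add: W_def sum_distrib_right)
    qed
    \<comment> \<open>The coefficient of index \<alpha> about z carries r^(-|\<alpha>|), while the
      monomial at scale R costs R^|\<alpha>|. This is the origin of the loss (R / r)^p.\<close>
    have Qe: "Q = (\<lambda>y. \<Sum>\<alpha>\<in>Idx p. (c \<alpha> * (1 / r) ^ mdeg \<alpha>) * mono \<alpha> (y - z))"
    proof
      fix y
      have "Q y = Q (z + r *\<^sub>R ((1 / r) *\<^sub>R (y - z)))" using r by simp
      also have "\<dots> = (\<Sum>\<alpha>\<in>Idx p. (c \<alpha> * (1 / r) ^ mdeg \<alpha>) * mono \<alpha> (y - z))"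
        unfolding c mono_scale by (simp add: mult_ac)
      finally show "Q y = (\<Sum>\<alpha>\<in>Idx p. (c \<alpha> * (1 / r) ^ mdeg \<alpha>) * mono \<alpha> (y - z))" .
    qed
    have Cc: "Ck_on p (\<lambda>y::real^'n. (y - z) $ i) UNIV" for i
      unfolding vector_minus_component by (intro Ck_on_diff Ck_on_coord Ck_on_const) auto
    have d1: "dbd p R R (\<lambda>y. (y - z) $ i) x" for i
    proof -
      have "dbd p R R (\<lambda>y. y $ i + - z $ i) x"
        using x R component_le_norm_cart[of "x - z" i] component_le_norm_cart[where i=i]
        by (intro dbd_affine bounded_linear_vec_nth) auto
      then show ?thesis by simp
    qed
    have d2: "dbd p ((2 ^ p) ^ CARD('n) * (2 ^ p * R) ^ mdeg \<alpha>) R (\<lambda>y. mono \<alpha> (y - z)) x" for \<alpha>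
      by (rule dbd_mono_comp[of UNIV]) (use Cc R d1 in auto)
    have d3: "dbd p (W \<alpha> * B * A * (R / r) ^ p) R (\<lambda>y. (c \<alpha> * (1 / r) ^ mdeg \<alpha>) * mono \<alpha> (y - z)) x"
      if al: "\<alpha> \<in> Idx p" for \<alpha>
      unfolding dbd_def
    proof (intro allI impI)
      fix vs :: "(real^'n) list" assume l: "length vs \<le> p"
      let ?P = "\<Prod>v\<leftarrow>vs. norm v / R"
      have P: "?P \<ge> 0" using R by (rule norm_prod_nonneg)
      have m: "mdeg \<alpha> \<le> p" using al by (simp add: Idx_def)
      have "\<bar>Dl vs (\<lambda>y. (c \<alpha> * (1 / r) ^ mdeg \<alpha>) * mono \<alpha> (y - z)) x\<bar> = \<bar>c \<alpha> * (1 / r) ^ mdeg \<alpha>\<bar> * \<bar>Dl vs (\<lambda>y. mono \<alpha> (y - z)) x\<bar>"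
        by (subst Dl_cmult[of UNIV])
           (use l in \<open>auto intro!: Ck_on_le[of p _ _ "length vs"] Ck_on_mono_comp Cc simp: abs_mult simp del: vector_minus_component\<close>)
      also have "\<dots> \<le> (W \<alpha> * A * (1 / r) ^ mdeg \<alpha>) * ((2 ^ p) ^ CARD('n) * (2 ^ p * R) ^ mdeg \<alpha> * ?P)"
        unfolding abs_mult using cb[OF al] dbdD[OF d2 l] r A W
        by (intro mult_mono) auto
      also have "\<dots> = W \<alpha> * A * ?P * (2 ^ p) ^ CARD('n) * ((2 ^ p) ^ mdeg \<alpha> * (R / r) ^ mdeg \<alpha>)"
        by (simp add: power_mult_distrib power_divide)
      also have "\<dots> \<le> W \<alpha> * A * ?P * (2 ^ p) ^ CARD('n) * ((2 ^ p) ^ p * (R / r) ^ p)"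
        using W A P m r by (intro mult_left_mono mult_mono power_increasing mult_nonneg_nonneg) auto
      finally show "\<bar>Dl vs (\<lambda>y. (c \<alpha> * (1 / r) ^ mdeg \<alpha>) * mono \<alpha> (y - z)) x\<bar> \<le> W \<alpha> * B * A * (R / r) ^ p * ?P"
        by (simp add: B_def mult_ac)
    qed
    have "dbd p (\<Sum>\<alpha>\<in>(Idx p :: 'n mindex set). W \<alpha> * B * A * (R / r) ^ p) R Q x"
      by (subst Qe, rule dbd_sum[of UNIV])
         (use d3 R in \<open>auto intro!: Ck_on_cmult Ck_on_mono_comp Cc simp del: vector_minus_component\<close>)
    then show ?thesis by (simp add: C_def sum_distrib_right)
  qed
  ultimately show ?thesis by (intro exI[of _ C]) blast
qed

text \<open>The direction \<open>V x\<close> is affine in the parameter x and constant in the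
  variable of differentiation. Each basis expansion of it therefore contributes one factor of degree
  1 in x.\<close>

lemma Dl_replicate_Ppoly:
  fixes g :: "'b::euclidean_space \<Rightarrow> real" and V :: "real^'n::finite \<Rightarrow> 'b"
  assumes "open S" "z \<in> S" "Ck_on k g S" "\<And>b. b \<in> Basis \<Longrightarrow> (\<lambda>x. V x \<bullet> b) \<in> Ppoly (Suc 0)"
  shows "(\<lambda>x. Dl (replicate k (V x)) g z) \<in> Ppoly k"
  using assms(3)
proof (induction k arbitrary: g)
  case 0
  then show ?case by (simp add: Ppoly_const)
next
  case (Suc k)
  have "(\<lambda>x. Dl (replicate (Suc k) (V x)) g z) = (\<lambda>x. \<Sum>b\<in>Basis. (V x \<bullet> b) * Dl (replicate k (V x)) (\<lambda>y. frechet_derivative g (at y) b) z)"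
  proof
    fix x
    show "Dl (replicate (Suc k) (V x)) g z = (\<Sum>b\<in>Basis. (V x \<bullet> b) * Dl (replicate k (V x)) (\<lambda>y. frechet_derivative g (at y) b) z)"
      using Dl_expand[OF assms(1), of "replicate k (V x)" g z "V x"] Suc.prems assms(2) by simp
  qed
  also have "\<dots> \<in> Ppoly (Suc 0 + k)"
    by (intro Ppoly_sum Ppoly_mult assms(4) Suc.IH) (use Suc.prems in auto)
  finally show ?case by simp
qed

section \<open>Partitions of unity with derivative bounds\<close>

lemma dbd_compact:
  fixes g :: "'a::euclidean_space \<Rightarrow> real"
  assumes "open S" "Ck_on p g S" "compact K" "K \<subseteq> S"
  shows "\<exists>A. \<forall>z\<in>K. dbd p A 1 g z"
proof -
  have "\<forall>z0\<in>K. \<exists>A U. open U \<and> z0 \<in> U \<and> (\<forall>z\<in>U. dbd p A 1 g z)"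
  proof
    fix z0 assume "z0 \<in> K"
    then obtain A where "eventually (\<lambda>z. dbd p A 1 g z) (nhds z0)"
      using dbd_locally[OF assms(1) _ assms(2), of z0] assms(4) by blast
    then show "\<exists>A U. open U \<and> z0 \<in> U \<and> (\<forall>z\<in>U. dbd p A 1 g z)"
      by (auto simp: eventually_nhds)
  qed
  then obtain A U where U: "\<And>z0. z0 \<in> K \<Longrightarrow> open (U z0) \<and> z0 \<in> U z0 \<and> (\<forall>z\<in>U z0. dbd p (A z0) 1 g z)"
    by metis
  obtain C where C: "C \<subseteq> K" "finite C" "K \<subseteq> (\<Union>c\<in>C. U c)"
    using compactE_image[OF assms(3), of K U] U by blast
  have "dbd p (\<Sum>c\<in>C. \<bar>A c\<bar>) 1 g z" if zK: "z \<in> K" for z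
  proof -
    obtain c where c: "c \<in> C" "z \<in> U c" using C zK by blast
    have "A c \<le> (\<Sum>c\<in>C. \<bar>A c\<bar>)"
      using c C member_le_sum[of c C "\<lambda>c. \<bar>A c\<bar>"] by force
    moreover have "dbd p (A c) 1 g z" using U[of c] c C by blast
    ultimately show ?thesis by (auto intro: dbd_mono)
  qed
  then show ?thesis by blast
qed

section \<open>Bump functions of finite smoothness\<close>

lemma max_power_has_derivative:
  "((\<lambda>t::real. max 0 t ^ Suc (Suc j)) has_real_derivative (real (Suc (Suc j)) * max 0 t ^ Suc j)) (at t)"
proof (cases "t = 0")
  case True
  \<comment> \<open>Caratheodory slope at 0: on either side the quotient by z is the positive part
    to the power j + 1, which is continuous and vanishes at 0.\<close>
  have "\<exists>g. (\<forall>z. max 0 z ^ Suc (Suc j) - max 0 t ^ Suc (Suc j) = g z * (z - t)) \<and> isCont g t \<and> g t = 0"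
  proof (intro exI[of _ "\<lambda>z. max 0 z ^ Suc j"] conjI allI)
    show "isCont (\<lambda>z. max 0 z ^ Suc j) t" by (intro continuous_intros)
  qed (use True in \<open>auto simp: max_def\<close>)
  then have "((\<lambda>t::real. max 0 t ^ Suc (Suc j)) has_real_derivative 0) (at t)"
    by (simp only: CARAT_DERIV)
  then show ?thesis using True by simp
next
  case False
  show ?thesis
  proof (cases "t > 0")
    case True
    have "((\<lambda>t::real. t ^ Suc (Suc j)) has_real_derivative (real (Suc (Suc j)) * t ^ Suc j)) (at t)"
      using DERIV_pow[of "Suc (Suc j)" t UNIV] by simp
    then have "((\<lambda>t::real. max 0 t ^ Suc (Suc j)) has_real_derivative (real (Suc (Suc j)) * t ^ Suc j)) (at t)"
      by (rule has_field_derivative_transform_within_open[of _ _ _ "{0<..}"]) (use True in auto)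
    then show ?thesis using True by simp
  next
    case F: False
    have "((\<lambda>t::real. 0) has_real_derivative 0) (at t)" by simp
    then have "((\<lambda>t::real. max 0 t ^ Suc (Suc j)) has_real_derivative 0) (at t)"
      by (rule has_field_derivative_transform_within_open[of _ _ _ "{..<0}"]) (use F False in auto)
    then show ?thesis using F by simp
  qed
qed

lemma Ck_on_max_power:
  fixes q :: "'a::real_normed_vector \<Rightarrow> real"
  assumes "open S" "Ck_on k q S" "k < m"
  shows "Ck_on k (\<lambda>x. max 0 (q x) ^ m) S"
  using assms(2,3)
proof (induction k arbitrary: m)
  case 0
  then show ?case by (auto intro!: continuous_intros)
next
  case (Suc k)
  then obtain j where m: "m = Suc (Suc j)" "k < Suc j"
    by (intro that[of "m - 2"]) auto
  have qk: "Ck_on k q S" using Suc.prems(1) by (rule Ck_on_SucD)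
  show ?case
  proof (rule Ck_on_SucI[where D="\<lambda>x v. (real m * max 0 (q x) ^ Suc j) * frechet_derivative q (at x) v"])
    show "open S" by fact
    fix x assume x: "x \<in> S"
    show "((\<lambda>x. max 0 (q x) ^ m) has_derivative (\<lambda>v. (real m * max 0 (q x) ^ Suc j) * frechet_derivative q (at x) v)) (at x)"
      using diff_chain_at[OF Ck_on_has_derivative[OF Suc.prems(1) x]
          has_field_derivative_imp_has_derivative[OF max_power_has_derivative[of j "q x"]]]
      by (simp add: o_def m)
  next
    fix v
    show "Ck_on k (\<lambda>x. (real m * max 0 (q x) ^ Suc j) * frechet_derivative q (at x) v) S"
      by (intro Ck_on_mult Ck_on_const assms(1) Suc.IH qk) (use Suc.prems m in auto)
  qed
qed

text \<open>The power p + 1 of a positive part is of class C^p, the smoothness in force throughout.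
  The function vanishes outside the open unit ball.\<close>

definition bump :: "nat \<Rightarrow> 'a::euclidean_space \<Rightarrow> real" where
  "bump p u = max 0 (1 - (norm u)\<^sup>2) ^ Suc p"

lemma Ck_on_bump: "Ck_on p (bump p :: 'a::euclidean_space \<Rightarrow> real) UNIV"
proof -
  have "Ck_on p (\<lambda>u::'a. 1 - (\<Sum>b\<in>Basis. (u \<bullet> b) * (u \<bullet> b))) UNIV"
    by (intro Ck_on_diff Ck_on_const Ck_on_sum Ck_on_mult Ck_on_bounded_linear bounded_linear_inner_left) auto
  then have "Ck_on p (\<lambda>u::'a. 1 - (norm u)\<^sup>2) UNIV"
    by (simp add: power2_norm_eq_inner euclidean_inner[symmetric])
  then show ?thesis
    unfolding bump_def[abs_def] by (intro Ck_on_max_power) auto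
qed

lemma bump_bounds: "0 \<le> bump p u" "norm u \<le> 1 / 2 \<Longrightarrow> (3 / 4) ^ Suc p \<le> bump p u" "1 \<le> norm u \<Longrightarrow> bump p u = 0"
proof -
  show "0 \<le> bump p u" by (simp add: bump_def)
  show "bump p u = 0" if "1 \<le> norm u"
    using one_le_power[OF that, of 2] by (simp add: bump_def max_def)
  assume "norm u \<le> 1 / 2"
  then have "(norm u)\<^sup>2 \<le> (1 / 2)\<^sup>2" by (intro power_mono) auto
  then have "3 / 4 \<le> max 0 (1 - (norm u)\<^sup>2)" by (simp add: power2_eq_square)
  then show "(3 / 4) ^ Suc p \<le> bump p u" unfolding bump_def by (rule power_mono) simp
qed

lemma Dl_scale:
  fixes B :: "'a::real_normed_vector \<Rightarrow> real"
  assumes "Ck_on (length vs) B UNIV"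
  shows "Dl vs (\<lambda>x. B (c *\<^sub>R (x - s))) x = Dl (map (\<lambda>v. c *\<^sub>R v) vs) B (c *\<^sub>R (x - s))"
  using assms
proof (induction vs arbitrary: B)
  case Nil
  then show ?case by simp
next
  case (Cons v vs)
  have "frechet_derivative (\<lambda>x. B (c *\<^sub>R (x - s))) (at y) v = frechet_derivative B (at (c *\<^sub>R (y - s))) (c *\<^sub>R v)" for y
  proof -
    have 1: "(B has_derivative frechet_derivative B (at (c *\<^sub>R (y - s)))) (at (c *\<^sub>R (y - s)))"
      using Cons.prems by (intro Ck_on_has_derivative) auto
    have 2: "((\<lambda>x. c *\<^sub>R (x - s)) has_derivative (\<lambda>v. c *\<^sub>R v)) (at y)"
      by (auto intro!: derivative_eq_intros)
    show ?thesis using frechet_derivative_at[OF diff_chain_at[OF 2 1]] by (auto simp: o_def fun_eq_iff)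
  qed
  then show ?case using Cons.IH[of "\<lambda>x. frechet_derivative B (at x) (c *\<^sub>R v)"] Cons.prems by simp
qed

lemma Ck_on_scale:
  fixes B :: "'a::real_normed_vector \<Rightarrow> real"
  assumes "Ck_on k B UNIV"
  shows "Ck_on k (\<lambda>x. B (c *\<^sub>R (x - s))) UNIV"
  using assms
proof (induction k arbitrary: B)
  case 0
  then show ?case by (auto intro!: continuous_intros intro: continuous_on_compose2)
next
  case (Suc k)
  show ?case
  proof (rule Ck_on_SucI[where D="\<lambda>x v. frechet_derivative B (at (c *\<^sub>R (x - s))) (c *\<^sub>R v)"])
    fix y
    have 1: "(B has_derivative frechet_derivative B (at (c *\<^sub>R (y - s)))) (at (c *\<^sub>R (y - s)))"
      using Suc.prems by (intro Ck_on_has_derivative) auto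
    have 2: "((\<lambda>x. c *\<^sub>R (x - s)) has_derivative (\<lambda>v. c *\<^sub>R v)) (at y)"
      by (auto intro!: derivative_eq_intros)
    show "((\<lambda>x. B (c *\<^sub>R (x - s))) has_derivative (\<lambda>v. frechet_derivative B (at (c *\<^sub>R (y - s))) (c *\<^sub>R v))) (at y)"
      using diff_chain_at[OF 2 1] by (simp add: o_def)
  next
    fix v
    show "Ck_on k (\<lambda>x. frechet_derivative B (at (c *\<^sub>R (x - s))) (c *\<^sub>R v)) UNIV"
      using Suc.IH[of "\<lambda>y. frechet_derivative B (at y) (c *\<^sub>R v)"] Suc.prems by simp
  qed simp
qed

lemma dbd_scale:
  fixes B :: "'a::real_normed_vector \<Rightarrow> real"
  assumes "Ck_on k B UNIV" "dbd k A 1 B ((1 / r) *\<^sub>R (x - s))" "r > 0"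
  shows "dbd k A r (\<lambda>x. B ((1 / r) *\<^sub>R (x - s))) x"
  unfolding dbd_def
proof (intro allI impI)
  fix vs :: "'a list" assume l: "length vs \<le> k"
  have "Dl vs (\<lambda>x. B ((1 / r) *\<^sub>R (x - s))) x = Dl (map (\<lambda>v. (1 / r) *\<^sub>R v) vs) B ((1 / r) *\<^sub>R (x - s))"
    by (rule Dl_scale) (use Ck_on_le[OF assms(1) l] in auto)
  moreover have "(\<Prod>v\<leftarrow>map (\<lambda>v. (1 / r) *\<^sub>R v) vs. norm v / 1) = (\<Prod>v\<leftarrow>vs. norm v / r)"
    using assms(3) by (simp add: o_def)
  ultimately show "\<bar>Dl vs (\<lambda>x. B ((1 / r) *\<^sub>R (x - s))) x\<bar> \<le> A * (\<Prod>v\<leftarrow>vs. norm v / r)"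
    using dbdD[OF assms(2), of "map (\<lambda>v. (1 / r) *\<^sub>R v) vs"] l by simp
qed

text \<open>\<open>ell x\<close> is the size at which the construction works near x. The Lipschitz
  condition makes the sizes at neighbouring points comparable, so that finite overlap and uniform
  derivative bounds hold at every scale.\<close>

locale length_scale =
  fixes p :: nat and \<Omega> :: "'a::euclidean_space set" and ell :: "'a \<Rightarrow> real"
  assumes open_dom: "open \<Omega>"
    and ell_pos: "x \<in> \<Omega> \<Longrightarrow> 0 < ell x"
    and ell_ball: "x \<in> \<Omega> \<Longrightarrow> ball x (ell x) \<subseteq> \<Omega>"
    and ell_lip: "x \<in> \<Omega> \<Longrightarrow> y \<in> \<Omega> \<Longrightarrow> ell x \<le> ell y + dist x y"
begin

text \<open>A maximal separated set plays the part of the centres of Whitney cubes; Zorn's lemma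
  provides it because separation is a condition on pairs and passes to unions of chains.\<close>

lemma net_exists: "\<exists>I. I \<subseteq> \<Omega> \<and> (\<forall>s\<in>I. \<forall>t\<in>I. s \<noteq> t \<longrightarrow> min (ell s) (ell t) / 8 \<le> dist s t) \<and>
   (\<forall>x\<in>\<Omega>. \<exists>s\<in>I. dist x s < ell s / 8)"
proof -
  define \<C> where "\<C> = {A. A \<subseteq> \<Omega> \<and> (\<forall>s\<in>A. \<forall>t\<in>A. s \<noteq> t \<longrightarrow> min (ell s) (ell t) / 8 \<le> dist s t)}"
  have "\<exists>M\<in>\<C>. \<forall>X\<in>\<C>. M \<subseteq> X \<longrightarrow> X = M"
  proof (rule subset_Zorn')
    fix C assume C: "subset.chain \<C> C"
    then have sub: "C \<subseteq> \<C>" and ch: "\<And>X Y. X \<in> C \<Longrightarrow> Y \<in> C \<Longrightarrow> X \<subseteq> Y \<or> Y \<subseteq> X"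
      by (auto simp: subset_chain_def)
    show "\<Union>C \<in> \<C>"
      unfolding \<C>_def
    proof (intro CollectI conjI ballI impI)
      show "\<Union>C \<subseteq> \<Omega>" using sub by (auto simp: \<C>_def)
      fix s t assume "s \<in> \<Union>C" "t \<in> \<Union>C" "s \<noteq> t"
      then obtain X Y where XY: "s \<in> X" "t \<in> Y" "X \<in> C" "Y \<in> C" by blast
      then obtain Z where "s \<in> Z" "t \<in> Z" "Z \<in> C" using ch[of X Y] by blast
      then show "min (ell s) (ell t) / 8 \<le> dist s t" using sub \<open>s \<noteq> t\<close> by (auto simp: \<C>_def)
    qed
  qed
  then obtain I where I: "I \<in> \<C>" and max: "\<And>X. X \<in> \<C> \<Longrightarrow> I \<subseteq> X \<Longrightarrow> X = I" by blast
  have "\<exists>s\<in>I. dist x s < ell s / 8" if x: "x \<in> \<Omega>" for x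
  proof (rule ccontr)
    assume neg: "\<not> ?thesis"
    have "x \<notin> I" using neg ell_pos[OF x] by auto
    \<comment> \<open>An uncovered x has distance at least \<open>ell s / 8\<close> from every s,
      which is at least the required separation, so adding it would contradict maximality.\<close>
    moreover have "insert x I \<in> \<C>"
      using I neg x unfolding \<C>_def by (auto simp: not_less dist_commute min_le_iff_disj)
    ultimately show False using max[of "insert x I"] by blast
  qed
  then show ?thesis using I by (intro exI[of _ I]) (auto simp: \<C>_def)
qed

definition net :: "'a set" where
  "net = (SOME I. I \<subseteq> \<Omega> \<and> (\<forall>s\<in>I. \<forall>t\<in>I. s \<noteq> t \<longrightarrow> min (ell s) (ell t) / 8 \<le> dist s t) \<and>
   (\<forall>x\<in>\<Omega>. \<exists>s\<in>I. dist x s < ell s / 8))"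

lemma net: "net \<subseteq> \<Omega>" "s \<in> net \<Longrightarrow> t \<in> net \<Longrightarrow> s \<noteq> t \<Longrightarrow> min (ell s) (ell t) / 8 \<le> dist s t"
   "x \<in> \<Omega> \<Longrightarrow> \<exists>s\<in>net. dist x s < ell s / 8"
  using someI_ex[OF net_exists] unfolding net_def[symmetric] by blast+

definition near :: "'a \<Rightarrow> 'a set" where
  "near x = {s \<in> net. dist x s < ell x / 2}"

lemma ell_near: "x \<in> \<Omega> \<Longrightarrow> s \<in> near x \<Longrightarrow> ell x / 2 \<le> ell s"
  using ell_lip[of x s] net(1) by (force simp: near_def)

text \<open>A packing argument. Points of \<open>near x\<close> have scale at least
  \<open>ell x / 2\<close>, hence mutual distance at least \<open>ell x / 16\<close>; after
  rescaling by \<open>ell x\<close>, no two can share a ball of radius 1 / 32. The cover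
  \<open>T\<close> of the unit ball is fixed before x, so the bound is uniform.\<close>

lemma card_near: "\<exists>N. \<forall>x\<in>\<Omega>. finite (near x) \<and> card (near x) \<le> N"
proof -
  obtain T :: "'a set" where T: "finite T" "cball 0 1 \<subseteq> (\<Union>t\<in>T. ball t (1 / 32))"
  proof (rule compactE_image[OF compact_cball[of "0::'a" 1], of UNIV "\<lambda>t. ball t (1 / 32)"])
    show "cball (0::'a) 1 \<subseteq> (\<Union>t\<in>UNIV. ball t (1 / 32))"
    proof
      fix x :: 'a
      have "x \<in> ball x (1 / 32)" by simp
      then show "x \<in> (\<Union>t\<in>UNIV. ball t (1 / 32))" by blast
    qed
  qed auto
  have "finite (near x) \<and> card (near x) \<le> card T" if x: "x \<in> \<Omega>" for x
  proof -
    let ?L = "ell x"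
    have L: "?L > 0" using ell_pos x by blast
    have "\<exists>t\<in>T. (1 / ?L) *\<^sub>R (s - x) \<in> ball t (1 / 32)" if s: "s \<in> near x" for s
    proof -
      have "norm ((1 / ?L) *\<^sub>R (s - x)) = dist x s / ?L"
        using L by (simp add: dist_norm norm_minus_commute)
      then have "norm ((1 / ?L) *\<^sub>R (s - x)) \<le> 1"
        using s L by (simp add: near_def)
      then have "(1 / ?L) *\<^sub>R (s - x) \<in> cball 0 1" by (simp only: mem_cball_0)
      then show ?thesis using T(2) by blast
    qed
    then obtain \<tau> where \<tau>: "\<And>s. s \<in> near x \<Longrightarrow> \<tau> s \<in> T \<and> (1 / ?L) *\<^sub>R (s - x) \<in> ball (\<tau> s) (1 / 32)" by metis
    have "inj_on \<tau> (near x)"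
    proof (rule inj_onI, rule ccontr)
      fix s t assume st: "s \<in> near x" "t \<in> near x" "\<tau> s = \<tau> t" "s \<noteq> t"
      have "dist ((1 / ?L) *\<^sub>R (s - x)) ((1 / ?L) *\<^sub>R (t - x)) < 1 / 16"
        using \<tau>[OF st(1)] \<tau>[OF st(2)] st(3)
          dist_triangle_half_r[of "\<tau> s" "(1 / ?L) *\<^sub>R (s - x)" "1 / 16" "(1 / ?L) *\<^sub>R (t - x)"] by simp
      moreover have "dist ((1 / ?L) *\<^sub>R (s - x)) ((1 / ?L) *\<^sub>R (t - x)) = dist s t / ?L"
        using L by (simp add: dist_norm scaleR_diff_right[symmetric])
      ultimately have "dist s t / ?L < 1 / 16" by simp
      then have "dist s t < ?L / 16" using L by (simp add: field_simps)
      moreover have "?L / 16 \<le> dist s t"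
        using net(2)[of s t] ell_near[OF x st(1)] ell_near[OF x st(2)] st by (auto simp: near_def)
      ultimately show False by simp
    qed
    moreover have "\<tau> ` near x \<subseteq> T" using \<tau> by blast
    ultimately show ?thesis using T(1) by (metis card_inj_on_le inj_on_finite)
  qed
  then show ?thesis by blast
qed

lemma finite_near: "x \<in> \<Omega> \<Longrightarrow> finite (near x)"
  using card_near by blast

text \<open>The support radius \<open>ell s / 4\<close> is twice the covering radius
  \<open>ell s / 8\<close> of the net, so every point lies in the inner half of some bump, where
  \<open>bump_bounds\<close> gives the lower bound.\<close>

definition wt :: "'a \<Rightarrow> 'a \<Rightarrow> real" where
  "wt s x = bump p ((1 / (ell s / 4)) *\<^sub>R (x - s))"

lemma wt_nonneg: "0 \<le> wt s x" by (simp add: wt_def bump_bounds)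

lemma wt_zero: "s \<in> net \<Longrightarrow> ell s / 4 \<le> dist x s \<Longrightarrow> wt s x = 0"
proof -
  assume s: "s \<in> net" "ell s / 4 \<le> dist x s"
  then have L: "ell s > 0" using ell_pos[of s] net(1) by blast
  then have "norm ((1 / (ell s / 4)) *\<^sub>R (x - s)) = dist x s / (ell s / 4)" by (simp add: dist_norm)
  also have "1 \<le> \<dots>" using s L by simp
  finally show ?thesis unfolding wt_def by (rule bump_bounds)
qed

lemma Ck_on_wt: "Ck_on p (wt s) UNIV"
  unfolding wt_def[abs_def] by (intro Ck_on_scale Ck_on_bump)

text \<open>With \<delta> = dist x s the hypotheses give \<delta> < ell x / 8 + ell s / 4 and ell s
  \<le> ell x + \<delta>, hence \<delta> < ell x / 2. This fixes the radius in
  \<open>near\<close>.\<close>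

lemma wt_support:
  assumes "x \<in> \<Omega>" "dist x y < ell x / 8" "s \<in> net" "wt s y \<noteq> 0"
  shows "s \<in> near x"
proof -
  have "dist y s < ell s / 4" using wt_zero[OF assms(3), of y] assms(4) by (meson not_le)
  moreover have "ell s \<le> ell x + dist s x" using ell_lip assms net(1) by blast
  moreover have "dist x s \<le> dist x y + dist y s" by (rule dist_triangle)
  ultimately show ?thesis using assms by (auto simp: near_def dist_commute)
qed

text \<open>Restricting to nonzero weights makes each sum over the infinite net finite. For
  differentiation \<open>wsum_local\<close> replaces the moving index set by the fixed finite set
  \<open>near x\<close>.\<close>

definition wsum :: "('a \<Rightarrow> 'a \<Rightarrow> real) \<Rightarrow> 'a \<Rightarrow> real" where
  "wsum g x = (\<Sum>s\<in>{s\<in>net. wt s x \<noteq> 0}. wt s x * g s x)"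

lemma wsum_local:
  assumes "x \<in> \<Omega>" "dist x y < ell x / 8"
  shows "wsum g y = (\<Sum>s\<in>near x. wt s y * g s y)"
  unfolding wsum_def
  by (rule sum.mono_neutral_left)
     (use finite_near wt_support[OF assms] assms in \<open>auto simp: near_def\<close>)

definition avg :: "('a \<Rightarrow> 'a \<Rightarrow> real) \<Rightarrow> 'a \<Rightarrow> real" where
  "avg g x = wsum g x * inverse (wsum (\<lambda>_ _. 1) x)"

text \<open>One net point covering x already contributes the bound. It is independent of x, as the
  uniform estimate of the inverse in \<open>avg_dbd\<close> requires.\<close>

lemma wsum_one:
  assumes "x \<in> \<Omega>" shows "(3 / 4) ^ Suc p \<le> wsum (\<lambda>_ _. 1) x"
proof -
  obtain s where s: "s \<in> net" "dist x s < ell s / 8" using net(3)[OF assms] by blast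
  have L: "ell s > 0" using ell_pos s net by blast
  have "norm ((1 / (ell s / 4)) *\<^sub>R (x - s)) = dist x s / (ell s / 4)"
    using L by (simp add: dist_norm)
  then have "norm ((1 / (ell s / 4)) *\<^sub>R (x - s)) \<le> 1 / 2"
    using s L by simp
  then have w: "(3 / 4) ^ Suc p \<le> wt s x" unfolding wt_def by (rule bump_bounds)
  then have "0 < wt s x" using zero_less_power[of "3/4::real" "Suc p"] by linarith
  then have "s \<in> near x" using wt_support[OF assms, of x s] ell_pos[OF assms] s by auto
  then have "wt s x \<le> (\<Sum>s\<in>near x. wt s x)"
    using finite_near[OF assms] by (intro member_le_sum) (auto simp: wt_nonneg)
  then show ?thesis using w wsum_local[OF assms, of x] ell_pos[OF assms] by simp
qed

lemma wsum_one_pos: "x \<in> \<Omega> \<Longrightarrow> 0 < wsum (\<lambda>_ _. 1) x"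
  using wsum_one[of x] zero_less_power[of "3/4::real" "Suc p"] by linarith

lemma Ck_on_wsum:
  assumes "\<And>s. s \<in> net \<Longrightarrow> Ck_on p (\<lambda>x. wt s x * g s x) \<Omega>"
  shows "Ck_on p (wsum g) \<Omega>"
proof (rule Ck_on_local)
  fix x assume x: "x \<in> \<Omega>"
  let ?T = "ball x (ell x / 8)"
  have "?T \<subseteq> \<Omega>" using ell_ball[OF x] ell_pos[OF x] by (auto simp: subset_iff)
  then have "Ck_on p (\<lambda>y. \<Sum>s\<in>near x. wt s y * g s y) ?T"
    by (intro Ck_on_sum Ck_on_subset[OF assms]) (auto simp: near_def)
  then have "Ck_on p (wsum g) ?T"
    by (rule Ck_on_cong_open[rotated 2]) (use wsum_local[OF x] in auto)
  then show "\<exists>T. open T \<and> x \<in> T \<and> Ck_on p (wsum g) T"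
    using ell_pos[OF x] by (intro exI[of _ ?T]) auto
qed

lemma Ck_on_avg:
  assumes "\<And>s. s \<in> net \<Longrightarrow> Ck_on p (\<lambda>x. wt s x * g s x) \<Omega>"
  shows "Ck_on p (avg g) \<Omega>"
proof -
  have "Ck_on p (wt s) \<Omega>" for s using Ck_on_wt by (rule Ck_on_subset) auto
  then have "Ck_on p (wsum (\<lambda>_ _. 1)) \<Omega>" by (intro Ck_on_wsum) auto
  then have "Ck_on p (\<lambda>x. inverse (wsum (\<lambda>_ _. 1) x)) \<Omega>"
    by (rule Ck_on_inverse[OF open_dom]) (use wsum_one_pos in force)
  then show ?thesis
    unfolding avg_def[abs_def] by (intro Ck_on_mult[OF open_dom Ck_on_wsum[OF assms]])
qed

text \<open>The normalised weights add up to 1, so a function common to all indices passes through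
  the average. Whitney's estimate uses this to reduce to differences of neighbouring
  polynomials.\<close>

lemma avg_diff_const:
  assumes "x \<in> \<Omega>" shows "avg (\<lambda>s y. g s y - Q y) x = avg g x - Q x"
proof -
  have "wsum (\<lambda>s y. g s y - Q y) x = wsum g x - Q x * wsum (\<lambda>_ _. 1) x"
    unfolding wsum_def by (simp add: right_diff_distrib sum_subtractf sum_distrib_left mult_ac)
  then show ?thesis using wsum_one_pos[OF assms] by (simp add: avg_def field_simps)
qed

lemma avg_eq:
  assumes "x \<in> \<Omega>" "\<And>s. s \<in> net \<Longrightarrow> wt s x \<noteq> 0 \<Longrightarrow> g s x = c"
  shows "avg g x = c"
proof -
  have "wsum g x = c * wsum (\<lambda>_ _. 1) x"
    unfolding wsum_def using assms(2) by (simp add: sum_distrib_left mult_ac)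
  then show ?thesis using wsum_one_pos[OF assms(1)] by (simp add: avg_def)
qed

text \<open>Near x at most N bumps are active, each with derivatives bounded at scale
  \<open>ell x / 8\<close>, so the constant depends neither on x nor on the averaged
  functions.\<close>

lemma avg_dbd:
  "\<exists>C\<ge>0. \<forall>x\<in>\<Omega>. \<forall>g D. (\<forall>s\<in>near x. Ck_on p (g s) UNIV \<and> dbd p D (ell x) (g s) x) \<longrightarrow> D \<ge> 0 \<longrightarrow>
      dbd p (C * D) (ell x / 8) (avg g) x"
proof -
  obtain N where N: "\<And>x. x \<in> \<Omega> \<Longrightarrow> card (near x) \<le> N" using card_near by blast
  \<comment> \<open>Radius 4 suffices: for s in \<open>near x\<close> the rescaled argument has norm
    at most (ell x / 2) / (ell x / 8).\<close>
  obtain A where A: "\<And>u::'a. u \<in> cball 0 4 \<Longrightarrow> dbd p A 1 (bump p) u"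
    using dbd_compact[OF open_UNIV Ck_on_bump compact_cball[of 0 4]] by blast
  have A0: "A \<ge> 0" using dbd_nonneg[OF A[of 0]] by simp
  have "(0::real) < (3 / 4) ^ Suc p" by simp
  from dbd_inverse_ex[OF this, of p "real N * A"] obtain Ci where
   Ci: "\<And>h (f :: 'a \<Rightarrow> real) S x. h > 0 \<Longrightarrow> open S \<Longrightarrow> x \<in> S \<Longrightarrow> Ck_on p f S \<Longrightarrow>
     (\<forall>y\<in>S. f y \<noteq> 0) \<Longrightarrow> (3 / 4) ^ Suc p \<le> \<bar>f x\<bar> \<Longrightarrow> dbd p (real N * A) h f x \<Longrightarrow> dbd p Ci h (\<lambda>x. inverse (f x)) x"
    by blast
  define C where "C = 2 ^ p * (real N * (2 ^ p * A)) * \<bar>Ci\<bar>"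
  have "C \<ge> 0" using A0 by (simp add: C_def)
  moreover have "dbd p (C * D) (ell x / 8) (avg g) x"
    if x: "x \<in> \<Omega>" and g: "\<And>s. s \<in> near x \<Longrightarrow> Ck_on p (g s) UNIV" "\<And>s. s \<in> near x \<Longrightarrow> dbd p D (ell x) (g s) x" and D: "D \<ge> 0"
    for x g D
  proof -
    let ?h = "ell x / 8" and ?T = "ball x (ell x / 8)"
    have h: "?h > 0" "ell x > 0" using ell_pos[OF x] by auto
    have T: "open ?T" "x \<in> ?T" "?T \<subseteq> \<Omega>" using h ell_ball[OF x] by auto
    have Cw: "Ck_on p (wt s) ?T" for s using Ck_on_wt by (rule Ck_on_subset) auto
    have Cg: "Ck_on p (g s) ?T" if "s \<in> near x" for s using g(1)[OF that] by (rule Ck_on_subset) auto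
    have wd: "dbd p A ?h (wt s) x" if s: "s \<in> near x" for s
    proof -
      have ls: "ell s / 4 > 0" "?h \<le> ell s / 4" using ell_near[OF x s] h by auto
      have "norm ((1 / (ell s / 4)) *\<^sub>R (x - s)) = dist x s / (ell s / 4)"
        using ls by (simp add: dist_norm)
      also have "\<dots> \<le> (ell x / 2) / ?h" using s ls h by - (rule frac_le, auto simp: near_def)
      finally have "(1 / (ell s / 4)) *\<^sub>R (x - s) \<in> cball 0 4" using h by simp
      then have "dbd p A (ell s / 4) (wt s) x"
        unfolding wt_def[abs_def] by (intro dbd_scale Ck_on_bump A ls)
      then show ?thesis by (rule dbd_shrink) (use h ls in auto)
    qed
    have "dbd p (\<Sum>s\<in>near x. 2 ^ p * A * D) ?h (\<lambda>y. \<Sum>s\<in>near x. wt s y * g s y) x"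
      by (intro dbd_sum[OF T(1,2)] dbd_mult[OF T(1,2)] Ck_on_mult T Cw Cg wd h)
         (use h in \<open>auto intro: dbd_shrink[OF g(2)]\<close>)
    then have "dbd p (real N * (2 ^ p * A) * D) ?h (\<lambda>y. \<Sum>s\<in>near x. wt s y * g s y) x"
      by (rule dbd_mono) (use N[OF x] A0 D h in \<open>auto simp: mult.assoc intro!: mult_right_mono\<close>)
    then have 1: "dbd p (real N * (2 ^ p * A) * D) ?h (wsum g) x"
      by (rule dbd_cong[OF T(1) _ _ T(2), rotated 2])
         (use wsum_local[OF x, of _ g] in \<open>auto intro!: Ck_on_sum Ck_on_mult Cw Cg\<close>)
    have "dbd p (\<Sum>s\<in>near x. A) ?h (\<lambda>y. \<Sum>s\<in>near x. wt s y) x"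
      by (intro dbd_sum[OF T(1,2)] Cw wd h)
    then have "dbd p (real N * A) ?h (\<lambda>y. \<Sum>s\<in>near x. wt s y) x"
      by (rule dbd_mono) (use N[OF x] A0 h in \<open>auto intro!: mult_right_mono\<close>)
    then have 2: "dbd p (real N * A) ?h (wsum (\<lambda>_ _. 1)) x"
      by (rule dbd_cong[OF T(1) _ _ T(2), rotated 2])
         (use wsum_local[OF x, of _ "\<lambda>_ _. 1"] in \<open>auto intro!: Ck_on_sum Cw\<close>)
    have CS: "Ck_on p (wsum (\<lambda>_ _. 1)) ?T"
      by (rule Ck_on_subset[OF Ck_on_wsum T(3)]) (use Ck_on_wt in \<open>auto intro: Ck_on_subset\<close>)
    have CW: "Ck_on p (wsum g) ?T"
      by (rule Ck_on_cong_open[OF T(1), of "\<lambda>y. \<Sum>s\<in>near x. wt s y * g s y"])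
         (use wsum_local[OF x, of _ g] in \<open>auto intro!: Ck_on_sum Ck_on_mult Cw Cg\<close>)
    have nz: "\<forall>y\<in>?T. wsum (\<lambda>_ _. 1) y \<noteq> 0" using wsum_one_pos T(3) by force
    have "dbd p Ci ?h (\<lambda>x. inverse (wsum (\<lambda>_ _. 1) x)) x"
      by (rule Ci[OF h(1) T(1,2) CS nz _ 2]) (use wsum_one[OF x] in linarith)
    then have 3: "dbd p \<bar>Ci\<bar> ?h (\<lambda>x. inverse (wsum (\<lambda>_ _. 1) x)) x"
      by (rule dbd_mono) (use h in auto)
    have "dbd p (2 ^ p * (real N * (2 ^ p * A) * D) * \<bar>Ci\<bar>) ?h (avg g) x"
      unfolding avg_def[abs_def]
      by (rule dbd_mult[OF T(1,2) CW _ h(1) 1 3]) (use nz CS in \<open>auto intro!: Ck_on_inverse\<close>)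
    then show ?thesis by (simp add: C_def mult_ac)
  qed
  ultimately show ?thesis by blast
qed

end

section \<open>Whitney's extension theorem\<close>

lemma norm_prod_divide: "(\<Prod>v\<leftarrow>vs. norm v / h) = (\<Prod>v\<leftarrow>vs. norm v) / h ^ length vs"
  by (induction vs) auto

lemma has_derivative_approx:
  fixes u w :: "'a::real_normed_vector \<Rightarrow> real"
  assumes "(w has_derivative w') (at a)"
    and "\<And>e. e > 0 \<Longrightarrow> \<exists>d>0. \<forall>y. norm (y - a) < d \<longrightarrow> \<bar>u y - w y\<bar> \<le> e * norm (y - a)"
  shows "(u has_derivative w') (at a)"
proof -
  have ua: "u a = w a" using assms(2)[of 1] by (auto dest!: spec[of _ a])
  have "((\<lambda>y. u y - w y) has_derivative (\<lambda>v. 0)) (at a)"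
    unfolding has_derivative_at_alt using assms(2) by (auto simp: ua)
  from has_derivative_add[OF this assms(1)] show ?thesis by simp
qed

text \<open>The jet at a is stored as the polynomial \<open>G a\<close>, and compatibility is one
  supremum bound on a ball of radius |a - b|. The classical bounds on every derivative follow from
  it by \<open>Ppoly_dbd\<close>.\<close>

theorem Whitney_extension:
  fixes G :: "real^'n::finite \<Rightarrow> real^'n \<Rightarrow> real"
  assumes K: "closed K" and G: "\<And>a. a \<in> K \<Longrightarrow> G a \<in> Ppoly p"
    and W: "\<And>a0 e. a0 \<in> K \<Longrightarrow> e > 0 \<Longrightarrow> \<exists>d>0. \<forall>a\<in>K. \<forall>b\<in>K. dist a a0 < d \<longrightarrow> dist b a0 < d \<longrightarrow>
        (\<forall>x. norm (x - b) \<le> norm (a - b) \<longrightarrow> \<bar>G a x - G b x\<bar> \<le> e * norm (a - b) ^ p)"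
  shows "\<exists>F. Ck_on p F UNIV \<and> (\<forall>a\<in>K. F a = G a a)"
proof (cases "K = {}")
  case True
  then show ?thesis by (intro exI[of _ "\<lambda>_. 0"]) (auto simp: Ck_on_const)
next
  case ne: False
  let ?ell = "\<lambda>x. infdist x K"
  have pos: "0 < ?ell x" if "x \<notin> K" for x
    using infdist_pos_not_in_closed[OF K ne that] .
  interpret length_scale p "- K" ?ell
  proof
    show "open (- K)" using K by auto
    show "ball x (?ell x) \<subseteq> - K" for x using infdist_le[of _ K x] by force
    show "?ell x \<le> ?ell y + dist x y" for x y by (rule infdist_triangle)
  qed (use pos in auto)
  obtain C1 where C1: "C1 \<ge> 0" and C1b: "\<And>Q (z::real^'n) r R A x. Q \<in> Ppoly p \<Longrightarrow> 0 < r \<Longrightarrow> r \<le> R \<Longrightarrow>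
      (\<forall>y\<in>cball z r. \<bar>Q y\<bar> \<le> A) \<Longrightarrow> norm (x - z) \<le> R \<Longrightarrow> dbd p (C1 * A * (R / r) ^ p) R Q x"
    using Ppoly_dbd[of p, where 'n='n] by blast
  have CG: "Ck_on p (G a) UNIV" if "a \<in> K" for a using Ck_on_Ppoly[OF G[OF that]] .
  \<comment> \<open>At any scale R \<ge> |a - b| the loss (R / |a - b|)^p of the Markov-type
    inequality cancels the factor |a - b|^p of the hypothesis and leaves R^p.\<close>
  have W': "\<exists>d>0. \<forall>a\<in>K. \<forall>b\<in>K. dist a a0 < d \<longrightarrow> dist b a0 < d \<longrightarrow>
        (\<forall>R x. 0 < R \<longrightarrow> norm (a - b) \<le> R \<longrightarrow> norm (x - b) \<le> R \<longrightarrow> dbd p (e * R ^ p) R (\<lambda>y. G a y - G b y) x)"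
    if a0: "a0 \<in> K" and e: "e > 0" for a0 e
  proof -
    define e' where "e' = e / (C1 + 1)"
    have e': "e' > 0" "C1 * e' \<le> e" using e C1 by (auto simp: e'_def field_simps)
    obtain d where d: "d > 0" "\<And>a b x. a \<in> K \<Longrightarrow> b \<in> K \<Longrightarrow> dist a a0 < d \<Longrightarrow> dist b a0 < d \<Longrightarrow>
        norm (x - b) \<le> norm (a - b) \<Longrightarrow> \<bar>G a x - G b x\<bar> \<le> e' * norm (a - b) ^ p"
      using W[OF a0 e'(1)] by blast
    have "dbd p (e * R ^ p) R (\<lambda>y. G a y - G b y) x"
      if ab: "a \<in> K" "b \<in> K" "dist a a0 < d" "dist b a0 < d" and R: "0 < R" "norm (a - b) \<le> R" "norm (x - b) \<le> R"
      for a b R x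
    proof (cases "a = b")
      case True
      then show ?thesis using dbd_const[OF R(1), of p 0 x] e R(1) by (auto intro: dbd_mono)
    next
      case False
      let ?r = "norm (a - b)"
      have r: "?r > 0" using False by simp
      have bd: "\<forall>y\<in>cball b ?r. \<bar>G a y - G b y\<bar> \<le> e' * ?r ^ p"
        using d(2)[OF ab] by (auto simp: dist_norm norm_minus_commute)
      have "dbd p (C1 * (e' * ?r ^ p) * (R / ?r) ^ p) R (\<lambda>y. G a y - G b y) x"
        by (rule C1b[OF Ppoly_diff[OF G G] r R(2) bd R(3)]) (use ab in auto)
      moreover have "C1 * (e' * ?r ^ p) * (R / ?r) ^ p = (C1 * e') * R ^ p"
        using r by (simp add: power_divide)
      moreover have "(C1 * e') * R ^ p \<le> e * R ^ p" using e' R by (intro mult_right_mono) auto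
      ultimately show ?thesis using R(1) by (auto intro: dbd_mono)
    qed
    then show ?thesis using d(1) by blast
  qed
  have "\<exists>y\<in>K. infdist x K = dist x y" for x using infdist_attains_inf[OF K ne, of x] by blast
  then obtain np where np: "\<And>x. np x \<in> K" "\<And>x. infdist x K = dist x (np x)" by metis
  \<comment> \<open>Whitney's formula: near a point off K, average the polynomials attached to
    nearest points of K.\<close>
  define F0 where "F0 = avg (\<lambda>s. G (np s))"
  have CF0: "Ck_on p F0 (- K)"
    unfolding F0_def
  proof (rule Ck_on_avg)
    fix s
    show "Ck_on p (\<lambda>x. wt s x * G (np s) x) (- K)"
      using Ck_on_subset[OF Ck_on_wt] Ck_on_subset[OF CG[OF np(1)]] by (intro Ck_on_mult open_dom) auto
  qed
  obtain C2 where C2: "C2 \<ge> 0" and C2b: "\<And>x g D. x \<in> - K \<Longrightarrow>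
     (\<forall>s\<in>near x. Ck_on p (g s) UNIV \<and> dbd p D (?ell x) (g s) x) \<Longrightarrow> D \<ge> 0 \<Longrightarrow> dbd p (C2 * D) (?ell x / 8) (avg g) x"
    using avg_dbd by blast
  define FF where "FF vs x = (if x \<in> K then Dl vs (G x) x else Dl vs F0 x)" for vs x
  \<comment> \<open>The one estimate needed at points of K: for lists shorter than p it gives
    differentiability there, and for lists of length p continuity.\<close>
  have approx: "\<exists>d>0. \<forall>x. norm (x - a) < d \<longrightarrow>
      (\<forall>vs. length vs \<le> p \<longrightarrow> \<bar>FF vs x - Dl vs (G a) x\<bar> \<le> e * norm (x - a) ^ (p - length vs) * (\<Prod>v\<leftarrow>vs. norm v))"
    if a: "a \<in> K" and e: "e > 0" for a e
  proof -
    \<comment> \<open>One summand per comparison: the averaging error with scale h / 8 and centres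
      within 3 h, the passage from the nearest point to a at scale 2 |x - a|, and the case of x in
      K.\<close>
    define C3 where "C3 = C2 * 3 ^ p * 8 ^ p + 2 ^ p + 1"
    have C3: "C3 > 0" using C2 by (simp add: C3_def add_nonneg_pos)
    define e1 where "e1 = e / C3"
    have e1: "e1 > 0" "C3 * e1 = e" using e C3 by (auto simp: e1_def)
    obtain d where d: "d > 0" "\<And>b c R x. b \<in> K \<Longrightarrow> c \<in> K \<Longrightarrow> dist b a < d \<Longrightarrow> dist c a < d \<Longrightarrow>
        0 < R \<Longrightarrow> norm (b - c) \<le> R \<Longrightarrow> norm (x - c) \<le> R \<Longrightarrow> dbd p (e1 * R ^ p) R (\<lambda>y. G b y - G c y) x"
      using W'[OF a e1(1)] by blast
    have Dd: "Dl vs (\<lambda>y. G b y - G c y) x = Dl vs (G b) x - Dl vs (G c) x" if "b \<in> K" "c \<in> K" "length vs \<le> p" for vs b c x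
      using that(3) by (intro Dl_diff[OF open_UNIV Ck_on_le[OF CG[OF that(1)]] Ck_on_le[OF CG[OF that(2)]]]) auto
    have pw: "h ^ p * (\<Prod>v\<leftarrow>vs. norm v / h) = h ^ (p - length vs) * (\<Prod>v\<leftarrow>vs. norm v)"
      if "h > 0" "length vs \<le> p" for h and vs :: "(real^'n) list"
      using that by (simp add: norm_prod_divide power_diff)
    \<comment> \<open>A quarter of d leaves room for the nearest points that enter: they lie within
      3 |x - a| of a.\<close>
    have "\<bar>FF vs x - Dl vs (G a) x\<bar> \<le> e * norm (x - a) ^ (p - length vs) * (\<Prod>v\<leftarrow>vs. norm v)"
      if x: "norm (x - a) < d / 4" and l: "length vs \<le> p" for x vs
    proof -
      let ?t = "norm (x - a)" and ?P = "\<Prod>v\<leftarrow>vs. norm v"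
      have P: "?P \<ge> 0" using norm_prod_nonneg[of 1 vs] by simp
      show ?thesis
      proof (cases "x \<in> K")
        case True
        show ?thesis
        proof (cases "x = a")
          case True
          then show ?thesis using P e a by (simp add: FF_def)
        next
          case False
          then have t: "?t > 0" by simp
          have "dbd p (e1 * ?t ^ p) ?t (\<lambda>y. G x y - G a y) x"
            by (rule d(2)) (use True a x t d(1) in \<open>auto simp: dist_norm\<close>)
          from dbdD[OF this l] have "\<bar>FF vs x - Dl vs (G a) x\<bar> \<le> e1 * (?t ^ (p - length vs) * ?P)"
            using True Dd[OF True a l] pw[OF t l] by (simp add: FF_def mult.assoc)
          also have "\<dots> \<le> C3 * e1 * (?t ^ (p - length vs) * ?P)"
            using P e1 C2 by (intro mult_right_mono) (auto simp: C3_def algebra_simps)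
          finally show ?thesis by (simp add: e1 mult.assoc)
        qed
      next
        case False
        let ?h = "?ell x" and ?b = "np x"
        have h: "?h > 0" using pos False by simp
        have ht: "?h \<le> ?t" using infdist_le[OF a, of x] by (simp add: dist_norm)
        have t: "?t > 0" using h ht by linarith
        have xb: "dist x ?b = ?h" using np by simp
        have xt: "dist x a = ?t" by (rule dist_norm)
        have ba: "dist ?b a \<le> 2 * ?t"
          using dist_triangle3[of ?b a x] xb ht xt by linarith
        \<comment> \<open>With h the distance from x to K, the scale at s is at most 3 h / 2, so
          \<open>np s\<close> is within 2 h of x and within 3 h of \<open>np x\<close>.\<close>
        have nd: "dbd p (e1 * (3 * ?h) ^ p) ?h (\<lambda>y. G (np s) y - G ?b y) x" if s: "s \<in> near x" for s
        proof -
          have xs: "dist x s < ?h / 2" using s by (simp add: near_def)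
          have "dist s (np s) \<le> ?h + dist x s"
            using infdist_triangle[of s K x] np(2)[of s] by (simp add: dist_commute)
          then have xn: "dist x (np s) \<le> 2 * ?h" using dist_triangle[of x "np s" s] xs by linarith
          then have "dist (np s) ?b \<le> 3 * ?h" using dist_triangle3[of "np s" ?b x] xb by linarith
          moreover have "dist (np s) a < d"
            using dist_triangle3[of "np s" a x] xn ht x xt d(1) by linarith
          ultimately have "dbd p (e1 * (3 * ?h) ^ p) (3 * ?h) (\<lambda>y. G (np s) y - G ?b y) x"
            using np ba x d(1) h xb by (intro d(2)) (auto simp: dist_norm)
          then show ?thesis by (rule dbd_shrink) (use h in auto)
        qed
        have avd: "dbd p (C2 * (e1 * (3 * ?h) ^ p)) (?h / 8) (avg (\<lambda>s y. G (np s) y - G ?b y)) x"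
          by (rule C2b) (use False nd CG np e1 h in \<open>auto intro!: Ck_on_diff\<close>)
        have Dle: "Dl vs (avg (\<lambda>s y. G (np s) y - G ?b y)) x = Dl vs F0 x - Dl vs (G ?b) x"
        proof -
          have c: "Ck_on (length vs) F0 (- K)" "Ck_on (length vs) (G ?b) (- K)"
            using Ck_on_le[OF CF0 l] Ck_on_le[OF Ck_on_subset[OF CG[OF np(1)]] l] by auto
          have "Dl vs (\<lambda>y. F0 y - G ?b y) x = Dl vs (avg (\<lambda>s y. G (np s) y - G ?b y)) x"
            by (rule Dl_cong[OF open_dom])
               (use False c in \<open>auto simp: F0_def avg_diff_const intro!: Ck_on_diff open_dom\<close>)
          then show ?thesis using Dl_diff[OF open_dom c] False by simp
        qed
        have "\<bar>Dl vs F0 x - Dl vs (G ?b) x\<bar> \<le> C2 * (e1 * (3 * ?h) ^ p) * (\<Prod>v\<leftarrow>vs. norm v / (?h / 8))"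
          using dbdD[OF avd l] by (simp only: Dle)
        also have "\<dots> = C2 * e1 * 3 ^ p * 8 ^ p * ((?h / 8) ^ p * (\<Prod>v\<leftarrow>vs. norm v / (?h / 8)))"
          by (simp add: power_mult_distrib power_divide)
        also have "\<dots> = C2 * e1 * 3 ^ p * 8 ^ p * ((?h / 8) ^ (p - length vs) * ?P)"
          using h by (subst pw[OF _ l]) auto
        also have "\<dots> \<le> C2 * e1 * 3 ^ p * 8 ^ p * (?t ^ (p - length vs) * ?P)"
          using C2 e1 h ht P by (intro mult_left_mono mult_right_mono power_mono) auto
        finally have 1: "\<bar>Dl vs F0 x - Dl vs (G ?b) x\<bar> \<le> C2 * e1 * 3 ^ p * 8 ^ p * (?t ^ (p - length vs) * ?P)" .
        have "dbd p (e1 * (2 * ?t) ^ p) (2 * ?t) (\<lambda>y. G ?b y - G a y) x"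
        proof (rule d(2)[OF np(1) a])
          show "dist ?b a < d" using ba x d(1) t by linarith
          show "dist a a < d" using d(1) by simp
        qed (use ba t in \<open>auto simp: dist_norm\<close>)
        then have "dbd p (e1 * (2 * ?t) ^ p) ?t (\<lambda>y. G ?b y - G a y) x"
          by (rule dbd_shrink) (use t in auto)
        from dbdD[OF this l] have "\<bar>Dl vs (G ?b) x - Dl vs (G a) x\<bar> \<le> e1 * (2 * ?t) ^ p * (\<Prod>v\<leftarrow>vs. norm v / ?t)"
          using Dd[OF np(1) a l] by simp
        also have "\<dots> = e1 * 2 ^ p * (?t ^ p * (\<Prod>v\<leftarrow>vs. norm v / ?t))"
          by (simp add: power_mult_distrib)
        also have "\<dots> = e1 * 2 ^ p * (?t ^ (p - length vs) * ?P)"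
          using t by (subst pw[OF _ l]) auto
        finally have 2: "\<bar>Dl vs (G ?b) x - Dl vs (G a) x\<bar> \<le> e1 * 2 ^ p * (?t ^ (p - length vs) * ?P)" .
        have "\<bar>FF vs x - Dl vs (G a) x\<bar> \<le> (C2 * e1 * 3 ^ p * 8 ^ p + e1 * 2 ^ p) * (?t ^ (p - length vs) * ?P)"
          using 1 2 False by (simp add: FF_def distrib_right)
        also have "\<dots> \<le> C3 * e1 * (?t ^ (p - length vs) * ?P)"
          using P e1 by (intro mult_right_mono) (auto simp: C3_def algebra_simps)
        finally show ?thesis by (simp add: e1 mult.assoc)
      qed
    qed
    then show ?thesis using d(1) by (intro exI[of _ "d / 4"]) auto
  qed
  have "Ck_on p (FF []) UNIV"
  proof (rule Ck_on_from_family)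
    fix vs and a :: "real^'n" assume l: "length (vs :: (real^'n) list) < p"
    show "(FF vs has_derivative (\<lambda>v. FF (vs @ [v]) a)) (at a)"
    proof (cases "a \<in> K")
      case False
      then have "(Dl vs F0 has_derivative (\<lambda>v. Dl (vs @ [v]) F0 a)) (at a)"
        using Dl_has_derivative[OF CF0 l] by simp
      then have "(FF vs has_derivative (\<lambda>v. Dl (vs @ [v]) F0 a)) (at a)"
        by (rule has_derivative_transform_within_open[OF _ open_dom]) (use False in \<open>auto simp: FF_def\<close>)
      then show ?thesis using False by (simp add: FF_def)
    next
      case True
      let ?P = "\<Prod>v\<leftarrow>vs. norm v"
      have P: "?P \<ge> 0" using norm_prod_nonneg[of 1 vs] by simp
      have "(Dl vs (G a) has_derivative (\<lambda>v. Dl (vs @ [v]) (G a) a)) (at a)"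
        by (rule Dl_has_derivative[OF CG[OF True] l]) simp
      then have "(FF vs has_derivative (\<lambda>v. Dl (vs @ [v]) (G a) a)) (at a)"
      proof (rule has_derivative_approx)
        fix e :: real assume e: "e > 0"
        define e' where "e' = e / (?P + 1)"
        have e': "e' > 0" "e' * ?P \<le> e" using e P by (auto simp: e'_def field_simps)
        obtain d where d: "d > 0" "\<And>x vs. norm (x - a) < d \<Longrightarrow> length vs \<le> p \<Longrightarrow>
           \<bar>FF vs x - Dl vs (G a) x\<bar> \<le> e' * norm (x - a) ^ (p - length vs) * (\<Prod>v\<leftarrow>vs. norm v)"
          using approx[OF True e'(1)] by blast
        have "\<bar>FF vs y - Dl vs (G a) y\<bar> \<le> e * norm (y - a)" if y: "norm (y - a) < min d 1" for y
        proof -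
          \<comment> \<open>\<open>length vs < p\<close> leaves a positive exponent, and the cap 1
            on the radius makes the first power the largest.\<close>
          have "norm (y - a) ^ (p - length vs) \<le> norm (y - a) ^ 1"
            using y l by (intro power_decreasing) auto
          then have "(e' * ?P) * norm (y - a) ^ (p - length vs) \<le> e * norm (y - a)"
            using e' P e by (intro mult_mono) auto
          then show ?thesis using d(2)[of y vs] y l by (simp add: mult_ac)
        qed
        then show "\<exists>d>0. \<forall>y. norm (y - a) < d \<longrightarrow> \<bar>FF vs y - Dl vs (G a) y\<bar> \<le> e * norm (y - a)"
          using d(1) by (intro exI[of _ "min d 1"]) auto
      qed
      then show ?thesis using True by (simp add: FF_def)
    qed
  next
    fix vs :: "(real^'n) list" assume l: "length vs = p"
    show "continuous_on UNIV (FF vs)"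
    proof (intro continuous_at_imp_continuous_on ballI)
      fix a :: "real^'n"
      show "isCont (FF vs) a"
      proof (cases "a \<in> K")
        case False
        have "continuous_on (- K) (Dl vs F0)" using Dl_continuous_on[OF CF0] l by simp
        then have "continuous_on (- K) (FF vs)"
          by (rule continuous_on_eq) (simp add: FF_def)
        then show ?thesis using False open_dom by (simp add: continuous_on_eq_continuous_at)
      next
        case True
        let ?P = "\<Prod>v\<leftarrow>vs. norm v"
        have P: "?P \<ge> 0" using norm_prod_nonneg[of 1 vs] by simp
        have "continuous_on UNIV (Dl vs (G a))" using Dl_continuous_on[OF CG[OF True]] l by simp
        then have G': "(Dl vs (G a) \<longlongrightarrow> Dl vs (G a) a) (at a)"
          by (simp add: continuous_on_eq_continuous_at isCont_def)
        have "((\<lambda>x. FF vs x - Dl vs (G a) x) \<longlongrightarrow> 0) (at a)"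
        proof (rule tendstoI)
          fix e :: real assume e: "e > 0"
          define e' where "e' = e / (2 * (?P + 1))"
          have e': "e' > 0" "e' * ?P < e" using e P by (auto simp: e'_def field_simps intro!: add_pos_nonneg)
          obtain d where d: "d > 0" "\<And>x vs. norm (x - a) < d \<Longrightarrow> length vs \<le> p \<Longrightarrow>
             \<bar>FF vs x - Dl vs (G a) x\<bar> \<le> e' * norm (x - a) ^ (p - length vs) * (\<Prod>v\<leftarrow>vs. norm v)"
            using approx[OF True e'(1)] by blast
          \<comment> \<open>At top order the power of |x - a| is the zeroth, so smallness comes from
            e' alone.\<close>
          have "\<bar>FF vs x - Dl vs (G a) x\<bar> < e" if "norm (x - a) < d" for x
            using d(2)[OF that, of vs] l e'(2) by simp
          then show "\<forall>\<^sub>F x in at a. dist (FF vs x - Dl vs (G a) x) 0 < e"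
            unfolding eventually_at using d(1) by (intro exI[of _ d]) (auto simp: dist_norm)
        qed
        from tendsto_add[OF this G'] have "(FF vs \<longlongrightarrow> Dl vs (G a) a) (at a)" by simp
        then show ?thesis using True by (simp add: isCont_def FF_def)
      qed
    qed
  qed auto
  then show ?thesis by (intro exI[of _ "FF []"]) (auto simp: FF_def)
qed

section \<open>Bundles and their limits\<close>

text \<open>Functionals are functions of multi-indices with the product topology, so limits in the
  closures defining \<open>rhoPhi\<close> may be checked on each monomial.\<close>

lemma tendsto_coordinatewiseI:
  fixes u :: "nat \<Rightarrow> 'i \<Rightarrow> real"
  assumes "\<And>i. (\<lambda>n. u n i) \<longlonglongrightarrow> l i"
  shows "u \<longlonglongrightarrow> l"
proof -
  have "limitin (product_topology (\<lambda>i::'i. euclidean :: real topology) UNIV) u l sequentially"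
    unfolding limitin_componentwise using assms by auto
  then show ?thesis by (simp add: euclidean_product_topology)
qed

lemma lspan2_superset: "A \<subseteq> lspan2 A"
proof
  fix v assume "v \<in> A"
  then show "v \<in> lspan2 A"
    unfolding lspan2_def by (intro CollectI exI[of _ "{v}"] exI[of _ "\<lambda>_. 1"]) auto
qed

lemma lspan2_zero: "((\<lambda>_. 0), 0) \<in> lspan2 A"
  unfolding lspan2_def by (intro CollectI exI[of _ "{}"]) auto

lemma lspan2_scale: "(\<xi>, l) \<in> lspan2 A \<Longrightarrow> ((\<lambda>\<alpha>. c * \<xi> \<alpha>), c * l) \<in> lspan2 A"
proof -
  assume "(\<xi>, l) \<in> lspan2 A"
  then obtain S d where S: "finite S" "S \<subseteq> A" "\<xi> = (\<lambda>\<alpha>. \<Sum>w\<in>S. d w * fst w \<alpha>)" "l = (\<Sum>w\<in>S. d w * snd w)"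
    unfolding lspan2_def by auto
  then show ?thesis
    unfolding lspan2_def
    by (intro CollectI exI[of _ S] exI[of _ "\<lambda>w. c * d w"]) (auto simp: sum_distrib_left mult_ac)
qed

lemma lspan2_add:
  assumes "(\<xi>, l) \<in> lspan2 A" "(\<eta>, m) \<in> lspan2 A"
  shows "((\<lambda>\<alpha>. \<xi> \<alpha> + \<eta> \<alpha>), l + m) \<in> lspan2 A"
proof -
  obtain S d where S: "finite S" "S \<subseteq> A" "\<xi> = (\<lambda>\<alpha>. \<Sum>w\<in>S. d w * fst w \<alpha>)" "l = (\<Sum>w\<in>S. d w * snd w)"
    using assms(1) unfolding lspan2_def by auto
  obtain T e where T: "finite T" "T \<subseteq> A" "\<eta> = (\<lambda>\<alpha>. \<Sum>w\<in>T. e w * fst w \<alpha>)" "m = (\<Sum>w\<in>T. e w * snd w)"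
    using assms(2) unfolding lspan2_def by auto
  let ?d = "\<lambda>w. if w \<in> S then d w else 0" and ?e = "\<lambda>w. if w \<in> T then e w else 0"
  have 1: "(\<Sum>w\<in>S. d w * g w) = (\<Sum>w\<in>S \<union> T. ?d w * g w)" for g :: "_ \<Rightarrow> real"
    using S T by (intro sum.mono_neutral_cong_left) auto
  have 2: "(\<Sum>w\<in>T. e w * g w) = (\<Sum>w\<in>S \<union> T. ?e w * g w)" for g :: "_ \<Rightarrow> real"
    using S T by (intro sum.mono_neutral_cong_left) auto
  show ?thesis
    unfolding lspan2_def S(3,4) T(3,4) 1 2
    by (intro CollectI exI[of _ "S \<union> T"] exI[of _ "\<lambda>w. ?d w + ?e w"])
       (use S T in \<open>simp add: sum.distrib distrib_right\<close>)
qed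

section \<open>Linear fibres and the iterates of \<open>rhoPhi\<close>\<close>

definition linear_bundle :: "'a set \<Rightarrow> ('a \<times> ('n mindex \<Rightarrow> real) \<times> real) set \<Rightarrow> bool" where
  "linear_bundle X \<Phi> \<longleftrightarrow> (\<forall>a\<in>X. (a, (\<lambda>_. 0), 0) \<in> \<Phi>) \<and>
     (\<forall>a \<xi> l \<eta> m. (a, \<xi>, l) \<in> \<Phi> \<longrightarrow> (a, \<eta>, m) \<in> \<Phi> \<longrightarrow> (a, (\<lambda>\<alpha>. \<xi> \<alpha> + \<eta> \<alpha>), l + m) \<in> \<Phi>) \<and>
     (\<forall>a \<xi> l c. (a, \<xi>, l) \<in> \<Phi> \<longrightarrow> (a, (\<lambda>\<alpha>. c * \<xi> \<alpha>), c * l) \<in> \<Phi>)"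

lemma linear_bundle_zero: "linear_bundle X \<Phi> \<Longrightarrow> a \<in> X \<Longrightarrow> (a, (\<lambda>_. 0), 0) \<in> \<Phi>"
  and linear_bundle_add: "linear_bundle X \<Phi> \<Longrightarrow> (a, \<xi>, l) \<in> \<Phi> \<Longrightarrow> (a, \<eta>, m) \<in> \<Phi> \<Longrightarrow> (a, (\<lambda>\<alpha>. \<xi> \<alpha> + \<eta> \<alpha>), l + m) \<in> \<Phi>"
  and linear_bundle_scale: "linear_bundle X \<Phi> \<Longrightarrow> (a, \<xi>, l) \<in> \<Phi> \<Longrightarrow> (a, (\<lambda>\<alpha>. c * \<xi> \<alpha>), c * l) \<in> \<Phi>"
  unfolding linear_bundle_def by blast+

lemma linear_bundle_diff:
  assumes "linear_bundle X \<Phi>" "(a, \<xi>, l) \<in> \<Phi>" "(a, \<eta>, m) \<in> \<Phi>"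
  shows "(a, (\<lambda>\<alpha>. \<xi> \<alpha> - \<eta> \<alpha>), l - m) \<in> \<Phi>"
  using linear_bundle_add[OF assms(1,2) linear_bundle_scale[OF assms(1,3), of "-1"]] by simp

lemma linear_bundle_sum:
  assumes "linear_bundle X \<Phi>" "a \<in> X" "finite I" "\<And>i. i \<in> I \<Longrightarrow> (a, \<xi> i, l i) \<in> \<Phi>"
  shows "(a, (\<lambda>\<alpha>. \<Sum>i\<in>I. c i * \<xi> i \<alpha>), \<Sum>i\<in>I. c i * l i) \<in> \<Phi>"
  using assms(3,4)
proof (induction I)
  case empty
  then show ?case using linear_bundle_zero[OF assms(1,2)] by simp
next
  case (insert i I)
  then show ?case
    using linear_bundle_add[OF assms(1) linear_bundle_scale[OF assms(1), of a "\<xi> i" "l i" "c i"]] by simp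
qed

text \<open>The difference of two distinct values over one functional is a multiple of the vertical
  vector.\<close>

lemma linear_bundle_unique:
  assumes "linear_bundle X \<Phi>" "(a, (\<lambda>_. 0), 1) \<notin> \<Phi>" "(a, \<xi>, l) \<in> \<Phi>" "(a, \<xi>, m) \<in> \<Phi>"
  shows "l = m"
proof (rule ccontr)
  assume "l \<noteq> m"
  then have "(a, (\<lambda>_. 0), 1) \<in> \<Phi>"
    using linear_bundle_scale[OF assms(1) linear_bundle_diff[OF assms(1,3,4)], of "1 / (l - m)"] by simp
  then show False using assms(2) by simp
qed

lemma linear_bundle_Phi0: "linear_bundle X (Phi0 p X f)"
  unfolding linear_bundle_def
proof (intro conjI allI ballI impI)
  fix a assume "a \<in> X"
  then show "(a, (\<lambda>_. 0), 0) \<in> Phi0 p X f"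
    unfolding Phi0_def by (intro CollectI exI[of _ a] exI[of _ 0]) auto
next
  fix a \<xi> l \<eta> m assume "(a, \<xi>, l) \<in> Phi0 p X f" "(a, \<eta>, m) \<in> Phi0 p X f"
  then obtain c d where "a \<in> X" "\<xi> = (\<lambda>\<alpha>. c * delta p a \<alpha>)" "l = c * f a" "\<eta> = (\<lambda>\<alpha>. d * delta p a \<alpha>)" "m = d * f a"
    unfolding Phi0_def by auto
  then show "(a, (\<lambda>\<alpha>. \<xi> \<alpha> + \<eta> \<alpha>), l + m) \<in> Phi0 p X f"
    unfolding Phi0_def by (intro CollectI exI[of _ a] exI[of _ "c + d"]) (auto simp: distrib_right)
next
  fix a \<xi> l c assume "(a, \<xi>, l) \<in> Phi0 p X f"
  then obtain d where "a \<in> X" "\<xi> = (\<lambda>\<alpha>. d * delta p a \<alpha>)" "l = d * f a"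
    unfolding Phi0_def by auto
  then show "(a, (\<lambda>\<alpha>. c * \<xi> \<alpha>), c * l) \<in> Phi0 p X f"
    unfolding Phi0_def by (intro CollectI exI[of _ a] exI[of _ "c * d"]) (auto simp: mult_ac)
qed

lemma linear_bundle_rhoPhi: "linear_bundle X (rhoPhi p X \<Phi>)"
  unfolding linear_bundle_def rhoPhi_def using lspan2_zero lspan2_add lspan2_scale by auto

lemma linear_bundle_iterate: "linear_bundle X ((rhoPhi p X ^^ j) (Phi0 p X f))"
  by (cases j) (auto simp: linear_bundle_Phi0 linear_bundle_rhoPhi)

lemma small_scale: "small p a b \<eta> \<Longrightarrow> \<bar>c\<bar> \<le> 1 \<Longrightarrow> small p a b (\<lambda>\<alpha>. c * \<eta> \<alpha>)"
proof -
  assume s: "small p a b \<eta>" and c: "\<bar>c\<bar> \<le> 1"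
  have "norm (a - b) ^ (p - mdeg \<alpha>) * \<bar>dcomp p (\<lambda>\<alpha>. c * \<eta> \<alpha>) \<alpha> b\<bar> \<le> 1" if "\<alpha> \<in> Idx p" for \<alpha>
  proof -
    let ?u = "norm (a - b) ^ (p - mdeg \<alpha>) * \<bar>dcomp p \<eta> \<alpha> b\<bar>"
    have "?u \<le> 1" using s that by (auto simp: small_def)
    then have "\<bar>c\<bar> * ?u \<le> 1 * 1" using c by (intro mult_mono) auto
    then show ?thesis by (simp add: dcomp_scale abs_mult mult_ac)
  qed
  then show ?thesis by (auto simp: small_def)
qed

lemma small_zero: "small p a b (\<lambda>_. 0)"
  by (simp add: small_def dcomp_def dapp_def)

lemma DeltaPhiI:
  "a \<in> X \<Longrightarrow> b \<in> X \<Longrightarrow> (a, \<xi>, l) \<in> \<Phi> \<Longrightarrow> (b, \<eta>, m) \<in> \<Phi> \<Longrightarrow> small p a b \<eta> \<Longrightarrow>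
    (a, b, (\<lambda>\<alpha>. \<xi> \<alpha> + \<eta> \<alpha>), l + m) \<in> DeltaPhi p X \<Phi>"
  unfolding DeltaPhi_def by blast

lemma rhoPhiI: "a \<in> X \<Longrightarrow> (a, a, z, l) \<in> closure (DeltaPhi p X \<Phi>) \<Longrightarrow> (a, z, l) \<in> rhoPhi p X \<Phi>"
  using subsetD[OF lspan2_superset, of "(z, l)" "{w. (a, a, w) \<in> closure (DeltaPhi p X \<Phi>)}"]
  by (simp add: rhoPhi_def)

lemma Phi_iterate_base: "a \<in> fst ` ((rhoPhi p X ^^ j) (Phi0 p X f)) \<Longrightarrow> a \<in> X"
  by (cases j) (auto simp: Phi0_def rhoPhi_def)

text \<open>Taking b = a and \<eta> = 0 in \<open>DeltaPhi\<close> returns each element of the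
  previous bundle, since the zero functional is always small.\<close>

lemma Phi_iterate_mono:
  assumes "i \<le> j"
  shows "(rhoPhi p X ^^ i) (Phi0 p X f) \<subseteq> (rhoPhi p X ^^ j) (Phi0 p X f)"
proof -
  have step: "(rhoPhi p X ^^ k) (Phi0 p X f) \<subseteq> (rhoPhi p X ^^ Suc k) (Phi0 p X f)" for k
  proof
    let ?\<Phi> = "(rhoPhi p X ^^ k) (Phi0 p X f)"
    fix w assume w: "w \<in> ?\<Phi>"
    obtain a \<xi> l where wa: "w = (a, \<xi>, l)" by (cases w)
    have a: "a \<in> X" using Phi_iterate_base[of a k p X f] w wa by force
    have "(a, a, (\<lambda>\<alpha>. \<xi> \<alpha> + 0), l + 0) \<in> DeltaPhi p X ?\<Phi>"
      by (rule DeltaPhiI[OF a a _ linear_bundle_zero[OF linear_bundle_iterate a] small_zero]) (use w wa in simp)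
    then have "(a, a, \<xi>, l) \<in> closure (DeltaPhi p X ?\<Phi>)" using closure_subset by auto
    then show "w \<in> (rhoPhi p X ^^ Suc k) (Phi0 p X f)"
      using a wa by (simp add: rhoPhiI)
  qed
  show ?thesis
    by (rule lift_Suc_mono_le[where f="\<lambda>k. (rhoPhi p X ^^ k) (Phi0 p X f)", OF step assms])
qed

text \<open>The restriction to |c| at most 1 is essential to the argument: smallness is a bound by
  1, so only shrinking preserves it.\<close>

lemma DeltaPhi_scale:
  assumes "linear_bundle X \<Phi>" "(a, b, \<zeta>, \<nu>) \<in> DeltaPhi p X \<Phi>" "\<bar>c\<bar> \<le> 1"
  shows "(a, b, (\<lambda>\<alpha>. c * \<zeta> \<alpha>), c * \<nu>) \<in> DeltaPhi p X \<Phi>"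
proof -
  obtain \<xi> \<eta> l m where *: "\<zeta> = (\<lambda>\<alpha>. \<xi> \<alpha> + \<eta> \<alpha>)" "\<nu> = l + m" "a \<in> X" "b \<in> X" "(a, \<xi>, l) \<in> \<Phi>" "(b, \<eta>, m) \<in> \<Phi>" "small p a b \<eta>"
    using assms(2) unfolding DeltaPhi_def by auto
  have "(a, b, (\<lambda>\<alpha>. c * \<xi> \<alpha> + c * \<eta> \<alpha>), c * l + c * m) \<in> DeltaPhi p X \<Phi>"
    by (rule DeltaPhiI) (use * linear_bundle_scale[OF assms(1)] small_scale[OF _ assms(3)] in auto)
  then show ?thesis by (simp add: * distrib_left)
qed

lemma DeltaPhi_limit:
  assumes "a \<in> X" "A \<longlonglongrightarrow> a" "B \<longlonglongrightarrow> a" "\<And>\<beta>. (\<lambda>n. \<zeta> n \<beta>) \<longlonglongrightarrow> z \<beta>" "\<nu> \<longlonglongrightarrow> l"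
    and "\<And>n. (A n, B n, \<zeta> n, \<nu> n) \<in> DeltaPhi p X \<Phi>"
  shows "(a, z, l) \<in> rhoPhi p X \<Phi>"
proof -
  have "(\<lambda>n. (A n, B n, \<zeta> n, \<nu> n)) \<longlonglongrightarrow> (a, a, z, l)"
    using assms(2-5) by (intro tendsto_Pair tendsto_coordinatewiseI)
  then have "(a, a, z, l) \<in> closure (DeltaPhi p X \<Phi>)"
    by (rule Lim_in_closed_set[OF closed_closure, rotated 2])
       (use assms(6) closure_subset in \<open>auto intro!: always_eventually\<close>)
  then show ?thesis using assms(1) by (simp add: rhoPhiI)
qed

text \<open>If the values \<open>\<nu> n\<close> were unbounded, dividing by them would put \<open>(0, 1)\<close> into the limit fibre.\<close>

lemma DeltaPhi_convergent_subseq: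
  assumes lin: "linear_bundle X \<Phi>" and "a \<in> X" and no: "(a, (\<lambda>_. 0), 1) \<notin> rhoPhi p X \<Phi>"
    and lim: "A \<longlonglongrightarrow> a" "B \<longlonglongrightarrow> a" "\<And>\<beta>. (\<lambda>n. \<zeta> n \<beta>) \<longlonglongrightarrow> z \<beta>"
    and D: "\<And>n. (A n, B n, \<zeta> n, \<nu> n) \<in> DeltaPhi p X \<Phi>"
  shows "\<exists>r l. strict_mono r \<and> (\<nu> \<circ> r) \<longlonglongrightarrow> l \<and> (a, z, l) \<in> rhoPhi p X \<Phi>"
proof -
  have "Bseq \<nu>"
  proof (rule ccontr)
    assume nb: "\<not> Bseq \<nu>"
    have "\<exists>n\<ge>k. real k < \<bar>\<nu> n\<bar>" for k
    proof (rule ccontr)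
      assume "\<not> ?thesis"
      then have "\<forall>n\<ge>k. norm (\<nu> n) \<le> real k + 1" by (auto simp: not_less)
      then have "Bseq \<nu>"
        by (intro BfunI[of _ "real k + 1"]) (auto simp: eventually_sequentially)
      then show False using nb by simp
    qed
    then obtain N where N: "\<And>k. k \<le> N k" "\<And>k. real k < \<bar>\<nu> (N k)\<bar>" by metis
    have Nlim: "filterlim N sequentially sequentially"
      using N(1) by (rule filterlim_at_top_mono[OF filterlim_ident always_eventually[OF allI]])
    \<comment> \<open>The shift makes every |\<nu> (?M k)| exceed 1, so dividing by it is a scaling
      that \<open>DeltaPhi_scale\<close> permits.\<close>
    let ?M = "\<lambda>k. N (Suc k)"
    have Mlim: "filterlim ?M sequentially sequentially"
      using filterlim_compose[OF Nlim filterlim_Suc] .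
    have big: "1 \<le> \<bar>\<nu> (?M k)\<bar>" for k using N(2)[of "Suc k"] by simp
    have inv0: "(\<lambda>k. 1 / \<nu> (?M k)) \<longlonglongrightarrow> 0"
    proof (rule Lim_null_comparison)
      show "\<forall>\<^sub>F k in sequentially. norm (1 / \<nu> (?M k)) \<le> inverse (real (Suc k))"
      proof (intro always_eventually allI)
        fix k
        have "1 / \<bar>\<nu> (?M k)\<bar> \<le> 1 / real (Suc k)"
          using N(2)[of "Suc k"] by (intro divide_left_mono) (auto intro!: mult_pos_pos)
        then show "norm (1 / \<nu> (?M k)) \<le> inverse (real (Suc k))" by (simp add: divide_inverse abs_inverse)
      qed
    qed (rule LIMSEQ_inverse_real_of_nat)
    have "(a, (\<lambda>_. 0), 1) \<in> rhoPhi p X \<Phi>"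
    proof (rule DeltaPhi_limit[where A="\<lambda>k. A (?M k)" and B="\<lambda>k. B (?M k)"
          and \<zeta>="\<lambda>k \<alpha>. 1 / \<nu> (?M k) * \<zeta> (?M k) \<alpha>" and \<nu>="\<lambda>k. 1 / \<nu> (?M k) * \<nu> (?M k)"])
      show "(\<lambda>k. A (?M k)) \<longlonglongrightarrow> a" "(\<lambda>k. B (?M k)) \<longlonglongrightarrow> a"
        using filterlim_compose[OF lim(1) Mlim] filterlim_compose[OF lim(2) Mlim] by auto
      show "(\<lambda>k. 1 / \<nu> (?M k) * \<zeta> (?M k) \<beta>) \<longlonglongrightarrow> 0" for \<beta>
        using tendsto_mult[OF inv0 filterlim_compose[OF lim(3)[of \<beta>] Mlim]] by simp
      have "1 / \<nu> (?M k) * \<nu> (?M k) = 1" for k using big[of k] by auto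
      then show "(\<lambda>k. 1 / \<nu> (?M k) * \<nu> (?M k)) \<longlonglongrightarrow> 1" by simp
      show "(A (?M k), B (?M k), (\<lambda>\<alpha>. 1 / \<nu> (?M k) * \<zeta> (?M k) \<alpha>), 1 / \<nu> (?M k) * \<nu> (?M k)) \<in> DeltaPhi p X \<Phi>" for k
        by (rule DeltaPhi_scale[OF lin D]) (use big[of k] in \<open>auto simp: abs_divide divide_le_eq_1\<close>)
    qed fact
    then show False using no by simp
  qed
  then have "bounded (range \<nu>)" by (simp add: Bseq_eq_bounded)
  then obtain l r where r: "strict_mono r" "(\<nu> \<circ> r) \<longlonglongrightarrow> l"
    using bounded_imp_convergent_subsequence by blast
  have "(a, z, l) \<in> rhoPhi p X \<Phi>"
  proof (rule DeltaPhi_limit[where A="A \<circ> r" and B="B \<circ> r" and \<zeta>="\<zeta> \<circ> r" and \<nu>="\<nu> \<circ> r"])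
    show "(\<lambda>n. (\<zeta> \<circ> r) n \<beta>) \<longlonglongrightarrow> z \<beta>" for \<beta>
      using LIMSEQ_subseq_LIMSEQ[OF lim(3)[of \<beta>] r(1)] by (simp add: o_def)
  qed (use assms r D in \<open>auto intro: LIMSEQ_subseq_LIMSEQ\<close>)
  then show ?thesis using r by blast
qed

lemma mdeg_single: "mdeg ((\<lambda>_. 0)(i := k)) = k"
proof -
  have "(\<Sum>j\<in>UNIV. ((\<lambda>_. 0)(i := k)) j) = (\<Sum>j\<in>UNIV. if j = i then k else 0)"
    by (intro sum.cong) auto
  then show ?thesis by (simp add: mdeg_def)
qed

text \<open>Powers of one coordinate already give p + 1 multi-indices. Hence p + 2 is within the 2
  (r + 1) iterations that define \<open>nabla\<close>.\<close>

lemma dimP_ge: "p < dimP p TYPE('n::finite)"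
proof -
  obtain i :: 'n where True by simp
  let ?g = "\<lambda>k. (\<lambda>_::'n. 0::nat)(i := k)"
  have "inj_on ?g {..p}" by (auto simp: inj_on_def dest: fun_cong[of _ _ i])
  then have "Suc p = card (?g ` {..p})" by (simp add: card_image)
  also have "\<dots> \<le> card (Idx p :: 'n mindex set)"
    by (intro card_mono finite_Idx) (auto simp: Idx_def mdeg_single)
  finally show ?thesis by (simp add: dimP_def)
qed

text \<open>The zero functional lies in every fibre of \<open>tau\<close> and has the value 0 in
  \<open>nabla\<close>; a vertical vector in any earlier iterate would survive into
  \<open>nabla\<close> and give it the second value 1.\<close>

lemma nabla_no_vertical:
  fixes X :: "(real^'n::finite) set"
  assumes "nabla_is_function p X f" "a \<in> X" "j \<le> 2 * (dimP p TYPE('n) + 1)"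
  shows "(a, (\<lambda>_. 0), 1) \<notin> (rhoPhi p X ^^ j) (Phi0 p X f)"
proof
  assume 1: "(a, (\<lambda>_. 0), 1) \<in> (rhoPhi p X ^^ j) (Phi0 p X f)"
  have "(\<lambda>_. 0) \<in> lspan B" for B :: "('n mindex \<Rightarrow> real) set"
    unfolding lspan_def by (intro CollectI exI[of _ "{}"]) auto
  moreover have "dimP p TYPE('n) \<noteq> 0" using dimP_ge[of p, where 'n='n] by simp
  then obtain k where "2 * dimP p TYPE('n) = Suc k" by (cases "2 * dimP p TYPE('n)") auto
  ultimately have "(a, (\<lambda>_. 0)) \<in> tau p X"
    using assms(2) by (simp add: tau_def rhoE_def)
  moreover have "(a, (\<lambda>_. 0), 1) \<in> nabla p X f"
    using 1 Phi_iterate_mono[OF assms(3)] unfolding nabla_def by blast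
  moreover have "(a, (\<lambda>_. 0), 0) \<in> nabla p X f"
    unfolding nabla_def by (rule linear_bundle_zero[OF linear_bundle_iterate assms(2)])
  ultimately show False
    using assms(1) unfolding nabla_is_function_def by (metis zero_neq_one)
qed

section \<open>The Whitney field in a chart\<close>

lemma Dl_replicate_zero:
  fixes g :: "'a::euclidean_space \<Rightarrow> real"
  assumes "open S" "Ck_on k g S" "z \<in> S" "k > 0"
  shows "Dl (replicate k 0) g z = 0"
proof -
  obtain j where j: "k = Suc j" using assms(4) by (cases k) auto
  show ?thesis using Dl_expand[OF assms(1), of "replicate j 0" g z 0] assms j by simp
qed

lemma mfact_ge_1: "1 \<le> mfact \<alpha>"
  unfolding mfact_def by (intro prod_ge_1) (simp add: fact_ge_1)

lemma dcomp_sum: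
  "dcomp p (\<lambda>\<beta>. \<Sum>k\<in>I. c k * \<xi> k \<beta>) \<alpha> b = (\<Sum>k\<in>I. c k * dcomp p (\<xi> k) \<alpha> b)"
proof -
  have "dapp p (\<lambda>\<beta>. \<Sum>k\<in>I. c k * \<xi> k \<beta>) P = (\<Sum>k\<in>I. c k * dapp p (\<xi> k) P)" for P
    unfolding dapp_def
    by (simp add: sum_distrib_left) (subst sum.swap, simp add: mult_ac)
  then show ?thesis by (simp add: dcomp_def)
qed

text \<open>\<open>\<psi>\<close> lives on an open set of the full space, but only directions in L
  stay on the manifold. The projection \<open>pr\<close> lets a point x of the full space supply
  such a direction \<open>pr x - z\<close>, so that the Whitney field is defined on all of the
  space.\<close>

locale chart =
  fixes p :: nat and X X0 W L :: "(real^'n::finite) set" and f :: "real^'n \<Rightarrow> real"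
    and \<psi> pr :: "real^'n \<Rightarrow> real^'n"
  assumes W: "open W" and Ck_psi: "Ck_on p \<psi> W"
    and L: "subspace L" and pr: "linear pr" "\<And>x. pr x \<in> L" "\<And>x. x \<in> L \<Longrightarrow> pr x = x"
    and X_L: "\<And>z. z \<in> W \<Longrightarrow> \<psi> z \<in> X \<Longrightarrow> z \<in> L"
    and X0: "X0 \<subseteq> X"
    and X0_int: "\<And>z. z \<in> W \<Longrightarrow> \<psi> z \<in> X0 \<Longrightarrow> \<exists>r>0. \<forall>y\<in>L. dist y z < r \<longrightarrow> y \<in> W \<and> \<psi> y \<in> X0"
    and X0_dense: "\<And>z. z \<in> W \<Longrightarrow> \<psi> z \<in> X \<Longrightarrow> \<exists>u. (\<forall>n. u n \<in> W \<and> \<psi> (u n) \<in> X0) \<and> u \<longlonglongrightarrow> z"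
    and no_vertical: "\<And>a j. a \<in> X \<Longrightarrow> j \<le> Suc (Suc p) \<Longrightarrow> (a, (\<lambda>_. 0), 1) \<notin> (rhoPhi p X ^^ j) (Phi0 p X f)"
begin

abbreviation Phi :: "nat \<Rightarrow> ((real^'n) \<times> ('n mindex \<Rightarrow> real) \<times> real) set" where
  "Phi j \<equiv> (rhoPhi p X ^^ j) (Phi0 p X f)"

text \<open>The functional \<open>P \<mapsto> D\<^sub>v\<^sup>k(P \<circ> \<psi>)(z)\<close>, given by its values on monomials.\<close>

definition dl :: "real^'n \<Rightarrow> real^'n \<Rightarrow> nat \<Rightarrow> 'n mindex \<Rightarrow> real" where
  "dl z v k = (\<lambda>\<beta>. if \<beta> \<in> Idx p then Dl (replicate k v) (\<lambda>x. mono \<beta> (\<psi> x)) z else 0)"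

lemma Ck_psi_coord: "Ck_on p (\<lambda>x. \<psi> x $ i) W"
  by (rule Ck_on_bounded_linear_comp[OF bounded_linear_vec_nth W Ck_psi])

lemma Ck_mono_psi: "Ck_on p (\<lambda>x. mono \<beta> (\<psi> x)) W"
  by (intro Ck_on_mono_comp W Ck_psi_coord)

lemma Ck_psi_shift: "Ck_on p (\<lambda>x. (\<psi> x - b) $ i) W"
  unfolding vector_minus_component by (intro Ck_on_diff W Ck_psi_coord Ck_on_const)

text \<open>The shifted monomial has degree at most p, and differentiation is linear in its
  expansion in the basis, so the formula defining \<open>dl\<close> on basis monomials carries over
  to it.\<close>

lemma dcomp_dl:
  assumes "\<alpha> \<in> Idx p" "k \<le> p" "z \<in> W"
  shows "dcomp p (dl z v k) \<alpha> b = Dl (replicate k v) (\<lambda>x. mono \<alpha> (\<psi> x - b)) z / mfact \<alpha>"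
proof -
  obtain c where c: "\<And>x. 1 / mfact \<alpha> * mono \<alpha> (x - b) = (\<Sum>\<beta>\<in>Idx p. c \<beta> * mono \<beta> x)"
    using mono_shift_Ppoly[OF assms(1), of "1 / mfact \<alpha>" b] unfolding Ppoly_def by blast
  have Ck: "Ck_on (length (replicate k v)) g W" if "Ck_on p g W" for g :: "real^'n \<Rightarrow> real"
    using Ck_on_le[OF that assms(2)] by simp
  have "dcomp p (dl z v k) \<alpha> b = (\<Sum>\<beta>\<in>Idx p. c \<beta> * dl z v k \<beta>)"
    unfolding dcomp_def by (rule dapp_eq) (simp add: c[symmetric])
  also have "\<dots> = (\<Sum>\<beta>\<in>Idx p. Dl (replicate k v) (\<lambda>x. c \<beta> * mono \<beta> (\<psi> x)) z)"
    by (intro sum.cong refl) (simp add: dl_def Dl_cmult[OF W Ck[OF Ck_mono_psi] assms(3)])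
  also have "\<dots> = Dl (replicate k v) (\<lambda>x. \<Sum>\<beta>\<in>Idx p. c \<beta> * mono \<beta> (\<psi> x)) z"
    by (rule Dl_sum[OF W _ assms(3), symmetric]) (intro Ck Ck_on_cmult W Ck_mono_psi)
  also have "\<dots> = Dl (replicate k v) (\<lambda>x. 1 / mfact \<alpha> * mono \<alpha> (\<psi> x - b)) z"
    by (simp only: c)
  also have "\<dots> = 1 / mfact \<alpha> * Dl (replicate k v) (\<lambda>x. mono \<alpha> (\<psi> x - b)) z"
    by (rule Dl_cmult[OF W _ assms(3)]) (intro Ck Ck_on_mono_comp W Ck_psi_shift)
  finally show ?thesis by simp
qed

text \<open>Subtracting \<open>\<psi> z\<close> makes each coordinate of size h at scale h, so a
  monomial of index \<alpha> is of size h^|\<alpha>|. The free scale h is later set to a step length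
  or to |y - z|. The Lipschitz bound assumes p > 0, as \<open>\<psi>\<close> is merely continuous
  for p = 0.\<close>

lemma local_bounds:
  assumes "z0 \<in> W"
  obtains C d where "C \<ge> 1" "d > 0" "ball z0 d \<subseteq> W"
    and "\<And>z h \<alpha> k v. z \<in> ball z0 d \<Longrightarrow> 0 < h \<Longrightarrow> h \<le> 1 \<Longrightarrow> \<alpha> \<in> Idx p \<Longrightarrow> k \<le> p \<Longrightarrow>
        \<bar>dcomp p (dl z v k) \<alpha> (\<psi> z)\<bar> \<le> C * h ^ mdeg \<alpha> * (norm v / h) ^ k"
    and "\<And>y z. y \<in> ball z0 d \<Longrightarrow> z \<in> ball z0 d \<Longrightarrow> p > 0 \<Longrightarrow> norm (\<psi> y - \<psi> z) \<le> C * norm (y - z)"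
proof -
  have "\<forall>i. \<exists>A. eventually (\<lambda>z. dbd p A 1 (\<lambda>x. \<psi> x $ i) z) (nhds z0)"
    using dbd_locally[OF W assms Ck_psi_coord] by blast
  then obtain A where A: "\<And>i. eventually (\<lambda>z. dbd p (A i) 1 (\<lambda>x. \<psi> x $ i) z) (nhds z0)" by metis
  have "eventually (\<lambda>z. z \<in> W \<and> (\<forall>i. dbd p (A i) 1 (\<lambda>x. \<psi> x $ i) z)) (nhds z0)"
    using eventually_nhds_in_open[OF W assms] eventually_all_finite[OF A] by (rule eventually_conj)
  then obtain d where d: "d > 0" "\<And>z. dist z z0 < d \<Longrightarrow> z \<in> W" "\<And>z i. dist z z0 < d \<Longrightarrow> dbd p (A i) 1 (\<lambda>x. \<psi> x $ i) z"
    unfolding eventually_nhds_metric by blast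
  define B where "B = (\<Sum>i\<in>UNIV. A i) + 1"
  have A0: "A i \<ge> 0" for i using d(3)[of z0 i] d(1) dbd_nonneg by force
  have AB: "A i \<le> B" for i
    using member_le_sum[of i UNIV A] A0 by (simp add: B_def add_increasing2)
  have B1: "B \<ge> 1" using A0 by (simp add: B_def sum_nonneg)
  have dB: "dbd p B 1 (\<lambda>x. \<psi> x $ i) z" if "z \<in> ball z0 d" for z i
    using d(3)[of z i] that AB[of i] by (auto simp: dist_commute intro: dbd_mono)
  define C where "C = max ((2 ^ p) ^ CARD('n) * (2 ^ p * B) ^ p) (real CARD('n) * B)"
  have pB: "(2::real) ^ p * B \<ge> 1" using B1 one_le_power[of "2::real" p] mult_mono[of 1 "2 ^ p" 1 B] by simp
  have c1: "1 \<le> ((2::real) ^ p) ^ CARD('n) * (2 ^ p * B) ^ p"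
    using one_le_power[OF pB, of p] one_le_power[OF one_le_power[of "2::real" p], of "CARD('n)"]
      mult_mono[of 1 "((2::real) ^ p) ^ CARD('n)" 1 "(2 ^ p * B) ^ p"] by simp
  have "C \<ge> 1" unfolding C_def using c1 by (simp add: le_max_iff_disj)
  moreover note d(1)
  moreover have "ball z0 d \<subseteq> W" using d(2) by (auto simp: dist_commute)
  moreover have "\<bar>dcomp p (dl z v k) \<alpha> (\<psi> z)\<bar> \<le> C * h ^ mdeg \<alpha> * (norm v / h) ^ k"
    if z: "z \<in> ball z0 d" and h: "0 < h" "h \<le> 1" and al: "\<alpha> \<in> Idx p" and k: "k \<le> p" for z h \<alpha> k v
  proof -
    have zW: "z \<in> W" using z d(2) by (auto simp: dist_commute)
    \<comment> \<open>The value at z is 0, and every derivative has at least one factor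
      \<open>norm v\<close>; since h \<le> 1 this yields the extra factor h.\<close>
    have db: "dbd p (B * h) h (\<lambda>x. (\<psi> x - \<psi> z) $ i) z" for i
      unfolding dbd_def
    proof (intro allI impI)
      fix vs :: "(real^'n) list" assume l: "length vs \<le> p"
      show "\<bar>Dl vs (\<lambda>x. (\<psi> x - \<psi> z) $ i) z\<bar> \<le> B * h * (\<Prod>v\<leftarrow>vs. norm v / h)"
      proof (cases "vs = []")
        case True
        then show ?thesis using B1 h by simp
      next
        case False
        have "Dl vs (\<lambda>x. (\<psi> x - \<psi> z) $ i) z = Dl vs (\<lambda>x. \<psi> x $ i) z - Dl vs (\<lambda>x. \<psi> z $ i) z"
          unfolding vector_minus_component
          by (rule Dl_diff[OF W Ck_on_le[OF Ck_psi_coord l] Ck_on_const zW])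
        then have "\<bar>Dl vs (\<lambda>x. (\<psi> x - \<psi> z) $ i) z\<bar> \<le> B * (\<Prod>v\<leftarrow>vs. norm v)"
          using False dbdD[OF dB[OF z] l, of i] by (simp add: Dl_const)
        also have "\<dots> = B * h ^ length vs * (\<Prod>v\<leftarrow>vs. norm v / h)"
          using h by (simp add: norm_prod_divide)
        also have "\<dots> \<le> B * h ^ 1 * (\<Prod>v\<leftarrow>vs. norm v / h)"
          using False h B1 by (intro mult_right_mono mult_left_mono power_decreasing norm_prod_nonneg) (auto simp: Suc_le_eq)
        finally show ?thesis by simp
      qed
    qed
    have dm: "dbd p ((2 ^ p) ^ CARD('n) * (2 ^ p * (B * h)) ^ mdeg \<alpha>) h (\<lambda>x. mono \<alpha> (\<psi> x - \<psi> z)) z"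
      by (rule dbd_mono_comp[OF W zW Ck_psi_shift h(1) db])
    have m: "mdeg \<alpha> \<le> p" using al by (simp add: Idx_def)
    have vh: "(norm v / h) ^ k \<ge> 0" using h by simp
    have "\<bar>dcomp p (dl z v k) \<alpha> (\<psi> z)\<bar> = \<bar>Dl (replicate k v) (\<lambda>x. mono \<alpha> (\<psi> x - \<psi> z)) z\<bar> / mfact \<alpha>"
      using mfact_ge_1[of \<alpha>] by (simp add: dcomp_dl[OF al k zW] abs_divide)
    also have "\<dots> \<le> \<bar>Dl (replicate k v) (\<lambda>x. mono \<alpha> (\<psi> x - \<psi> z)) z\<bar> / 1"
      using mfact_ge_1[of \<alpha>] by (intro divide_left_mono) auto
    also have "\<dots> \<le> (2 ^ p) ^ CARD('n) * (2 ^ p * (B * h)) ^ mdeg \<alpha> * (norm v / h) ^ k"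
      using dbdD[OF dm, of "replicate k v"] k by (simp add: prod_list_replicate)
    also have "\<dots> = ((2 ^ p) ^ CARD('n) * (2 ^ p * B) ^ mdeg \<alpha>) * h ^ mdeg \<alpha> * (norm v / h) ^ k"
      by (simp add: power_mult_distrib)
    also have "\<dots> \<le> C * h ^ mdeg \<alpha> * (norm v / h) ^ k"
    proof (intro mult_right_mono)
      have "(2 ^ p) ^ CARD('n) * (2 ^ p * B) ^ mdeg \<alpha> \<le> (2 ^ p) ^ CARD('n) * (2 ^ p * B) ^ p"
        using pB m by (intro mult_left_mono power_increasing) auto
      also have "\<dots> \<le> C" unfolding C_def by (rule max.cobounded1)
      finally show "(2 ^ p) ^ CARD('n) * (2 ^ p * B) ^ mdeg \<alpha> \<le> C" .
    qed (use h vh in auto)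
    finally show ?thesis .
  qed
  moreover have "norm (\<psi> y - \<psi> z) \<le> C * norm (y - z)" if y: "y \<in> ball z0 d" and z: "z \<in> ball z0 d" and p: "p > 0" for y z
  proof -
    obtain q where q: "p = Suc q" using p by (cases p) auto
    have comp: "\<bar>\<psi> y $ i - \<psi> z $ i\<bar> \<le> B * norm (y - z)" for i
    proof -
      let ?g = "\<lambda>x. \<psi> x $ i"
      have der: "(?g has_derivative frechet_derivative ?g (at x)) (at x)" if "x \<in> ball z0 d" for x
        using Ck_on_has_derivative[OF Ck_psi_coord[unfolded q]] d(2)[of x] that by (auto simp: dist_commute)
      have "onorm (frechet_derivative ?g (at x)) \<le> B" if x: "x \<in> ball z0 d" for x
      proof (rule onorm_le)
        fix v
        show "norm (frechet_derivative ?g (at x) v) \<le> B * norm v"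
          using dbdD[OF dB[OF x], of "[v]" i] p by simp
      qed
      from differentiable_bound[OF convex_ball has_derivative_at_withinI[OF der] this y z]
      show ?thesis by simp
    qed
    have "norm (\<psi> y - \<psi> z) \<le> (\<Sum>i\<in>UNIV. \<bar>(\<psi> y - \<psi> z) $ i\<bar>)" by (rule norm_le_l1_cart)
    also have "\<dots> \<le> (\<Sum>i\<in>(UNIV::'n set). B * norm (y - z))" using comp by (intro sum_mono) simp
    also have "\<dots> = real CARD('n) * B * norm (y - z)" by simp
    also have "\<dots> \<le> C * norm (y - z)" by (intro mult_right_mono) (auto simp: C_def)
    finally show ?thesis .
  qed
  ultimately show ?thesis by (rule that)
qed

lemma psi_tendsto: "z \<in> W \<Longrightarrow> (\<And>n. u n \<in> W) \<Longrightarrow> u \<longlonglongrightarrow> z \<Longrightarrow> (\<lambda>n. \<psi> (u n)) \<longlonglongrightarrow> \<psi> z"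
  using Ck_on_continuous_on[OF Ck_psi] by (simp add: continuous_on_tendsto_compose)

text \<open>The summand at z has components of order t^(|\<alpha>| - k), and the distance of the two
  base points is O(t). After weighting and division by t there remains t^(p - k - 1), which is
  bounded because k < p in the induction step.\<close>

lemma dl_interior:
  assumes "k \<le> p" "z \<in> W" "\<psi> z \<in> X0" "v \<in> L"
  shows "\<exists>l. (\<psi> z, dl z v k, l) \<in> Phi k"
  using assms(1,2,3)
proof (induction k arbitrary: z)
  case 0
  have "dl z v 0 = (\<lambda>\<alpha>. 1 * delta p (\<psi> z) \<alpha>)" by (auto simp: dl_def delta_def)
  then have "(\<psi> z, dl z v 0, 1 * f (\<psi> z)) \<in> Phi0 p X f"
    using 0 X0 unfolding Phi0_def by blast
  then show ?case by auto
next
  case (Suc k)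
  have k: "k < p" "k \<le> p" using Suc.prems by auto
  have psX: "\<psi> z \<in> X" using Suc.prems X0 by blast
  have zL: "z \<in> L" using X_L Suc.prems psX by blast
  obtain r where r: "r > 0" "\<And>y. y \<in> L \<Longrightarrow> dist y z < r \<Longrightarrow> y \<in> W \<and> \<psi> y \<in> X0"
    using X0_int[OF Suc.prems(2,3)] by blast
  obtain C d where C: "C \<ge> 1" and d: "d > 0" "ball z d \<subseteq> W"
    and bd: "\<And>z' h \<alpha> k v. z' \<in> ball z d \<Longrightarrow> 0 < h \<Longrightarrow> h \<le> 1 \<Longrightarrow> \<alpha> \<in> Idx p \<Longrightarrow> k \<le> p \<Longrightarrow>
        \<bar>dcomp p (dl z' v k) \<alpha> (\<psi> z')\<bar> \<le> C * h ^ mdeg \<alpha> * (norm v / h) ^ k"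
    and lip: "\<And>y z'. y \<in> ball z d \<Longrightarrow> z' \<in> ball z d \<Longrightarrow> p > 0 \<Longrightarrow> norm (\<psi> y - \<psi> z') \<le> C * norm (y - z')"
    by (rule local_bounds[OF Suc.prems(2)]) (rule that)
  \<comment> \<open>At least 1, so that its powers increase with the exponent and v = 0 needs no
    separate treatment.\<close>
  define V where "V = max 1 (norm v)"
  have V: "V \<ge> 1" "norm v \<le> V" by (auto simp: V_def)
  \<comment> \<open>Keeps z + t v within r, where \<open>\<psi>\<close> maps into X0, within d,
    where the bounds hold, and keeps t at most 1.\<close>
  define \<tau> where "\<tau> = min 1 (min r d / (2 * V))"
  have \<tau>: "\<tau> > 0" "\<tau> \<le> 1" "\<tau> * V < min r d"
  proof -
    show "\<tau> > 0" "\<tau> \<le> 1" using r d V by (auto simp: \<tau>_def)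
    have "\<tau> \<le> min r d / (2 * V)" by (simp add: \<tau>_def)
    then have "\<tau> * V \<le> min r d / (2 * V) * V" using V by (intro mult_right_mono) auto
    also have "\<dots> = min r d / 2" using V by simp
    also have "\<dots> < min r d" using r(1) d(1) by (simp add: min_def)
    finally show "\<tau> * V < min r d" .
  qed
  define t where "t n = \<tau> / real (Suc n)" for n
  have t: "t n > 0" "t n \<le> 1" "t n * norm v < r" "t n * norm v < d" for n
  proof -
    show 1: "t n > 0" using \<tau> by (simp add: t_def)
    have 2: "t n \<le> \<tau>" using \<tau> by (simp add: t_def divide_le_eq mult_le_cancel_left1)
    then show "t n \<le> 1" using \<tau> by linarith
    have "t n * norm v \<le> \<tau> * V" using 1 2 V by (intro mult_mono) auto
    then show "t n * norm v < r" "t n * norm v < d" using \<tau>(3) by auto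
  qed
  have tlim: "t \<longlonglongrightarrow> 0"
  proof -
    have "(\<lambda>n. \<tau> * inverse (real (Suc n))) \<longlonglongrightarrow> \<tau> * 0"
      by (intro tendsto_mult tendsto_const LIMSEQ_inverse_real_of_nat)
    then show ?thesis by (simp add: t_def[abs_def] divide_inverse)
  qed
  define zn where "zn n = z + t n *\<^sub>R v" for n
  have znL: "zn n \<in> L" for n
    unfolding zn_def using zL assms(4) L by (intro subspace_add subspace_scale)
  have dzn: "dist (zn n) z = t n * norm v" for n
    using t(1)[of n] by (simp add: zn_def dist_norm)
  have zn: "zn n \<in> W" "\<psi> (zn n) \<in> X0" "zn n \<in> ball z d" for n
    using r(2)[OF znL, of n] dzn t by (auto simp: dist_commute)
  obtain l where l: "\<And>n. (\<psi> (zn n), dl (zn n) v k, l n) \<in> Phi k"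
    using Suc.IH[OF k(2) zn(1,2)] by metis
  obtain m where m: "(\<psi> z, dl z v k, m) \<in> Phi k" using Suc.IH[OF k(2) Suc.prems(2,3)] by blast
  \<comment> \<open>The largest of the constants (C V)^(p - |\<alpha>|) C V^k over all admissible
    \<alpha> and k.\<close>
  define D where "D = (C * V) ^ p * C * V ^ p"
  have D: "D > 0" using C V by (simp add: D_def)
  define c where "c n = 1 / (D * t n)" for n
  have small: "small p (\<psi> (zn n)) (\<psi> z) (\<lambda>\<beta>. - c n * dl z v k \<beta>)" for n
    unfolding small_def
  proof
    fix \<alpha> :: "'n mindex" assume al: "\<alpha> \<in> Idx p"
    then have mp: "mdeg \<alpha> \<le> p" by (simp add: Idx_def)
    let ?t = "t n"
    have CV: "C * V \<ge> 1" using C V mult_mono[of 1 C 1 V] by simp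
    have "norm (\<psi> (zn n) - \<psi> z) \<le> C * (?t * norm v)"
      using lip[OF zn(3), of z n] d k dzn[of n] by (simp add: dist_norm)
    also have "\<dots> \<le> C * V * ?t" using C V t(1)[of n] by (simp add: mult.assoc mult.commute[of ?t])
    finally have 1: "norm (\<psi> (zn n) - \<psi> z) ^ (p - mdeg \<alpha>) \<le> (C * V * ?t) ^ (p - mdeg \<alpha>)"
      by (rule power_mono) simp
    have "\<bar>dcomp p (dl z v k) \<alpha> (\<psi> z)\<bar> \<le> C * ?t ^ mdeg \<alpha> * (norm v / ?t) ^ k"
      by (rule bd) (use d t al k in auto)
    also have "\<dots> \<le> C * ?t ^ mdeg \<alpha> * (V / ?t) ^ k"
      using C t(1)[of n] V by (intro mult_left_mono power_mono divide_right_mono) auto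
    finally have 2: "\<bar>dcomp p (dl z v k) \<alpha> (\<psi> z)\<bar> \<le> C * ?t ^ mdeg \<alpha> * (V / ?t) ^ k" .
    have "norm (\<psi> (zn n) - \<psi> z) ^ (p - mdeg \<alpha>) * \<bar>dcomp p (\<lambda>\<beta>. - c n * dl z v k \<beta>) \<alpha> (\<psi> z)\<bar>
        = c n * (norm (\<psi> (zn n) - \<psi> z) ^ (p - mdeg \<alpha>) * \<bar>dcomp p (dl z v k) \<alpha> (\<psi> z)\<bar>)"
      using D t(1)[of n] unfolding dcomp_scale by (simp add: abs_mult c_def)
    also have "\<dots> \<le> c n * ((C * V * ?t) ^ (p - mdeg \<alpha>) * (C * ?t ^ mdeg \<alpha> * (V / ?t) ^ k))"
      using 1 2 D t(1)[of n] C V by (intro mult_left_mono mult_mono) (auto simp: c_def)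
    also have "\<dots> = ((C * V) ^ (p - mdeg \<alpha>) * C * V ^ k) / D * (?t ^ (p - mdeg \<alpha>) * ?t ^ mdeg \<alpha> / (?t ^ Suc k))"
      using t(1)[of n] by (simp add: c_def power_mult_distrib power_divide mult_ac)
    also have "?t ^ (p - mdeg \<alpha>) * ?t ^ mdeg \<alpha> = ?t ^ p"
      using mp by (simp flip: power_add)
    also have "((C * V) ^ (p - mdeg \<alpha>) * C * V ^ k) / D * (?t ^ p / ?t ^ Suc k) \<le> 1 * 1"
    proof (intro mult_mono)
      have "(C * V) ^ (p - mdeg \<alpha>) * C * V ^ k \<le> (C * V) ^ p * C * V ^ p"
        using CV C V k by (intro mult_mono power_increasing) auto
      then have "(C * V) ^ (p - mdeg \<alpha>) * C * V ^ k \<le> D" by (simp only: D_def)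
      then show "((C * V) ^ (p - mdeg \<alpha>) * C * V ^ k) / D \<le> 1"
        using D by simp
      have "?t ^ p \<le> ?t ^ Suc k" using t[of n] k by (intro power_decreasing) auto
      then show "?t ^ p / ?t ^ Suc k \<le> 1" using t(1)[of n] by (simp add: divide_le_eq_1)
    qed (use t(1)[of n] in auto)
    finally show "norm (\<psi> (zn n) - \<psi> z) ^ (p - mdeg \<alpha>) * \<bar>dcomp p (\<lambda>\<beta>. - c n * dl z v k \<beta>) \<alpha> (\<psi> z)\<bar> \<le> 1"
      by simp
  qed
  have Del: "(\<psi> (zn n), \<psi> z, (\<lambda>\<beta>. c n * dl (zn n) v k \<beta> + - c n * dl z v k \<beta>), c n * l n + - c n * m) \<in> DeltaPhi p X (Phi k)" for n
    by (rule DeltaPhiI[OF _ psX linear_bundle_scale[OF linear_bundle_iterate l] linear_bundle_scale[OF linear_bundle_iterate m] small])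
       (use zn X0 in auto)
  have znlim: "zn \<longlonglongrightarrow> z"
  proof -
    have "(\<lambda>n. z + t n *\<^sub>R v) \<longlonglongrightarrow> z + 0 *\<^sub>R v" by (intro tendsto_intros tlim)
    then show ?thesis by (simp add: zn_def[abs_def])
  qed
  have conv: "(\<lambda>n. c n * dl (zn n) v k \<beta> + - c n * dl z v k \<beta>) \<longlonglongrightarrow> 1 / D * dl z v (Suc k) \<beta>" for \<beta>
  proof (cases "\<beta> \<in> Idx p")
    case True
    let ?g = "\<lambda>x. mono \<beta> (\<psi> x)"
    have "((\<lambda>s. Dl (replicate k v) ?g (z + s *\<^sub>R v)) has_real_derivative Dl (replicate (Suc k) v) ?g (z + 0 *\<^sub>R v)) (at 0)"
      by (rule Dl_line_derivative[OF Ck_mono_psi k(1)]) (use Suc.prems in simp)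
    then have "((\<lambda>h. (Dl (replicate k v) ?g (z + h *\<^sub>R v) - Dl (replicate k v) ?g z) / h) \<longlongrightarrow> Dl (replicate (Suc k) v) ?g z) (at 0)"
      by (simp add: DERIV_def)
    moreover have "filterlim t (at 0) sequentially"
      using tlim t(1) by (auto simp: filterlim_at less_imp_neq[symmetric] intro!: always_eventually)
    ultimately have "(\<lambda>n. (Dl (replicate k v) ?g (z + t n *\<^sub>R v) - Dl (replicate k v) ?g z) / t n) \<longlonglongrightarrow> Dl (replicate (Suc k) v) ?g z"
      by (rule filterlim_compose)
    from tendsto_mult[OF tendsto_const[of "1 / D"] this]
    show ?thesis using True by (simp add: dl_def c_def zn_def diff_divide_distrib right_diff_distrib)
  qed (simp add: dl_def)
  have "(\<psi> z, (\<lambda>_. 0), 1) \<notin> rhoPhi p X (Phi k)"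
    using no_vertical[OF psX, of "Suc k"] k by simp
  from DeltaPhi_convergent_subseq[OF linear_bundle_iterate psX this psi_tendsto[OF Suc.prems(2) zn(1) znlim] tendsto_const conv Del]
  obtain l' where "(\<psi> z, (\<lambda>\<beta>. 1 / D * dl z v (Suc k) \<beta>), l') \<in> Phi (Suc k)" by auto
  from linear_bundle_scale[OF linear_bundle_iterate this, of D]
  show ?case using D by auto
qed

text \<open>Pairs with equal base points and zero second summand use only the closure in
  \<open>rhoPhi\<close>. Convergence holds because derivatives of order k \<le> p of monomials
  composed with \<open>\<psi>\<close> are continuous.\<close>

lemma dl_all:
  assumes "k \<le> p" "z \<in> W" "\<psi> z \<in> X" "v \<in> L"
  shows "\<exists>l. (\<psi> z, dl z v k, l) \<in> Phi (Suc p)"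
proof -
  obtain u where u: "\<And>n. u n \<in> W" "\<And>n. \<psi> (u n) \<in> X0" "u \<longlonglongrightarrow> z" using X0_dense[OF assms(2,3)] by blast
  have "\<exists>l. (\<psi> (u n), dl (u n) v k, l) \<in> Phi p" for n
    using dl_interior[OF assms(1) u(1,2) assms(4)] Phi_iterate_mono[OF assms(1)] by blast
  then obtain l where l: "\<And>n. (\<psi> (u n), dl (u n) v k, l n) \<in> Phi p" by metis
  have uX: "\<psi> (u n) \<in> X" for n using u X0 by blast
  have Del: "(\<psi> (u n), \<psi> (u n), (\<lambda>\<beta>. dl (u n) v k \<beta> + 0), l n + 0) \<in> DeltaPhi p X (Phi p)" for n
    by (rule DeltaPhiI[OF uX uX l linear_bundle_zero[OF linear_bundle_iterate uX] small_zero])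
  have conv: "(\<lambda>n. dl (u n) v k \<beta> + 0) \<longlonglongrightarrow> dl z v k \<beta>" for \<beta>
  proof (cases "\<beta> \<in> Idx p")
    case True
    have "continuous_on W (Dl (replicate k v) (\<lambda>x. mono \<beta> (\<psi> x)))"
      using Dl_continuous_on[OF Ck_mono_psi] assms(1) by simp
    then show ?thesis
      using True u assms(2) by (simp add: dl_def continuous_on_tendsto_compose)
  qed (simp add: dl_def)
  have "(\<psi> z, (\<lambda>_. 0), 1) \<notin> rhoPhi p X (Phi p)"
    using no_vertical[OF assms(3), of "Suc p"] by simp
  from DeltaPhi_convergent_subseq[OF linear_bundle_iterate assms(3) this psi_tendsto[OF assms(2) u(1,3)] psi_tendsto[OF assms(2) u(1,3)] conv Del]
  show ?thesis by auto
qed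

text \<open>The functional \<open>P \<mapsto> T\<^sub>z(P \<circ> \<psi>)(\<pi> x)\<close>.\<close>

definition kap :: "real^'n \<Rightarrow> real^'n \<Rightarrow> 'n mindex \<Rightarrow> real" where
  "kap z x = (\<lambda>\<beta>. \<Sum>k\<le>p. 1 / fact k * dl z (pr x - z) k \<beta>)"

text \<open>Over points of X the choice is no choice: \<open>G_mem\<close> gives existence and
  \<open>G_unique\<close> uniqueness of the value.\<close>

definition G :: "real^'n \<Rightarrow> real^'n \<Rightarrow> real" where
  "G z x = (SOME l. (\<psi> z, kap z x, l) \<in> Phi (Suc p))"

lemma G_mem:
  assumes "z \<in> W" "\<psi> z \<in> X" shows "(\<psi> z, kap z x, G z x) \<in> Phi (Suc p)"
proof -
  have "pr x - z \<in> L" using pr X_L[OF assms] L by (simp add: subspace_diff)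
  then have "\<exists>l. (\<psi> z, dl z (pr x - z) k, l) \<in> Phi (Suc p)" if "k \<le> p" for k
    using dl_all[OF that assms] by blast
  then obtain l where "\<And>k. k \<le> p \<Longrightarrow> (\<psi> z, dl z (pr x - z) k, l k) \<in> Phi (Suc p)" by metis
  then have "(\<psi> z, kap z x, \<Sum>k\<le>p. 1 / fact k * l k) \<in> Phi (Suc p)"
    unfolding kap_def by (intro linear_bundle_sum[OF linear_bundle_iterate assms(2)]) auto
  then show ?thesis unfolding G_def by (rule someI)
qed

lemma G_unique:
  assumes "z \<in> W" "\<psi> z \<in> X" "(\<psi> z, kap z x, l) \<in> Phi (Suc p)" shows "G z x = l"
  by (rule linear_bundle_unique[OF linear_bundle_iterate no_vertical[OF assms(2)] G_mem[OF assms(1,2)] assms(3)]) simp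

text \<open>Since \<open>pr z = z\<close>, all Taylor terms of positive order vanish and
  \<open>kap z z\<close> is the point evaluation at \<open>\<psi> z\<close>, whose value is known
  from \<open>Phi0\<close>.\<close>

lemma G_diag:
  assumes "z \<in> W" "\<psi> z \<in> X" shows "G z z = f (\<psi> z)"
proof (rule G_unique[OF assms])
  have "kap z z \<beta> = 1 * delta p (\<psi> z) \<beta>" for \<beta>
  proof (cases "\<beta> \<in> Idx p")
    case True
    have "pr z - z = 0" using pr(3)[OF X_L[OF assms]] by simp
    then have "kap z z \<beta> = (\<Sum>k\<le>p. 1 / fact k * Dl (replicate k 0) (\<lambda>x. mono \<beta> (\<psi> x)) z)"
      using True by (simp add: kap_def dl_def)
    also have "\<dots> = (\<Sum>k\<le>p. if k = 0 then mono \<beta> (\<psi> z) else 0)"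
      using Dl_replicate_zero[OF W Ck_on_le[OF Ck_mono_psi] assms(1)] by (intro sum.cong) auto
    finally show ?thesis using True by (simp add: delta_def)
  qed (simp add: kap_def dl_def delta_def)
  then have "(\<psi> z, kap z z, 1 * f (\<psi> z)) \<in> Phi0 p X f"
    using assms(2) unfolding Phi0_def by (intro CollectI exI[of _ "\<psi> z"] exI[of _ 1]) auto
  then have "(\<psi> z, kap z z, f (\<psi> z)) \<in> Phi 0" by simp
  then show "(\<psi> z, kap z z, f (\<psi> z)) \<in> Phi (Suc p)"
    using Phi_iterate_mono[of 0 "Suc p" p X f] by blast
qed

lemma kap_Ppoly:
  assumes "z \<in> W" shows "(\<lambda>x. kap z x \<beta>) \<in> Ppoly p"
proof (cases "\<beta> \<in> Idx p")
  case True
  have aff: "(\<lambda>x. (pr x - z) \<bullet> b) \<in> Ppoly (Suc 0)" for b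
  proof -
    have "linear (\<lambda>x. pr x \<bullet> b)" using pr(1) by (simp add: linear_iff inner_add_left)
    from Ppoly_linear[OF this, of "- (z \<bullet> b)"] show ?thesis by (simp add: inner_diff_left)
  qed
  have "(\<lambda>x. Dl (replicate k (pr x - z)) (\<lambda>x. mono \<beta> (\<psi> x)) z) \<in> Ppoly p" if "k \<le> p" for k
    by (rule Ppoly_mono[OF Dl_replicate_Ppoly[OF W assms Ck_on_le[OF Ck_mono_psi that]] that]) (rule aff)
  then show ?thesis using True unfolding kap_def dl_def by (simp, intro Ppoly_sum) (auto intro: Ppoly_cmult[of _ p "1 / fact _", simplified])
qed (simp add: kap_def dl_def Ppoly_const)

text \<open>Each component of \<open>kap z x\<close> is a polynomial in x, hence a combination of
  its values at finitely many points with weights polynomial in x. Linearity of the fibre and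
  uniqueness of values transfer this formula to G.\<close>

lemma G_Ppoly:
  assumes "z \<in> W" "\<psi> z \<in> X" shows "G z \<in> Ppoly p"
proof -
  obtain J and pt :: "('n \<Rightarrow> nat) \<Rightarrow> real^'n" and w where J: "finite J" "\<And>g. g \<in> J \<Longrightarrow> norm (pt g) \<le> 1"
    "\<And>\<alpha> c. \<alpha> \<in> Idx p \<Longrightarrow> (\<Sum>g\<in>J. w \<alpha> g * (\<Sum>\<beta>\<in>Idx p. c \<beta> * mono \<beta> (pt g))) = c \<alpha>"
    by (rule Ppoly_interpolation[where p=p]) (rule that)
  \<comment> \<open>Polynomials that reproduce every element of \<open>Ppoly p\<close> from its
    values on the grid.\<close>
  define Lg where "Lg g x = (\<Sum>\<alpha>\<in>Idx p. w \<alpha> g * mono \<alpha> x)" for g and x :: "real^'n"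
  have interp: "P x = (\<Sum>g\<in>J. Lg g x * P (pt g))" if P: "P \<in> Ppoly p" for P x
  proof -
    obtain c where c: "\<And>x. P x = (\<Sum>\<alpha>\<in>Idx p. c \<alpha> * mono \<alpha> x)" using P unfolding Ppoly_def by blast
    have "P x = (\<Sum>\<alpha>\<in>Idx p. (\<Sum>g\<in>J. w \<alpha> g * P (pt g)) * mono \<alpha> x)"
      unfolding c using J(3)[of _ c] by simp
    also have "\<dots> = (\<Sum>g\<in>J. Lg g x * P (pt g))"
      unfolding Lg_def sum_distrib_right by (subst sum.swap) (simp add: mult_ac)
    finally show ?thesis .
  qed
  have Gx: "G z x = (\<Sum>g\<in>J. Lg g x * G z (pt g))" for x
  proof (rule G_unique[OF assms])
    have "kap z x = (\<lambda>\<beta>. \<Sum>g\<in>J. Lg g x * kap z (pt g) \<beta>)"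
      using interp[OF kap_Ppoly[OF assms(1)]] by blast
    moreover have "(\<psi> z, (\<lambda>\<beta>. \<Sum>g\<in>J. Lg g x * kap z (pt g) \<beta>), \<Sum>g\<in>J. Lg g x * G z (pt g)) \<in> Phi (Suc p)"
      by (rule linear_bundle_sum[OF linear_bundle_iterate assms(2) J(1) G_mem[OF assms]])
    ultimately show "(\<psi> z, kap z x, \<Sum>g\<in>J. Lg g x * G z (pt g)) \<in> Phi (Suc p)" by simp
  qed
  have "Lg g \<in> Ppoly p" for g
    unfolding Lg_def[abs_def] by (intro Ppoly_sum Ppoly_monomial) (auto simp: Idx_def)
  from Ppoly_cmult[OF this] have "(\<lambda>x. Lg g x * c) \<in> Ppoly p" for g c
    by (simp add: mult.commute)
  then have "(\<lambda>x. \<Sum>g\<in>J. Lg g x * G z (pt g)) \<in> Ppoly p" by (intro Ppoly_sum)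
  moreover have "G z = (\<lambda>x. \<Sum>g\<in>J. Lg g x * G z (pt g))" by (rule ext) (rule Gx)
  ultimately show ?thesis by (simp only:)
qed

lemma kap_Tay:
  assumes "\<beta> \<in> Idx p" shows "kap z x \<beta> = Tay p (\<lambda>x. mono \<beta> (\<psi> x)) z (pr x)"
  using assms by (simp add: kap_def dl_def Tay_def)

text \<open>Both terms are Taylor polynomials of one function evaluated at \<open>pr x\<close>, with
  base points y and z at distance at most (B + 1) |y - z| from it, so both are close to the
  function's value there.\<close>

lemma kap_diff_small:
  assumes z0: "z0 \<in> W" and B: "B \<ge> 1" "\<And>x. norm (pr x) \<le> B * norm x" and e: "e > 0"
  shows "\<exists>d>0. \<forall>y z x. y \<in> L \<longrightarrow> z \<in> L \<longrightarrow> dist y z0 < d \<longrightarrow> dist z z0 < d \<longrightarrow> norm (x - z) \<le> norm (y - z) \<longrightarrow>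
     \<bar>kap y x \<beta> - kap z x \<beta>\<bar> \<le> e * norm (y - z) ^ p"
proof (cases "\<beta> \<in> Idx p")
  case True
  let ?g = "\<lambda>x. mono \<beta> (\<psi> x)"
  define e' where "e' = e / (2 * (B + 1) ^ p)"
  have Bp: "(B + 1) ^ p > 0" using B by simp
  have e': "e' > 0" "2 * e' * (B + 1) ^ p = e" using e Bp B(1) by (auto simp: e'_def)
  obtain d where d: "d > 0" "\<And>z x. z \<in> ball z0 d \<Longrightarrow> x \<in> ball z0 d \<Longrightarrow> \<bar>?g x - Tay p ?g z x\<bar> \<le> e' * norm (x - z) ^ p"
    using Taylor_locally[OF W z0 Ck_mono_psi e'(1)] by blast
  \<comment> \<open>|y - z| is below 2 d', so \<open>pr x\<close> is within 2 B d' + d' = d of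
    z0.\<close>
  define d' where "d' = d / (2 * B + 1)"
  have d': "d' > 0" "(2 * B + 1) * d' = d" using d(1) B by (auto simp: d'_def)
  have d'd: "d' \<le> d" using d' B mult_right_mono[of 1 "2 * B + 1" d'] by simp
  have "\<bar>kap y x \<beta> - kap z x \<beta>\<bar> \<le> e * norm (y - z) ^ p"
    if yz: "y \<in> L" "z \<in> L" "dist y z0 < d'" "dist z z0 < d'" and x: "norm (x - z) \<le> norm (y - z)" for y z x
  proof -
    let ?h = "norm (y - z)"
    have "norm (pr x - z) = norm (pr (x - z))" using pr(3)[OF yz(2)] linear_diff[OF pr(1)] by simp
    also have "\<dots> \<le> B * ?h" using B(2)[of "x - z"] x B(1) mult_left_mono[of "norm (x - z)" ?h B] by linarith
    finally have 1: "norm (pr x - z) \<le> B * ?h" .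
    have "norm (pr x - y) \<le> norm (pr x - z) + ?h"
      using norm_triangle_ineq4[of "pr x - z" "y - z"] by simp
    then have 2: "norm (pr x - y) \<le> (B + 1) * ?h" using 1 by (simp add: distrib_right)
    have 3: "norm (pr x - z) \<le> (B + 1) * ?h" using 1 by (simp add: distrib_right add_increasing2)
    have h: "?h < 2 * d'" using yz dist_triangle2[of y z z0] by (simp add: dist_norm[symmetric])
    have "dist (pr x) z0 \<le> norm (pr x - z) + dist z z0" using dist_triangle[of "pr x" z0 z] by (simp add: dist_norm)
    also have "\<dots> < B * (2 * d') + d'"
      using 1 h yz(4) B(1) mult_left_mono[of ?h "2 * d'" B] by linarith
    also have "\<dots> = d" using d'(2) by (simp add: algebra_simps)
    finally have px: "pr x \<in> ball z0 d" by (simp add: dist_commute)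
    have yb: "y \<in> ball z0 d" "z \<in> ball z0 d" using yz d'd by (auto simp: dist_commute)
    have "\<bar>kap y x \<beta> - kap z x \<beta>\<bar> \<le> e' * norm (pr x - y) ^ p + e' * norm (pr x - z) ^ p"
      using d(2)[OF yb(1) px] d(2)[OF yb(2) px] unfolding kap_Tay[OF True] by linarith
    also have "\<dots> \<le> e' * ((B + 1) * ?h) ^ p + e' * ((B + 1) * ?h) ^ p"
      using 2 3 e' by (intro add_mono mult_left_mono power_mono) auto
    also have "\<dots> = e * ?h ^ p" unfolding e'(2)[symmetric] by (simp add: power_mult_distrib)
    finally show ?thesis .
  qed
  then show ?thesis using d'(1) by blast
qed (use e in \<open>auto simp: kap_def dl_def intro!: exI[of _ 1]\<close>)

text \<open>The direction \<open>pr x - z\<close> has length at most B |y - z|, so at scale h = |y -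
  z| every Taylor term has components of size h^|\<alpha>|. Weighting by (C h)^(p - |\<alpha>|)
  gives h^p in total, which the divisor absorbs.\<close>

lemma kap_small:
  assumes z0: "z0 \<in> W" and B: "B \<ge> 1" "\<And>x. norm (pr x) \<le> B * norm x"
  obtains D d where "D > 0" "d > 0"
    "\<And>y z x. z \<in> L \<Longrightarrow> dist y z0 < d \<Longrightarrow> dist z z0 < d \<Longrightarrow> y \<noteq> z \<Longrightarrow> norm (x - z) \<le> norm (y - z) \<Longrightarrow>
      small p (\<psi> y) (\<psi> z) (\<lambda>\<beta>. - (1 / (D * norm (y - z) ^ p)) * kap z x \<beta>)"
proof -
  obtain C d where C: "C \<ge> 1" and d: "d > 0" "ball z0 d \<subseteq> W"
    and bd: "\<And>z h \<alpha> k v. z \<in> ball z0 d \<Longrightarrow> 0 < h \<Longrightarrow> h \<le> 1 \<Longrightarrow> \<alpha> \<in> Idx p \<Longrightarrow> k \<le> p \<Longrightarrow>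
        \<bar>dcomp p (dl z v k) \<alpha> (\<psi> z)\<bar> \<le> C * h ^ mdeg \<alpha> * (norm v / h) ^ k"
    and lip: "\<And>y z. y \<in> ball z0 d \<Longrightarrow> z \<in> ball z0 d \<Longrightarrow> p > 0 \<Longrightarrow> norm (\<psi> y - \<psi> z) \<le> C * norm (y - z)"
    by (rule local_bounds[OF z0]) (rule that)
  \<comment> \<open>Lipschitz factors to the power at most p, times p + 1 Taylor terms bounded by C
    B^p each.\<close>
  define D where "D = C ^ p * (real (Suc p) * (C * B ^ p))"
  have D: "D > 0" using C B by (simp add: D_def)
  \<comment> \<open>The radius 1 / 2 keeps |y - z| at most 1, the range of h in
    \<open>local_bounds\<close>.\<close>
  have "small p (\<psi> y) (\<psi> z) (\<lambda>\<beta>. - (1 / (D * norm (y - z) ^ p)) * kap z x \<beta>)"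
    if zL: "z \<in> L" and yz: "dist y z0 < min d (1 / 2)" "dist z z0 < min d (1 / 2)" "y \<noteq> z" and x: "norm (x - z) \<le> norm (y - z)" for y z x
    unfolding small_def
  proof
    fix \<alpha> :: "'n mindex" assume al: "\<alpha> \<in> Idx p"
    then have mp: "mdeg \<alpha> \<le> p" by (simp add: Idx_def)
    let ?h = "norm (y - z)"
    have h: "0 < ?h" "?h \<le> 1" using yz dist_triangle2[of y z z0] by (auto simp: dist_norm[symmetric])
    have yb: "y \<in> ball z0 d" "z \<in> ball z0 d" using yz by (auto simp: dist_commute)
    have "norm (pr x - z) = norm (pr (x - z))" using pr(3)[OF zL] linear_diff[OF pr(1)] by simp
    also have "\<dots> \<le> B * ?h" using B(2)[of "x - z"] x B(1) mult_left_mono[of "norm (x - z)" ?h B] by linarith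
    finally have vb: "norm (pr x - z) / ?h \<le> B" using h by (simp add: divide_le_eq)
    have k: "\<bar>1 / fact k * dcomp p (dl z (pr x - z) k) \<alpha> (\<psi> z)\<bar> \<le> C * B ^ p * ?h ^ mdeg \<alpha>" if kp: "k \<le> p" for k
    proof -
      have "\<bar>1 / fact k * dcomp p (dl z (pr x - z) k) \<alpha> (\<psi> z)\<bar> \<le> 1 * \<bar>dcomp p (dl z (pr x - z) k) \<alpha> (\<psi> z)\<bar>"
        unfolding abs_mult by (intro mult_right_mono) (auto simp: fact_ge_1)
      also have "\<dots> \<le> C * ?h ^ mdeg \<alpha> * (norm (pr x - z) / ?h) ^ k"
        using bd[OF yb(2) h al kp] by simp
      also have "\<dots> \<le> C * ?h ^ mdeg \<alpha> * B ^ p"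
      proof (rule mult_left_mono)
        have "(norm (pr x - z) / ?h) ^ k \<le> B ^ k" using vb h by (intro power_mono) auto
        also have "\<dots> \<le> B ^ p" using B kp by (intro power_increasing)
        finally show "(norm (pr x - z) / ?h) ^ k \<le> B ^ p" .
      qed (use C in auto)
      finally show ?thesis by (simp add: mult_ac)
    qed
    have "\<bar>dcomp p (kap z x) \<alpha> (\<psi> z)\<bar> \<le> (\<Sum>k\<le>p. \<bar>1 / fact k * dcomp p (dl z (pr x - z) k) \<alpha> (\<psi> z)\<bar>)"
      unfolding kap_def dcomp_sum by (rule sum_abs)
    also have "\<dots> \<le> (\<Sum>k\<le>p. C * B ^ p * ?h ^ mdeg \<alpha>)" using k by (intro sum_mono) simp
    finally have 1: "\<bar>dcomp p (kap z x) \<alpha> (\<psi> z)\<bar> \<le> real (Suc p) * (C * B ^ p) * ?h ^ mdeg \<alpha>" by simp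
    \<comment> \<open>For p = 0 the exponent is 0, so the Lipschitz bound is called upon only when
      it is available.\<close>
    have 2: "norm (\<psi> y - \<psi> z) ^ (p - mdeg \<alpha>) \<le> (C * ?h) ^ (p - mdeg \<alpha>)"
    proof (cases "p = 0")
      case False
      then show ?thesis using lip[OF yb] by (intro power_mono) auto
    qed simp
    have "norm (\<psi> y - \<psi> z) ^ (p - mdeg \<alpha>) * \<bar>dcomp p (\<lambda>\<beta>. - (1 / (D * ?h ^ p)) * kap z x \<beta>) \<alpha> (\<psi> z)\<bar>
      = 1 / (D * ?h ^ p) * (norm (\<psi> y - \<psi> z) ^ (p - mdeg \<alpha>) * \<bar>dcomp p (kap z x) \<alpha> (\<psi> z)\<bar>)"
      using D h unfolding dcomp_scale by (simp add: abs_mult)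
    also have "\<dots> \<le> 1 / (D * ?h ^ p) * ((C * ?h) ^ (p - mdeg \<alpha>) * (real (Suc p) * (C * B ^ p) * ?h ^ mdeg \<alpha>))"
      using 1 2 D h C B by (intro mult_left_mono mult_mono) auto
    also have "\<dots> = C ^ (p - mdeg \<alpha>) * (real (Suc p) * (C * B ^ p)) / D * (?h ^ (p - mdeg \<alpha>) * ?h ^ mdeg \<alpha> / ?h ^ p)"
      by (simp add: power_mult_distrib mult_ac)
    also have "?h ^ (p - mdeg \<alpha>) * ?h ^ mdeg \<alpha> / ?h ^ p = 1"
      using mp h by (simp flip: power_add)
    also have "C ^ (p - mdeg \<alpha>) * (real (Suc p) * (C * B ^ p)) / D * 1 \<le> 1"
    proof -
      have "C ^ (p - mdeg \<alpha>) * (real (Suc p) * (C * B ^ p)) \<le> D"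
        unfolding D_def using C B by (intro mult_right_mono power_increasing) auto
      then show ?thesis using D by simp
    qed
    finally show "norm (\<psi> y - \<psi> z) ^ (p - mdeg \<alpha>) * \<bar>dcomp p (\<lambda>\<beta>. - (1 / (D * ?h ^ p)) * kap z x \<beta>) \<alpha> (\<psi> z)\<bar> \<le> 1" .
  qed
  then show ?thesis using D d(1) by (intro that[of D "min d (1 / 2)"]) auto
qed

text \<open>A failure gives sequences y, z tending to z0 along which the scaled functionals tend to
  0 although their values stay at least e / D in modulus. A limit of the values would be a nonzero
  value over the zero functional.\<close>

lemma G_Whitney:
  assumes z0: "z0 \<in> W" "\<psi> z0 \<in> X" and e: "e > 0"
  shows "\<exists>d>0. \<forall>y z. y \<in> W \<longrightarrow> \<psi> y \<in> X \<longrightarrow> z \<in> W \<longrightarrow> \<psi> z \<in> X \<longrightarrow> dist y z0 < d \<longrightarrow> dist z z0 < d \<longrightarrow>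
     (\<forall>x. norm (x - z) \<le> norm (y - z) \<longrightarrow> \<bar>G y x - G z x\<bar> \<le> e * norm (y - z) ^ p)"
proof (rule ccontr)
  assume neg: "\<not> ?thesis"
  obtain B0 where B0: "\<And>x. norm (pr x) \<le> norm x * B0"
    using bounded_linear.bounded[OF linear_conv_bounded_linear[THEN iffD1, OF pr(1)]] by blast
  have "norm (pr x) \<le> norm x * max 1 B0" for x
    by (rule order_trans[OF B0 mult_left_mono]) auto
  then have B: "max 1 B0 \<ge> 1" "\<And>x. norm (pr x) \<le> max 1 B0 * norm x"
    by (auto simp: mult.commute)
  obtain D d where D: "D > 0" and d: "d > 0" and sm:
    "\<And>y z x. z \<in> L \<Longrightarrow> dist y z0 < d \<Longrightarrow> dist z z0 < d \<Longrightarrow> y \<noteq> z \<Longrightarrow> norm (x - z) \<le> norm (y - z) \<Longrightarrow>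
      small p (\<psi> y) (\<psi> z) (\<lambda>\<beta>. - (1 / (D * norm (y - z) ^ p)) * kap z x \<beta>)"
    by (rule kap_small[OF z0(1) B]) (rule that)
  have "\<exists>y z x. y \<in> W \<and> \<psi> y \<in> X \<and> z \<in> W \<and> \<psi> z \<in> X \<and> dist y z0 < d / real (Suc n) \<and> dist z z0 < d / real (Suc n) \<and>
     norm (x - z) \<le> norm (y - z) \<and> e * norm (y - z) ^ p < \<bar>G y x - G z x\<bar>" for n
  proof -
    have "d / real (Suc n) > 0" using d by simp
    then show ?thesis using neg by (meson not_less)
  qed
  then obtain y z x where yW: "\<And>n. y n \<in> W" "\<And>n. \<psi> (y n) \<in> X" and zW: "\<And>n. z n \<in> W" "\<And>n. \<psi> (z n) \<in> X"
    and dist: "\<And>n. dist (y n) z0 < d / real (Suc n)" "\<And>n. dist (z n) z0 < d / real (Suc n)"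
    and x: "\<And>n. norm (x n - z n) \<le> norm (y n - z n)"
    and gt: "\<And>n. e * norm (y n - z n) ^ p < \<bar>G (y n) (x n) - G (z n) (x n)\<bar>" by metis
  have ne: "y n \<noteq> z n" for n
  proof
    assume "y n = z n"
    then have "e * norm (y n - z n) ^ p < 0" using gt[of n] by simp
    moreover have "0 \<le> e * norm (y n - z n) ^ p" using e by simp
    ultimately show False by linarith
  qed
  have yL: "y n \<in> L" "z n \<in> L" for n using X_L yW zW by auto
  have dn: "d / real (Suc n) \<le> d" for n using d by (simp add: divide_le_eq mult_le_cancel_left1)
  have lim0: "(\<lambda>n. d / real (Suc n)) \<longlonglongrightarrow> 0"
    using tendsto_mult[OF tendsto_const[of d] LIMSEQ_inverse_real_of_nat] by (simp add: divide_inverse)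
  have lim: "u \<longlonglongrightarrow> z0" if "\<And>n. dist (u n) z0 < d / real (Suc n)" for u
  proof -
    have "(\<lambda>n. dist (u n) z0) \<longlonglongrightarrow> 0"
      by (rule Lim_null_comparison[OF always_eventually lim0]) (use that in \<open>auto intro: less_imp_le\<close>)
    then show ?thesis by (subst tendsto_dist_iff)
  qed
  define c where "c n = 1 / (D * norm (y n - z n) ^ p)" for n
  have c: "c n > 0" for n using D ne by (simp add: c_def)
  have Del: "(\<psi> (y n), \<psi> (z n), (\<lambda>\<beta>. c n * kap (y n) (x n) \<beta> + - c n * kap (z n) (x n) \<beta>), c n * G (y n) (x n) + - c n * G (z n) (x n))
     \<in> DeltaPhi p X (Phi (Suc p))" for n
  proof (rule DeltaPhiI)
    show "small p (\<psi> (y n)) (\<psi> (z n)) (\<lambda>\<beta>. - c n * kap (z n) (x n) \<beta>)"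
      unfolding c_def
      by (rule sm[OF yL(2) less_le_trans[OF dist(1) dn] less_le_trans[OF dist(2) dn] ne x])
    show "(\<psi> (y n), (\<lambda>\<beta>. c n * kap (y n) (x n) \<beta>), c n * G (y n) (x n)) \<in> Phi (Suc p)"
      by (rule linear_bundle_scale[OF linear_bundle_iterate G_mem[OF yW]])
    show "(\<psi> (z n), (\<lambda>\<beta>. - c n * kap (z n) (x n) \<beta>), - c n * G (z n) (x n)) \<in> Phi (Suc p)"
      by (rule linear_bundle_scale[OF linear_bundle_iterate G_mem[OF zW]])
  qed (use yW zW in auto)
  have conv: "(\<lambda>n. c n * kap (y n) (x n) \<beta> + - c n * kap (z n) (x n) \<beta>) \<longlonglongrightarrow> 0" for \<beta>
  proof (rule tendstoI)
    fix \<epsilon> :: real assume \<epsilon>: "\<epsilon> > 0"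
    define e2 where "e2 = \<epsilon> * D / 2"
    have e2: "e2 > 0" using \<epsilon> D by (simp add: e2_def)
    obtain d2 where d2: "d2 > 0" "\<And>y z x. y \<in> L \<Longrightarrow> z \<in> L \<Longrightarrow> dist y z0 < d2 \<Longrightarrow> dist z z0 < d2 \<Longrightarrow> norm (x - z) \<le> norm (y - z) \<Longrightarrow>
       \<bar>kap y x \<beta> - kap z x \<beta>\<bar> \<le> e2 * norm (y - z) ^ p"
      using kap_diff_small[OF z0(1) B e2] by blast
    have "eventually (\<lambda>n. dist (y n) z0 < d2) sequentially" "eventually (\<lambda>n. dist (z n) z0 < d2) sequentially"
      using tendstoD[OF lim[OF dist(1)] d2(1)] tendstoD[OF lim[OF dist(2)] d2(1)] by auto
    then show "eventually (\<lambda>n. dist (c n * kap (y n) (x n) \<beta> + - c n * kap (z n) (x n) \<beta>) 0 < \<epsilon>) sequentially"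
    proof eventually_elim
      case (elim n)
      have "\<bar>c n * kap (y n) (x n) \<beta> + - c n * kap (z n) (x n) \<beta>\<bar> = c n * \<bar>kap (y n) (x n) \<beta> - kap (z n) (x n) \<beta>\<bar>"
        using c[of n] by (simp add: abs_mult right_diff_distrib[symmetric])
      also have "\<dots> \<le> c n * (e2 * norm (y n - z n) ^ p)"
        using d2(2)[OF yL elim x] c[of n] by (intro mult_left_mono) auto
      also have "\<dots> = \<epsilon> / 2" using ne[of n] D by (simp add: c_def e2_def)
      also have "\<dots> < \<epsilon>" using \<epsilon> by simp
      finally show ?case by (simp add: dist_norm)
    qed
  qed
  have no: "(\<psi> z0, (\<lambda>_. 0), 1) \<notin> rhoPhi p X (Phi (Suc p))"
    using no_vertical[OF z0(2), of "Suc (Suc p)"] by simp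
  obtain r l where r: "strict_mono r" "((\<lambda>n. c n * G (y n) (x n) + - c n * G (z n) (x n)) \<circ> r) \<longlonglongrightarrow> l"
    and l: "(\<psi> z0, (\<lambda>_. 0), l) \<in> rhoPhi p X (Phi (Suc p))"
    using DeltaPhi_convergent_subseq[OF linear_bundle_iterate z0(2) no psi_tendsto[OF z0(1) yW(1) lim[OF dist(1)]]
        psi_tendsto[OF z0(1) zW(1) lim[OF dist(2)]] conv Del] by blast
  have "l = 0"
    by (rule linear_bundle_unique[OF linear_bundle_rhoPhi no l linear_bundle_zero[OF linear_bundle_rhoPhi z0(2)]])
  moreover have "e / D \<le> \<bar>c n * G (y n) (x n) + - c n * G (z n) (x n)\<bar>" for n
  proof -
    have "e / D = c n * (e * norm (y n - z n) ^ p)" using ne[of n] by (simp add: c_def)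
    also have "\<dots> \<le> c n * \<bar>G (y n) (x n) - G (z n) (x n)\<bar>"
      using gt[of n] c[of n] by (intro mult_left_mono) auto
    also have "\<dots> = \<bar>c n * G (y n) (x n) + - c n * G (z n) (x n)\<bar>"
      using c[of n] by (simp add: abs_mult right_diff_distrib[symmetric])
    finally show ?thesis .
  qed
  then have "e / D \<le> \<bar>l\<bar>"
    by (intro tendsto_lowerbound[OF tendsto_rabs[OF r(2)]]) (auto intro!: always_eventually)
  ultimately show False using divide_pos_pos[OF e D] by simp
qed

theorem chart_extension:
  assumes "closed K" "\<And>z. z \<in> K \<Longrightarrow> z \<in> W \<and> \<psi> z \<in> X"
  shows "\<exists>F. Ck_on p F UNIV \<and> (\<forall>z\<in>K. F z = f (\<psi> z))"
proof -
  have "\<exists>F. Ck_on p F UNIV \<and> (\<forall>z\<in>K. F z = G z z)"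
  proof (rule Whitney_extension[OF assms(1), where G=G])
    fix z :: "real^'n" assume "z \<in> K" then show "G z \<in> Ppoly p" using G_Ppoly assms(2) by blast
  next
    fix z0 :: "real^'n" and e :: real assume "z0 \<in> K" "e > 0"
    then obtain d where "d > 0" "\<forall>y z. y \<in> W \<longrightarrow> \<psi> y \<in> X \<longrightarrow> z \<in> W \<longrightarrow> \<psi> z \<in> X \<longrightarrow> dist y z0 < d \<longrightarrow> dist z z0 < d \<longrightarrow>
      (\<forall>x. norm (x - z) \<le> norm (y - z) \<longrightarrow> \<bar>G y x - G z x\<bar> \<le> e * norm (y - z) ^ p)"
      using G_Whitney[of z0 e] assms(2) by blast
    then show "\<exists>d>0. \<forall>a\<in>K. \<forall>b\<in>K. dist a z0 < d \<longrightarrow> dist b z0 < d \<longrightarrow>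
        (\<forall>x. norm (x - b) \<le> norm (a - b) \<longrightarrow> \<bar>G a x - G b x\<bar> \<le> e * norm (a - b) ^ p)"
      using assms(2) by blast
  qed
  then show ?thesis using G_diag assms(2) by auto
qed

end

section \<open>Gluing\<close>

text \<open>The scale is the Lebesgue radius of the cover, the supremum of radii of balls that fit
  into one piece. It is 1-Lipschitz because a ball of radius r about x contains the ball about y of
  radius r - dist x y.\<close>

lemma glue_extensions:
  fixes U X :: "'a::euclidean_space set" and f :: "'a \<Rightarrow> real"
  assumes U: "open U"
    and loc: "\<And>a. a \<in> U \<Longrightarrow> \<exists>V F. open V \<and> a \<in> V \<and> V \<subseteq> U \<and> Ck_on p F V \<and> (\<forall>x\<in>X \<inter> V. F x = f x)"
  shows "\<exists>F. Ck_on p F U \<and> (\<forall>x\<in>X \<inter> U. F x = f x)"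
proof -
  define ok where "ok V F \<longleftrightarrow> open V \<and> V \<subseteq> U \<and> Ck_on p F V \<and> (\<forall>x\<in>X \<inter> V. F x = f x)" for V F
  \<comment> \<open>The cap at 1 keeps the supremum finite even if U is the whole space.\<close>
  define radii where "radii x = {r. 0 < r \<and> r \<le> 1 \<and> (\<exists>V F. ok V F \<and> ball x r \<subseteq> V)}" for x
  define ell where "ell x = Sup (radii x)" for x
  have bdd: "bdd_above (radii x)" for x by (rule bdd_aboveI[of _ 1]) (auto simp: radii_def)
  have upper: "r \<le> ell x" if "r \<in> radii x" for r x
    unfolding ell_def using that bdd by (rule cSup_upper)
  have nonempty: "\<exists>r. r \<in> radii x" if x: "x \<in> U" for x
  proof -
    obtain V F where VF: "ok V F" "x \<in> V" using loc[OF x] unfolding ok_def by blast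
    then obtain r where "r > 0" "ball x r \<subseteq> V" unfolding ok_def by (meson openE)
    moreover from this have "ball x (min r 1) \<subseteq> V" by auto
    ultimately have "min r 1 \<in> radii x" using VF(1) unfolding radii_def by auto
    then show ?thesis by blast
  qed
  have pos: "0 < ell x" if x: "x \<in> U" for x
    using nonempty[OF x] upper by (fastforce simp: radii_def)
  have less: "\<exists>V F. ok V F \<and> ball x r \<subseteq> V" if xr: "x \<in> U" "r < ell x" for x r
  proof -
    obtain r' where r': "r' \<in> radii x" "r < r'"
      using less_cSupE[of r "radii x"] xr(2) nonempty[OF xr(1)] unfolding ell_def by blast
    then obtain V F where "ok V F" "ball x r' \<subseteq> V" by (auto simp: radii_def)
    moreover have "ball x r \<subseteq> ball x r'" using r'(2) by (intro subset_ball) simp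
    ultimately show ?thesis by blast
  qed
  interpret length_scale p U ell
  proof
    show "ball x (ell x) \<subseteq> U" if xU: "x \<in> U" for x
    proof
      fix y assume "y \<in> ball x (ell x)"
      then have d: "dist x y < ell x" by simp
      then obtain r where r: "dist x y < r" "r < ell x" using dense by blast
      obtain V F where "ok V F" "ball x r \<subseteq> V" using less[OF xU r(2)] by blast
      then show "y \<in> U" using r unfolding ok_def by auto
    qed
    show "ell x \<le> ell y + dist x y" if xy: "x \<in> U" "y \<in> U" for x y
      unfolding ell_def[of x]
    proof (rule cSup_least)
      show "radii x \<noteq> {}" using nonempty[OF xy(1)] by blast
      fix r assume r: "r \<in> radii x"
      show "r \<le> ell y + dist x y"
      proof (cases "r \<le> dist x y")
        case True
        then show ?thesis using pos[OF xy(2)] by simp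
      next
        case False
        have "ball y (r - dist x y) \<subseteq> ball x r"
        proof
          fix u assume "u \<in> ball y (r - dist x y)"
          then show "u \<in> ball x r" using dist_triangle[of x u y] by simp
        qed
        moreover have "r \<le> 1" "\<exists>V F. ok V F \<and> ball x r \<subseteq> V" using r by (auto simp: radii_def)
        moreover have "0 < r - dist x y" "r - dist x y \<le> r" using False by auto
        ultimately have "r - dist x y \<in> radii y"
          unfolding radii_def by (intro CollectI conjI) (simp, linarith, blast)
        then show ?thesis using upper by fastforce
      qed
    qed
  qed (use U pos in auto)
  \<comment> \<open>The supremum need not be attained; half of it is safe and still exceeds the
    support radius \<open>ell s / 4\<close> of the weight.\<close>
  have "\<exists>V F. ok V F \<and> ball s (ell s / 2) \<subseteq> V" if "s \<in> net" for s
    using less[of s "ell s / 2"] pos[of s] net(1) that by auto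
  then obtain V F where VF: "\<And>s. s \<in> net \<Longrightarrow> ok (V s) (F s) \<and> ball s (ell s / 2) \<subseteq> V s" by metis
  have "Ck_on p (avg F) U"
  proof (rule Ck_on_avg)
    fix s assume s: "s \<in> net"
    then have ls: "ell s > 0" using pos net(1) by blast
    have V: "open (V s)" "Ck_on p (F s) (V s)" using VF[OF s] by (auto simp: ok_def)
    show "Ck_on p (\<lambda>x. wt s x * F s x) U"
    proof (rule Ck_on_local)
      fix x
      show "\<exists>T. open T \<and> x \<in> T \<and> Ck_on p (\<lambda>x. wt s x * F s x) T"
      proof (cases "x \<in> V s")
        case True
        then show ?thesis
          using V Ck_on_subset[OF Ck_on_wt, of "V s" s] by (intro exI[of _ "V s"]) (auto intro!: Ck_on_mult)
      next
        case False
        \<comment> \<open>Outside its piece \<open>F s\<close> is uncontrolled, but there the weight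
          vanishes identically. This open set and \<open>V s\<close> together cover
          everything.\<close>
        let ?T = "- cball s (ell s / 4)"
        have "x \<notin> ball s (ell s / 2)" using False VF[OF s] by blast
        then have x: "x \<in> ?T" using ls by auto
        have "wt s y * F s y = 0" if "y \<in> ?T" for y
          using wt_zero[OF s, of y] that by (simp add: dist_commute)
        then have "Ck_on p (\<lambda>x. wt s x * F s x) ?T"
          by (intro Ck_on_cong_open[OF _ _ Ck_on_const[of p 0]]) auto
        then show ?thesis using x by (intro exI[of _ ?T]) auto
      qed
    qed
  qed
  moreover have "avg F x = f x" if "x \<in> X \<inter> U" for x
  proof (rule avg_eq)
    fix s assume s: "s \<in> net" "wt s x \<noteq> 0"
    have "ell s > 0" using s pos net(1) by blast
    moreover have "dist x s < ell s / 4" using wt_zero[OF s(1), of x] s(2) by (meson not_le)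
    ultimately have "x \<in> V s" using VF[OF s(1)] by (auto simp: dist_commute)
    then show "F s x = f x" using VF[OF s(1)] that by (auto simp: ok_def)
  qed (use that in auto)
  ultimately show ?thesis by blast
qed

lemma linear_projection_exists:
  fixes L :: "'a::real_vector set"
  assumes "subspace L"
  shows "\<exists>pr. linear pr \<and> (\<forall>x. pr x \<in> L) \<and> (\<forall>x\<in>L. pr x = x)"
proof -
  have "linear (id :: 'a \<Rightarrow> 'a)" "inj_on (id :: 'a \<Rightarrow> 'a) L" by (auto simp: linear_id)
  from linear_exists_left_inverse_on[OF this(1) assms this(2)]
  obtain g :: "'a \<Rightarrow> 'a" where "range g \<subseteq> L" "linear g" "\<forall>v\<in>L. g (id v) = v" by blast
  then show ?thesis by (intro exI[of _ g]) auto
qed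

theorem theorem4p24:
  fixes p :: nat
    and X M U :: "(real^'n::finite) set"
    and f :: "real^'n \<Rightarrow> real"
  assumes "open U"
    and "closed_Ck_submanifold p M U"
    and "X \<subseteq> M"
    and "X = (top_of_set M) closure_of ((top_of_set M) interior_of X)"
    and "nabla_is_function p X f"
  shows "\<exists>F. Ck_on p F U \<and> (\<forall>x\<in>X. F x = f x)"
proof -
  define X0 where "X0 = (top_of_set M) interior_of X"
  have MU: "M \<subseteq> U" "closedin (top_of_set U) M"
    using assms(2) unfolding closed_Ck_submanifold_def by auto
  have "closedin (top_of_set M) X" by (subst assms(4)) (rule closedin_closure_of)
  then have "closedin (top_of_set U) X" using MU(2) by (rule closedin_trans)
  \<comment> \<open>X is closed only relative to U; T makes the set K below closed in the whole
    space, as Whitney's theorem demands.\<close>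
  then obtain T where T: "closed T" "X = U \<inter> T" by (auto simp: closedin_closed)
  have X0X: "X0 \<subseteq> X" unfolding X0_def by (rule interior_of_subset)
  have "openin (top_of_set M) X0" unfolding X0_def by (rule openin_interior_of)
  then obtain O' where O': "open O'" "X0 = M \<inter> O'" by (auto simp: openin_open)
  have dense: "X \<subseteq> closure X0"
  proof -
    have "X = M \<inter> closure (M \<inter> X0)"
      by (subst assms(4)) (simp add: closure_of_subtopology X0_def)
    also have "\<dots> \<subseteq> closure X0" by (auto intro: subsetD[OF closure_mono])
    finally show ?thesis .
  qed
  have "\<exists>V F. open V \<and> a \<in> V \<and> V \<subseteq> U \<and> Ck_on p F V \<and> (\<forall>x\<in>X \<inter> V. F x = f x)" if aU: "a \<in> U" for a
  proof (cases "a \<in> X")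
    case False
    \<comment> \<open>Off X no values are prescribed, and U minus T is open, so the zero function
      serves.\<close>
    then show ?thesis using assms(1) T aU
      by (intro exI[of _ "U \<inter> - T"] exI[of _ "\<lambda>_. 0"]) (auto simp: Ck_on_const)
  next
    case aX: True
    obtain V W \<phi> L where V: "a \<in> V" "V \<subseteq> U" and diff: "Ck_diffeo p \<phi> V W" and L: "subspace L" and img: "\<phi> ` (M \<inter> V) = W \<inter> L"
      using assms(2,3) aX unfolding closed_Ck_submanifold_def by blast
    obtain \<psi> where VW: "open V" "open W" and hom: "homeomorphism V W \<phi> \<psi>" and C\<phi>: "Ck_on p \<phi> V" and C\<psi>: "Ck_on p \<psi> W"
      using diff unfolding Ck_diffeo_def by blast
    have \<psi>V: "\<psi> z \<in> V" "\<phi> (\<psi> z) = z" if "z \<in> W" for z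
      using hom that unfolding homeomorphism_def by blast+
    have \<phi>W: "\<phi> z \<in> W" "\<psi> (\<phi> z) = z" if "z \<in> V" for z
      using hom that unfolding homeomorphism_def by blast+
    have cont: "continuous_on V \<phi>" "continuous_on W \<psi>" using hom unfolding homeomorphism_def by blast+
    obtain pr where pr: "linear pr" "\<And>x. pr x \<in> L" "\<And>x. x \<in> L \<Longrightarrow> pr x = x"
      using linear_projection_exists[OF L] by blast
    interpret chart p X X0 W L f \<psi> pr
    proof (rule chart.intro)
      show "z \<in> L" if z: "z \<in> W" "\<psi> z \<in> X" for z
      proof -
        have "\<phi> (\<psi> z) \<in> \<phi> ` (M \<inter> V)" using z \<psi>V[OF z(1)] assms(3) by blast
        then show ?thesis using \<psi>V[OF z(1)] img by auto
      qed
      show "\<exists>r>0. \<forall>y\<in>L. dist y z < r \<longrightarrow> y \<in> W \<and> \<psi> y \<in> X0" if z: "z \<in> W" "\<psi> z \<in> X0" for z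
      proof -
        have "open (W \<inter> \<psi> -` O')" using cont(2) VW(2) O'(1) by (rule continuous_open_preimage)
        moreover have "z \<in> W \<inter> \<psi> -` O'" using z O' by auto
        ultimately obtain r where r: "r > 0" "ball z r \<subseteq> W \<inter> \<psi> -` O'" by (meson openE)
        have "y \<in> W \<and> \<psi> y \<in> X0" if y: "y \<in> L" "dist y z < r" for y
        proof -
          have yW: "y \<in> W" "\<psi> y \<in> O'" using r(2) y(2) by (auto simp: dist_commute subset_iff)
          \<comment> \<open>Points of W \<inter> L are chart images of points of M, so lying in O'
            puts \<open>\<psi> y\<close> into X0.\<close>
          then obtain m where "m \<in> M \<inter> V" "y = \<phi> m" using img y(1) by blast
          then show ?thesis using yW \<phi>W O' by auto
        qed
        then show ?thesis using r(1) by blast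
      qed
      show "\<exists>u. (\<forall>n. u n \<in> W \<and> \<psi> (u n) \<in> X0) \<and> u \<longlonglongrightarrow> z" if z: "z \<in> W" "\<psi> z \<in> X" for z
      proof -
        obtain w where w: "\<And>n. w n \<in> X0" "w \<longlonglongrightarrow> \<psi> z"
          using z(2) dense closure_sequential[of "\<psi> z" X0] by blast
        \<comment> \<open>Only a tail of the approximating sequence lies in the chart domain;
          shifting by N discards the rest.\<close>
        obtain N where N: "\<And>n. n \<ge> N \<Longrightarrow> w n \<in> V"
          using topological_tendstoD[OF w(2) VW(1) \<psi>V(1)[OF z(1)]] unfolding eventually_sequentially by blast
        have lim: "(\<lambda>n. w (n + N)) \<longlonglongrightarrow> \<psi> z" using w(2) by (rule LIMSEQ_ignore_initial_segment)
        have "(\<lambda>n. \<phi> (w (n + N))) \<longlonglongrightarrow> \<phi> (\<psi> z)"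
          by (rule continuous_on_tendsto_compose[OF cont(1) lim \<psi>V(1)[OF z(1)]]) (use N in auto)
        then show ?thesis using \<psi>V(2)[OF z(1)] N \<phi>W w(1)
          by (intro exI[of _ "\<lambda>n. \<phi> (w (n + N))"]) auto
      qed
      show "(b, (\<lambda>_. 0), 1) \<notin> (rhoPhi p X ^^ j) (Phi0 p X f)" if "b \<in> X" "j \<le> Suc (Suc p)" for b j
        using nabla_no_vertical[OF assms(5) that(1), of j] that(2) dimP_ge[of p, where 'n='n] by simp
    qed (use VW C\<psi> L pr X0X in auto)
    have "\<phi> a \<in> W" using \<phi>W V by blast
    then obtain R where R: "R > 0" "cball (\<phi> a) R \<subseteq> W" using VW(2) open_contains_cball by blast
    \<comment> \<open>Intersecting with a closed ball inside W keeps the preimage away from the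
      boundary of W, where it could fail to be closed.\<close>
    define K where "K = cball (\<phi> a) R \<inter> \<psi> -` T"
    have "closed K"
      unfolding K_def using continuous_on_subset[OF cont(2) R(2)] T(1) by (intro continuous_closed_preimage) auto
    moreover have "z \<in> W \<and> \<psi> z \<in> X" if "z \<in> K" for z
      using that R(2) \<psi>V(1) V(2) T(2) unfolding K_def by blast
    ultimately have "\<exists>H. Ck_on p H UNIV \<and> (\<forall>z\<in>K. H z = f (\<psi> z))" by (rule chart_extension)
    then obtain H where H: "Ck_on p H UNIV" "\<And>z. z \<in> K \<Longrightarrow> H z = f (\<psi> z)" by blast
    let ?V = "V \<inter> \<phi> -` ball (\<phi> a) R"
    have "open ?V" using cont(1) VW(1) open_ball by (rule continuous_open_preimage)
    moreover have "Ck_on p (\<lambda>x. H (\<phi> x)) ?V"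
      by (rule Ck_on_compose[OF \<open>open ?V\<close> open_UNIV _ H(1) Ck_on_subset[OF C\<phi>]]) auto
    moreover have "H (\<phi> x) = f x" if "x \<in> X \<inter> ?V" for x
      using H(2)[of "\<phi> x"] that \<phi>W T(2) unfolding K_def by auto
    ultimately show ?thesis using V R(1) by (intro exI[of _ ?V] exI[of _ "\<lambda>x. H (\<phi> x)"]) auto
  qed
  from glue_extensions[OF assms(1) this] show ?thesis using T(2) by blast
qed

end
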